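(* Let $(p_1,p_2,p_3)=(0,1,\infty)$ in $S^2=\mathbb{C}\cup\{\infty\}$. Let $\beta_1,\beta_3$ be non-integral real numbers greater than $-1$ and $\beta_2$ a positive integer. Consider, for a non-negative integer $N$ and mutually distinct complex numbers $a_1,\dots,a_N\in\mathbb{C}\setminus\{0,1\}$, the systems $$(\mathrm{A})\quad \frac{\beta_1}{a_j}+\frac{\beta_2}{a_j-1}-\sum_{k\ne j}\frac{2}{a_j-a_k}=0\qquad(j=1,\dots,N),$$ $$(\mathrm{B})\quad \frac{-\beta_1-2}{a_j}+\frac{\beta_2}{a_j-1}-\sum_{k\ne j}\frac{2}{a_j-a_k}=0\qquad(j=1,\dots,N),$$ where sums are over $1\le k\le N$, $k\ne j$ (both systems are void for $N=0$). Then there exists $d\sigma^2\in\mathrm{Met}(S^2)$ with divisor $\beta_1p_1+\beta_2p_2+\beta_3p_3$ if and only if one of the following occurs: 1. There exist a non-negative integer $N$ and mutually distinct $a_1,\dots,a_N\in\mathbb{C}\setminus\{0,1\}$ such that $\beta_1+\beta_2+\beta_3=2N-2$ and (A) holds. 2. There exist a non-negative integer $N$ and mutually distinct $a_1,\dots,a_N\in\mathbb{C}\setminus\{0,1\}$ such that $\beta_1-\beta_2+\beta_3=-2N-2$ and (B) holds. 3. There exist a non-negative integer $N$ and mutually distinct $a_1,\dots,a_N\in\mathbb{C}\setminus\{0,1\}$ such that $\beta_1+\beta_2-\beta_3=2N$ and (A) holds. 4. There exist a non-negative integer $N$ and mutually distinct $a_1,\dots,a_N\in\mathbb{C}\setminus\{0,1\}$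 such that $\beta_1-\beta_2-\beta_3=-2N$ and (B) holds. Moreover, such a metric is unique up to the following change: writing $d\sigma^2=g^*d\sigma_0^2$ with $g=z^{\mu}\varphi(z)$, $\mu\in\mathbb{R}\setminus\mathbb{Z}$, $\varphi$ a rational function, one replaces $d\sigma^2$ by $(tg)^*d\sigma_0^2$ with $t\in\mathbb{R}$, $t>0$.
   Context: A conformal positive semidefinite metric $d\sigma^2$ on $S^2$ has a conical singularity of order $\beta>-1$ at $p$ if, in a complex local coordinate $z$ around $p$, it is asymptotic to $C|z-z(p)|^{2\beta}\,dz\,d\bar z$ at $p$ for some constant $C>0$. $\mathrm{Met}(S^2)$ is the set of (non-vanishing) conformal pseudometrics of constant curvature $1$ on $S^2$ with finitely many conical singularities. If the conical singularities of $d\sigma^2$ are at $p_1,\dots,p_n$ with orders $\beta_1,\dots,\beta_n$ (and $d\sigma^2$ is a regular metric elsewhere), the formal sum $\beta_1p_1+\cdots+\beta_np_n$ is the divisor of $d\sigma^2$. For $d\sigma^2\in\mathrm{Met}(S^2)$ with singular points $p_1,p_2,p_3$ there is a meromorphic function $g$ on the universal cover of $S^2\setminus\{p_1,p_2,p_3\}$ with $d\sigma^2=g^*d\sigma_0^2=\frac{4\,dg\,d\bar g}{(1+|g|^2)^2}$, where $d\sigma_0^2=4\,dz\,d\bar z/(1+|z|^2)^2$. It is unique up to Möbius transformations by elements of $\mathrm{PSU}(2)=\mathrm{SU}(2)/\{\pm\mathrm{id}\}$. In the situation of the claim ($\beta_1,\beta_3\notin\mathbb{Z}$, $\beta_2\in\mathbb{Z}$),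 $g$ can be chosen of the form $g=z^{\mu}\varphi(z)$ with $\mu\in\mathbb{R}\setminus\mathbb{Z}$ and $\varphi$ rational. *)

theory Defs
  imports "HOL-Complex_Analysis.Complex_Analysis" "HOL-Library.Landau_Symbols"
begin

section \<open>Smooth functions on the plane and Gaussian curvature\<close>

primrec C_k_on :: "nat \<Rightarrow> (complex \<Rightarrow> real) \<Rightarrow> complex set \<Rightarrow> bool" where
  "C_k_on 0 f U \<longleftrightarrow> continuous_on U f"
| "C_k_on (Suc k) f U \<longleftrightarrow> (\<forall>z\<in>U. f differentiable (at z)) \<and>
     (\<forall>v. C_k_on k (\<lambda>z. frechet_derivative f (at z) v) U)"

text \<open>Only used for open \<open>U\<close>.\<close>

definition smooth_on :: "(complex \<Rightarrow> real) \<Rightarrow> complex set \<Rightarrow> bool" where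
  "smooth_on f U \<longleftrightarrow> (\<forall>k. C_k_on k f U)"

definition laplacian :: "(complex \<Rightarrow> real) \<Rightarrow> complex \<Rightarrow> real" where
  "laplacian f z =
     frechet_derivative (\<lambda>w. frechet_derivative f (at w) 1) (at z) 1 +
     frechet_derivative (\<lambda>w. frechet_derivative f (at w) \<i>) (at z) \<i>"

text \<open>Gaussian curvature of the conformal metric \<open>\<rho> dz d\<bar>z\<close> (where \<open>\<rho> > 0\<close>).\<close>

definition gauss_curvature :: "(complex \<Rightarrow> real) \<Rightarrow> complex \<Rightarrow> real" where
  "gauss_curvature \<rho> z = - laplacian (\<lambda>w. ln (\<rho> w)) z / (2 * \<rho> z)"


section \<open>Conformal pseudometrics on the sphere\<close>

text \<open>
  A point of \<open>S\<^sup>2 = \<complex> \<union> {\<infinity>}\<close> is an element of \<^typ>\<open>complex option\<close>, with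
  \<^term>\<open>None\<close> for \<open>\<infinity>\<close>. A conformal pseudometric is given by its coefficient: for a point
  \<open>p = Some z\<close> the value \<open>\<sigma> p\<close> is the coefficient of \<open>dz d\<bar>z\<close>, and \<open>\<sigma> None\<close> is the
  coefficient of \<open>dw d\<bar>w\<close>, \<open>w = 1/z\<close>, at \<open>w = 0\<close>. The value of \<open>\<sigma>\<close> at a conical singularity
  (where the coefficient tends to \<open>0\<close> or to infinity) carries no information and is arbitrary;
  two such functions represent the same metric if they agree off the singular points.
\<close>

type_synonym sphere = "complex option"
type_synonym conformal_metric = "sphere \<Rightarrow> real"

text \<open>The local coordinate used around \<open>p\<close> is \<open>z\<close> if \<open>p\<close> is finite and \<open>w = 1/z\<close> if
  \<open>p = \<infinity>\<close>; in the latter, \<open>dz d\<bar>z = dw d\<bar>w / |w|^4\<close>.\<close>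

definition coord :: "sphere \<Rightarrow> complex" where
  "coord p = (case p of Some a \<Rightarrow> a | None \<Rightarrow> 0)"

definition coeff_near :: "conformal_metric \<Rightarrow> sphere \<Rightarrow> complex \<Rightarrow> real" where
  "coeff_near \<sigma> p = (case p of
      Some a \<Rightarrow> (\<lambda>z. \<sigma> (Some z))
    | None \<Rightarrow> (\<lambda>w. if w = 0 then \<sigma> None else \<sigma> (Some (1 / w)) / cmod w ^ 4))"

definition regular_at :: "conformal_metric \<Rightarrow> sphere \<Rightarrow> bool" where
  "regular_at \<sigma> p \<longleftrightarrow> (\<exists>U. open U \<and> coord p \<in> U \<and>
     smooth_on (coeff_near \<sigma> p) U \<and> (\<forall>z\<in>U. coeff_near \<sigma> p z > 0))"

definition curvature_at :: "conformal_metric \<Rightarrow> sphere \<Rightarrow> real" where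
  "curvature_at \<sigma> p = gauss_curvature (coeff_near \<sigma> p) (coord p)"

definition conical_at :: "conformal_metric \<Rightarrow> sphere \<Rightarrow> real \<Rightarrow> bool" where
  "conical_at \<sigma> p \<beta> \<longleftrightarrow> \<beta> > -1 \<and> (\<exists>C>0.
     coeff_near \<sigma> p \<sim>[at (coord p)] (\<lambda>z. C * cmod (z - coord p) powr (2 * \<beta>)))"

text \<open>A divisor is a function \<open>D\<close> of finite support, standing for the sum of \<open>D p \<cdot> p\<close>.\<close>

definition has_divisor :: "conformal_metric \<Rightarrow> (sphere \<Rightarrow> real) \<Rightarrow> bool" where
  "has_divisor \<sigma> D \<longleftrightarrow> finite {p. D p \<noteq> 0} \<and>
     (\<forall>p. if D p = 0 then regular_at \<sigma> p else conical_at \<sigma> p (D p))"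

definition Met_S2 :: "conformal_metric set" where
  "Met_S2 = {\<sigma>. (\<exists>D. has_divisor \<sigma> D) \<and>
     (\<forall>p. regular_at \<sigma> p \<longrightarrow> curvature_at \<sigma> p = 1)}"

definition divisor_01inf :: "real \<Rightarrow> real \<Rightarrow> real \<Rightarrow> sphere \<Rightarrow> real" where
  "divisor_01inf \<beta>1 \<beta>2 \<beta>3 = (\<lambda>_. 0)(Some 0 := \<beta>1, Some 1 := \<beta>2, None := \<beta>3)"


section \<open>Developing maps\<close>

text \<open>
  The coefficient of the pullback of the round metric \<open>4 dz d\<bar>z / (1 + |z|\<^sup>2)\<^sup>2\<close> under a
  meromorphic function \<open>g\<close>. At a pole we pass to \<open>1/g\<close>, inversion being an isometry of the
  round metric; there \<open>g\<close> is understood to take the value \<open>0\<close>, as is automatic for quotients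
  in lowest terms because of \<open>x / 0 = 0\<close>, so that \<open>1/g\<close> is \<open>0\<close> as it should be.
\<close>

definition round_pullback :: "(complex \<Rightarrow> complex) \<Rightarrow> complex \<Rightarrow> real" where
  "round_pullback g z =
     (let h = (if is_pole g z then (\<lambda>w. inverse (g w)) else g)
      in 4 * (cmod (deriv h z))\<^sup>2 / (1 + (cmod (h z))\<^sup>2)\<^sup>2)"

definition rational_function :: "(complex \<Rightarrow> complex) \<Rightarrow> bool" where
  "rational_function \<phi> \<longleftrightarrow> (\<exists>p q :: complex poly. q \<noteq> 0 \<and> coprime p q \<and>
     (\<forall>z. \<phi> z = poly p z / poly q z))"

text \<open>
  \<open>\<sigma> = g\<^sup>*d\<sigma>\<^sub>0\<^sup>2\<close> on \<open>S\<^sup>2 - {0, 1, \<infinity>}\<close> for the multivalued function \<open>g = z\<^sup>\<mu> \<phi>(z)\<close>. This \<open>g\<close> is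
  single-valued on the covering \<open>exp : \<complex> \<rightarrow> \<complex> - {0}\<close>, where it reads
  \<open>\<zeta> \<mapsto> exp (\<mu> \<zeta>) \<phi> (exp \<zeta>)\<close>, while the pullback of \<open>\<sigma>\<close> to the covering has the coefficient
  \<open>\<sigma> (exp \<zeta>) |exp \<zeta>|\<^sup>2\<close>.
\<close>

definition developed_by :: "conformal_metric \<Rightarrow> real \<Rightarrow> (complex \<Rightarrow> complex) \<Rightarrow> bool" where
  "developed_by \<sigma> \<mu> \<phi> \<longleftrightarrow> (\<forall>\<zeta>. exp \<zeta> \<noteq> 1 \<longrightarrow>
     \<sigma> (Some (exp \<zeta>)) * (cmod (exp \<zeta>))\<^sup>2 =
       round_pullback (\<lambda>\<xi>. exp (of_real \<mu> * \<xi>) * \<phi> (exp \<xi>)) \<zeta>)"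


section \<open>The algebraic systems\<close>

definition admissible :: "nat \<Rightarrow> (nat \<Rightarrow> complex) \<Rightarrow> bool" where
  "admissible N a \<longleftrightarrow> inj_on a {1..N} \<and> (\<forall>j\<in>{1..N}. a j \<noteq> 0 \<and> a j \<noteq> 1)"

definition system_A :: "real \<Rightarrow> nat \<Rightarrow> nat \<Rightarrow> (nat \<Rightarrow> complex) \<Rightarrow> bool" where
  "system_A \<beta>1 \<beta>2 N a \<longleftrightarrow> (\<forall>j\<in>{1..N}.
     of_real \<beta>1 / a j + of_nat \<beta>2 / (a j - 1) - (\<Sum>k\<in>{1..N} - {j}. 2 / (a j - a k)) = 0)"

definition system_B :: "real \<Rightarrow> nat \<Rightarrow> nat \<Rightarrow> (nat \<Rightarrow> complex) \<Rightarrow> bool" where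
  "system_B \<beta>1 \<beta>2 N a \<longleftrightarrow> (\<forall>j\<in>{1..N}.
     of_real (- \<beta>1 - 2) / a j + of_nat \<beta>2 / (a j - 1) - (\<Sum>k\<in>{1..N} - {j}. 2 / (a j - a k)) = 0)"

end

theory Submission
  imports Defs "HOL-Computational_Algebra.Fundamental_Theorem_Algebra"
    "HOL-Computational_Algebra.Polynomial_Factorial" "HOL-Computational_Algebra.Field_as_Ring"
begin

text \<open>
  If \<open>\<rho> dz d\<bar>z\<close> has curvature \<open>1\<close>, then \<open>y = 2 \<rho>\<^bsup>-1/2\<^esup>\<close> satisfies \<open>y\<^bsub>zz\<^esub> = - q y\<close> with \<open>q\<close> holomorphic, and
  \<open>y = |w\<^sub>1|\<^sup>2 + |w\<^sub>2|\<^sup>2\<close> for solutions of \<open>w'' = - q w\<close> that are unique up to \<open>SU(2)\<close>; their quotient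
  is a developing map. The functions \<open>f\<^sub>i = z\<^bsup>\<beta>\<^sub>1/2\<^esup> (z - 1)\<^bsup>\<beta>\<^sub>2/2\<^esup> w\<^sub>i\<close> are multivalued on \<open>\<complex> - {0, 1}\<close>
  with unitary monodromy, and by the conical asymptotics \<open>|f\<^sub>1|\<^sup>2 + |f\<^sub>2|\<^sup>2\<close> has positive limits at \<open>0\<close>
  and \<open>1\<close> and grows polynomially. Diagonalising the monodromy therefore shows that it is trivial at
  \<open>1\<close>, where its determinant is \<open>1\<close>, and that after a rotation \<open>f\<^sub>1 = z\<^sup>\<alpha> P\<close> and \<open>f\<^sub>2 = R\<close> with
  polynomials \<open>P\<close>, \<open>R\<close>. Thus the metric is the pullback under \<open>z\<^sup>\<nu> P / R\<close>, where
  \<open>\<nu> P R + z (P' R - P R') = c (z - 1)\<^bsup>\<beta>\<^sub>2\<^esup>\<close>, \<open>\<nu> = \<plusminus>(\<beta>\<^sub>1 + 1)\<close> and \<open>\<nu> + deg P - deg R = \<plusminus>(\<beta>\<^sub>3 + 1)\<close>. This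
  identity forces a hypergeometric equation on \<open>R\<close>, which read at the roots of \<open>R\<close> is the system (A)
  or (B) and which determines \<open>R\<close>, and with it \<open>P\<close>, up to constants.
\<close>

section \<open>Smooth functions and Wirtinger derivatives\<close>

text \<open>The choice of \<open>y\<close> comes from the target: if
  \<open>\<rho> = 4 |g'|^2 / (1 + |g|^2)^2\<close>, then \<open>2 / sqrt \<rho>\<close> is
  \<open>(1 + |g|^2) / |g'|\<close>, which equals \<open>|w1|^2 + |w2|^2\<close> for
  \<open>w2 = g'^(-1/2)\<close> and \<open>w1 = g w2\<close>; in this form the poles of g disappear.
  The obstacle is multivaluedness. Instead of a universal cover, three planes cut along the real
  axis are used, which share both half-planes. Frames are made to agree above the axis, so comparing
  them below it shows the monodromy. Its exponents, normalised to [0, 1), are pinned by two facts: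
  modulo integers their sum is \<open>\<beta>2\<close> at 1 and \<open>\<beta>1\<close> at 0, and
  the positive limit of the norm forces one of them to vanish at each point. So both vanish at 1,
  and exactly one vanishes at 0 because \<open>\<beta>1\<close> is not an integer. The four cases of
  the claim are the sign of \<open>\<nu>\<close> combined with the sign of
  \<open>\<nu> + deg P - deg R\<close>. If two metrics had the same \<open>\<nu>\<close> but
  different degrees of \<open>R\<close>, then \<open>\<beta>3\<close> would be an integer; this is
  why a single family remains.\<close>

lemma frechet_derivative_eqI:
  "(f has_derivative D) (at x) \<Longrightarrow> frechet_derivative f (at x) = D"
  using frechet_derivative_at by metis

lemma C_k_on_SucD: "C_k_on (Suc k) f U \<Longrightarrow> C_k_on k f U"
proof (induction k arbitrary: f)
  case 0
  then show ?case
    by (auto intro!: continuous_at_imp_continuous_on differentiable_imp_continuous_within)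
next
  case (Suc k)
  have "C_k_on k (\<lambda>z. frechet_derivative f (at z) v) U" for v
  proof (rule Suc.IH)
    show "C_k_on (Suc k) (\<lambda>z. frechet_derivative f (at z) v) U"
      using Suc.prems unfolding C_k_on.simps(2)[of "Suc k"] by blast
  qed
  moreover have "\<forall>z\<in>U. f differentiable (at z)"
    using Suc.prems unfolding C_k_on.simps(2)[of "Suc k"] by blast
  ultimately show ?case unfolding C_k_on.simps(2)[of k] by blast
qed

text \<open>Derivatives are taken in full neighbourhoods, so on an open set all derivatives of
  \<open>f\<close> and \<open>g\<close> agree as well; this is what the induction carries.\<close>

lemma C_k_on_cong:
  assumes "open U" "\<And>z. z \<in> U \<Longrightarrow> f z = g z" "C_k_on k f U"
  shows "C_k_on k g U"
  using assms(2,3)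
proof (induction k arbitrary: f g)
  case 0
  then show ?case using continuous_on_cong[of U U g f] unfolding C_k_on.simps(1) by metis
next
  case (Suc k)
  have D: "(g has_derivative frechet_derivative f (at z)) (at z)" if "z \<in> U" for z
  proof (rule has_derivative_transform_within_open[OF _ assms(1) that])
    show "(f has_derivative frechet_derivative f (at z)) (at z)"
      using Suc.prems(2) that by (simp add: frechet_derivative_works)
  qed (use Suc.prems(1) in auto)
  have "C_k_on k (\<lambda>z. frechet_derivative g (at z) v) U" for v
  proof (rule Suc.IH[of "\<lambda>z. frechet_derivative f (at z) v"])
    show "frechet_derivative f (at z) v = frechet_derivative g (at z) v" if "z \<in> U" for z
      using frechet_derivative_eqI[OF D[OF that]] by simp
    show "C_k_on k (\<lambda>z. frechet_derivative f (at z) v) U"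
      using Suc.prems(2) by simp
  qed
  moreover have "g differentiable (at z)" if "z \<in> U" for z
    using D[OF that] by (auto simp: differentiable_def)
  ultimately show ?case by simp
qed

text \<open>Replaces the choice-based \<open>frechet_derivative\<close> by an explicit
  \<open>D\<close>, so that the closure rules below reduce to known derivative formulas.\<close>

lemma C_k_on_SucI:
  assumes "open U" "\<And>z. z \<in> U \<Longrightarrow> (f has_derivative D z) (at z)" "\<And>v. C_k_on k (\<lambda>z. D z v) U"
  shows "C_k_on (Suc k) f U"
proof -
  have "f differentiable (at z)" if "z \<in> U" for z
    using assms(2)[OF that] by (auto simp: differentiable_def)
  moreover have "C_k_on k (\<lambda>z. frechet_derivative f (at z) v) U" for v
  proof (rule C_k_on_cong[OF assms(1) _ assms(3)[of v]])
    show "D z v = frechet_derivative f (at z) v" if "z \<in> U" for z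
      using frechet_derivative_eqI[OF assms(2)[OF that]] by simp
  qed
  ultimately show ?thesis by simp
qed

lemma C_k_on_SucE:
  assumes "C_k_on (Suc k) f U"
  shows "\<And>z. z \<in> U \<Longrightarrow> (f has_derivative frechet_derivative f (at z)) (at z)"
    and "\<And>v. C_k_on k (\<lambda>z. frechet_derivative f (at z) v) U"
  using assms unfolding C_k_on.simps(2) frechet_derivative_works by blast+

lemma C_k_on_const: "open U \<Longrightarrow> C_k_on k (\<lambda>z. c) U"
proof (induction k arbitrary: c)
  case (Suc k)
  show ?case
    by (rule C_k_on_SucI[where D="\<lambda>z h. 0"]) (use Suc in auto)
qed auto

lemma C_k_on_add: "open U \<Longrightarrow> C_k_on k f U \<Longrightarrow> C_k_on k g U \<Longrightarrow> C_k_on k (\<lambda>z. f z + g z) U"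
proof (induction k arbitrary: f g)
  case (Suc k)
  show ?case
    by (rule C_k_on_SucI[OF Suc.prems(1) has_derivative_add[OF C_k_on_SucE(1)[OF Suc.prems(2)] C_k_on_SucE(1)[OF Suc.prems(3)]]])
      (use Suc in auto)
qed (auto intro: continuous_intros)

lemma C_k_on_mult: "open U \<Longrightarrow> C_k_on k f U \<Longrightarrow> C_k_on k g U \<Longrightarrow> C_k_on k (\<lambda>z. f z * g z) U"
proof (induction k arbitrary: f g)
  case (Suc k)
  have fg: "C_k_on k f U" "C_k_on k g U"
    using Suc.prems C_k_on_SucD by blast+
  show ?case
    by (rule C_k_on_SucI[OF Suc.prems(1) has_derivative_mult[OF C_k_on_SucE(1)[OF Suc.prems(2)] C_k_on_SucE(1)[OF Suc.prems(3)]]])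
      (use Suc fg in \<open>auto intro!: C_k_on_add\<close>)
qed (auto intro: continuous_intros)

lemma C_k_on_power: "open U \<Longrightarrow> C_k_on k f U \<Longrightarrow> C_k_on k (\<lambda>z. f z ^ n) U"
  by (induction n) (auto intro: C_k_on_mult C_k_on_const)

lemma C_k_on_inverse:
  "open U \<Longrightarrow> (\<And>z. z \<in> U \<Longrightarrow> f z \<noteq> 0) \<Longrightarrow> C_k_on k f U \<Longrightarrow> C_k_on k (\<lambda>z. inverse (f z)) U"
proof (induction k)
  case (Suc k)
  have i: "C_k_on k (\<lambda>z. inverse (f z)) U"
    using Suc C_k_on_SucD by blast
  show ?case
  proof (rule C_k_on_SucI[OF Suc.prems(1)])
    show "((\<lambda>z. inverse (f z)) has_derivative
       (\<lambda>h. (- 1) * (inverse (f z) * frechet_derivative f (at z) h * inverse (f z)))) (at z)" if "z \<in> U" for z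
      using Deriv.has_derivative_inverse[OF Suc.prems(2)[OF that] C_k_on_SucE(1)[OF Suc.prems(3) that]]
      by simp
    show "C_k_on k (\<lambda>z. (- 1) * (inverse (f z) * frechet_derivative f (at z) v * inverse (f z))) U" for v
      using C_k_on_SucE(2)[OF Suc.prems(3)] i Suc.prems(1)
      by (intro C_k_on_mult C_k_on_const) auto
  qed
qed (auto intro!: continuous_intros)

lemma C_k_on_ln:
  assumes "open U" "\<And>z. z \<in> U \<Longrightarrow> f z > 0" "C_k_on k f U"
  shows "C_k_on k (\<lambda>z. ln (f z)) U"
proof (cases k)
  case 0
  then show ?thesis using assms
    by (auto intro!: continuous_on_ln dest: less_imp_neq[THEN not_sym])
next
  case (Suc j)
  show ?thesis unfolding Suc
  proof (rule C_k_on_SucI[OF assms(1)])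
    show "((\<lambda>z. ln (f z)) has_derivative (\<lambda>h. frechet_derivative f (at z) h * inverse (f z))) (at z)"
      if "z \<in> U" for z
      using has_derivative_ln[OF assms(2)[OF that] C_k_on_SucE(1)[OF assms(3)[unfolded Suc] that]] .
    show "C_k_on j (\<lambda>z. frechet_derivative f (at z) v * inverse (f z)) U" for v
      using assms C_k_on_SucE(2)[OF assms(3)[unfolded Suc]] C_k_on_SucD[OF assms(3)[unfolded Suc]]
      by (intro C_k_on_mult C_k_on_inverse) (auto dest: less_imp_neq[THEN not_sym])
  qed
qed

text \<open>The derivative of \<open>Re f\<close> along \<open>v\<close> is the real part of the
  holomorphic function f' v, so the induction runs over all holomorphic \<open>f\<close> at
  once.\<close>

lemma C_k_on_Re_holomorphic:
  "open U \<Longrightarrow> f holomorphic_on U \<Longrightarrow> C_k_on k (\<lambda>z. Re (f z)) U"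
proof (induction k arbitrary: f)
  case 0
  then show ?case by (auto intro!: continuous_intros holomorphic_on_imp_continuous_on)
next
  case (Suc k)
  show ?case
  proof (rule C_k_on_SucI[OF Suc.prems(1)])
    show "((\<lambda>z. Re (f z)) has_derivative (\<lambda>h. Re (deriv f z * h))) (at z)" if "z \<in> U" for z
      by (rule has_derivative_Re[OF holomorphic_derivI[OF Suc.prems(2,1) that, unfolded has_field_derivative_def]])
    show "C_k_on k (\<lambda>z. Re (deriv f z * v)) U" for v
      using Suc.prems by (intro Suc.IH holomorphic_intros) auto
  qed
qed

lemma C_k_on_cmod_squared:
  assumes "open U" "f holomorphic_on U"
  shows "C_k_on k (\<lambda>z. (cmod (f z))\<^sup>2) U"
proof -
  have "C_k_on k (\<lambda>z. Re (f z) ^ 2 + Re (- \<i> * f z) ^ 2) U"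
    using assms by (intro C_k_on_add C_k_on_power C_k_on_Re_holomorphic holomorphic_intros) auto
  then show ?thesis by (simp add: cmod_power2)
qed

text \<open>\<open>p\<close> and \<open>q\<close> are the derivatives with respect to z and its
  conjugate. As a relation for both at once, it lets each rule below compute them together, with
  real differentiability built in.\<close>

definition has_wirtinger :: "(complex \<Rightarrow> complex) \<Rightarrow> complex \<Rightarrow> complex \<Rightarrow> complex \<Rightarrow> bool" where
  "has_wirtinger f p q z \<longleftrightarrow> (f has_derivative (\<lambda>h. p * h + q * cnj h)) (at z)"

lemma has_wirtinger_holomorphic:
  "(f has_field_derivative f') (at z) \<Longrightarrow> has_wirtinger f f' 0 z"
  by (simp add: has_wirtinger_def has_field_derivative_def)

lemma has_wirtinger_cnj:
  "has_wirtinger f p q z \<Longrightarrow> has_wirtinger (\<lambda>w. cnj (f w)) (cnj q) (cnj p) z"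
  unfolding has_wirtinger_def
  by (drule has_derivative_cnj) (simp add: algebra_simps)

lemma has_wirtinger_add:
  "has_wirtinger f p q z \<Longrightarrow> has_wirtinger g p' q' z \<Longrightarrow>
    has_wirtinger (\<lambda>w. f w + g w) (p + p') (q + q') z"
  unfolding has_wirtinger_def
  by (drule (1) has_derivative_add) (simp add: algebra_simps)

lemma has_wirtinger_diff:
  "has_wirtinger f p q z \<Longrightarrow> has_wirtinger g p' q' z \<Longrightarrow>
    has_wirtinger (\<lambda>w. f w - g w) (p - p') (q - q') z"
  unfolding has_wirtinger_def
  by (drule (1) has_derivative_diff) (simp add: algebra_simps)

lemma has_wirtinger_mult:
  "has_wirtinger f p q z \<Longrightarrow> has_wirtinger g p' q' z \<Longrightarrow>
    has_wirtinger (\<lambda>w. f w * g w) (p * g z + f z * p') (q * g z + f z * q') z"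
  unfolding has_wirtinger_def
  by (drule (1) has_derivative_mult) (simp add: algebra_simps)

lemma has_wirtinger_const: "has_wirtinger (\<lambda>w. c) 0 0 z"
  by (simp add: has_wirtinger_def)

lemma has_wirtinger_cmult:
  "has_wirtinger f p q z \<Longrightarrow> has_wirtinger (\<lambda>w. c * f w) (c * p) (c * q) z"
  using has_wirtinger_mult[OF has_wirtinger_const, of f p q z c] by simp

lemma has_wirtinger_divide:
  assumes "has_wirtinger f p q z" "has_wirtinger g p' q' z" "g z \<noteq> 0"
  shows "has_wirtinger (\<lambda>w. f w / g w) ((p * g z - f z * p') / (g z)\<^sup>2) ((q * g z - f z * q') / (g z)\<^sup>2) z"
proof -
  have 1: "((\<lambda>w. f w / g w) has_derivative
    (\<lambda>h. ((p * h + q * cnj h) * g z - f z * (p' * h + q' * cnj h)) / (g z * g z))) (at z)"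
    by (rule has_derivative_divide'[OF assms(1,2)[unfolded has_wirtinger_def] assms(3)])
  have "(\<lambda>h. ((p * h + q * cnj h) * g z - f z * (p' * h + q' * cnj h)) / (g z * g z)) =
    (\<lambda>h. (p * g z - f z * p') / (g z)\<^sup>2 * h + (q * g z - f z * q') / (g z)\<^sup>2 * cnj h)"
    by (simp add: power2_eq_square diff_divide_distrib add_divide_distrib algebra_simps)
  with 1 show ?thesis unfolding has_wirtinger_def by simp
qed

lemma has_wirtinger_cong:
  assumes "has_wirtinger f p q z" "open U" "z \<in> U" "\<And>w. w \<in> U \<Longrightarrow> f w = g w"
  shows "has_wirtinger g p q z"
  using has_derivative_transform_within_open[OF assms(1)[unfolded has_wirtinger_def] assms(2-4)]
  by (simp add: has_wirtinger_def)

lemma has_wirtinger_unique: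
  assumes "has_wirtinger f p q z" "has_wirtinger f p' q' z"
  shows "p = p'" "q = q'"
proof -
  have *: "(\<lambda>h. p * h + q * cnj h) = (\<lambda>h. p' * h + q' * cnj h)"
    using assms unfolding has_wirtinger_def by (rule has_derivative_unique)
  from fun_cong[OF *, of 1] fun_cong[OF *, of \<i>]
  have "p + q = p' + q'" "\<i> * (p - q) = \<i> * (p' - q')"
    by (simp_all add: algebra_simps)
  then have "p + q = p' + q'" "p - q = p' - q'" by auto
  then have "2 * p = 2 * p'" "2 * q = 2 * q'" by (algebra, algebra)
  then show "p = p'" "q = q'" by auto
qed

text \<open>A mean value argument on the parallelogram spanned by h u and h v. It asks only that the
  directional derivative be differentiable at the one point \<open>z\<close>, not that second
  derivatives be continuous.\<close>

lemma second_difference_tendsto: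
  fixes f :: "complex \<Rightarrow> real"
  assumes "open U" "z \<in> U" "\<And>w. w \<in> U \<Longrightarrow> (f has_derivative F w) (at w)"
    and G: "((\<lambda>w. F w u) has_derivative G) (at z)"
  shows "((\<lambda>h. (f (z + h *\<^sub>R u + h *\<^sub>R v) - f (z + h *\<^sub>R u) - f (z + h *\<^sub>R v) + f z) / h\<^sup>2)
    \<longlongrightarrow> G v) (at_right 0)"
proof (rule tendstoI)
  fix e :: real assume "e > 0"
  \<comment> \<open>\<open>h * K\<close> bounds the sum of the lengths of t u + h v and t u for 0
    \<le> t \<le> h, the two increments at which differentiability at \<open>z\<close> is used; the
    1 keeps \<open>K\<close> positive.\<close>
  define K where "K = 2 * norm u + norm v + 1"
  have K: "K > 0" by (simp add: K_def add_nonneg_pos)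
  from G obtain d where d: "d > 0"
    "\<And>w. norm (w - z) < d \<Longrightarrow> norm (F w u - F z u - G (w - z)) \<le> e / (2 * K) * norm (w - z)"
    unfolding has_derivative_at_alt using \<open>e > 0\<close> K
    by (metis divide_pos_pos mult_pos_pos zero_less_numeral)
  obtain r where r: "r > 0" "ball z r \<subseteq> U"
    using assms(1,2) openE by blast
  interpret G: bounded_linear G using G by (rule has_derivative_bounded_linear)
  have main: "\<bar>(f (z + h *\<^sub>R u + h *\<^sub>R v) - f (z + h *\<^sub>R u) - f (z + h *\<^sub>R v) + f z) / h\<^sup>2 - G v\<bar> < e"
    if h: "0 < h" "h < min d r / K" for h
  proof -
    have hK: "h * K < d" "h * K < r" using h K by (auto simp: field_simps)
    have n: "norm (t *\<^sub>R u + s *\<^sub>R v) \<le> h * K" if "0 \<le> t" "t \<le> h" "0 \<le> s" "s \<le> h" for t s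
    proof -
      have "norm (t *\<^sub>R u + s *\<^sub>R v) \<le> t * norm u + s * norm v"
        using norm_triangle_ineq[of "t *\<^sub>R u" "s *\<^sub>R v"] that by simp
      also have "\<dots> \<le> h * norm u + h * norm v" using that by (intro add_mono mult_right_mono) auto
      also have "\<dots> \<le> h * K" using h by (auto simp: K_def algebra_simps)
      finally show ?thesis .
    qed
    have inU: "z + t *\<^sub>R u + s *\<^sub>R v \<in> U" if "0 \<le> t" "t \<le> h" "0 \<le> s" "s \<le> h" for t s
    proof -
      have "dist z (z + t *\<^sub>R u + s *\<^sub>R v) = norm (t *\<^sub>R u + s *\<^sub>R v)"
        by (metis add.assoc add_diff_cancel_left' dist_commute dist_norm)
      then show ?thesis using r(2) n[OF that] hK by auto
    qed
    \<comment> \<open>The difference in direction \<open>v\<close> is kept as it is; the mean value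
      theorem handles the one in direction \<open>u\<close>.\<close>
    define \<phi> where "\<phi> t = f (z + t *\<^sub>R u + h *\<^sub>R v) - f (z + t *\<^sub>R u)" for t :: real
    have D\<phi>: "(\<phi> has_derivative (\<lambda>s. s * (F (z + t *\<^sub>R u + h *\<^sub>R v) u - F (z + t *\<^sub>R u) u))) (at t within {0..h})"
      if t: "0 \<le> t" "t \<le> h" for t
    proof -
      have F1: "(f has_derivative F (z + t *\<^sub>R u + h *\<^sub>R v)) (at (z + t *\<^sub>R u + h *\<^sub>R v))"
        using assms(3) inU[of t h] t h by auto
      have F2: "(f has_derivative F (z + t *\<^sub>R u)) (at (z + t *\<^sub>R u))"
        using assms(3) inU[of t 0] t h by auto
      interpret F1: bounded_linear "F (z + t *\<^sub>R u + h *\<^sub>R v)" using F1 by (rule has_derivative_bounded_linear)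
      interpret F2: bounded_linear "F (z + t *\<^sub>R u)" using F2 by (rule has_derivative_bounded_linear)
      have i1: "((\<lambda>t. z + t *\<^sub>R u + h *\<^sub>R v) has_derivative (\<lambda>s. s *\<^sub>R u)) (at t within {0..h})"
        by (auto intro!: derivative_eq_intros)
      have i2: "((\<lambda>t. z + t *\<^sub>R u) has_derivative (\<lambda>s. s *\<^sub>R u)) (at t within {0..h})"
        by (auto intro!: derivative_eq_intros)
      have "((\<lambda>t. f (z + t *\<^sub>R u + h *\<^sub>R v) - f (z + t *\<^sub>R u)) has_derivative
         (\<lambda>s. F (z + t *\<^sub>R u + h *\<^sub>R v) (s *\<^sub>R u) - F (z + t *\<^sub>R u) (s *\<^sub>R u))) (at t within {0..h})"
        by (intro has_derivative_diff has_derivative_compose[OF i1 F1] has_derivative_compose[OF i2 F2])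
      then show ?thesis unfolding \<phi>_def
        by (simp only: F1.scaleR F2.scaleR real_scaleR_def right_diff_distrib)
    qed
    obtain t where t: "t \<in> {0..h}"
      "\<phi> h - \<phi> 0 = (h - 0) * (F (z + t *\<^sub>R u + h *\<^sub>R v) u - F (z + t *\<^sub>R u) u)"
      using mvt_very_simple[of 0 h \<phi> "\<lambda>t s. s * (F (z + t *\<^sub>R u + h *\<^sub>R v) u - F (z + t *\<^sub>R u) u)"] D\<phi> h by force
    have b1: "\<bar>F (z + t *\<^sub>R u + h *\<^sub>R v) u - F z u - (t * G u + h * G v)\<bar> \<le> e / (2 * K) * norm (t *\<^sub>R u + h *\<^sub>R v)"
      using d(2)[of "z + t *\<^sub>R u + h *\<^sub>R v"] n[of t h] hK t h by (simp add: G.add G.scaleR add.assoc)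
    have b2: "\<bar>F (z + t *\<^sub>R u) u - F z u - t * G u\<bar> \<le> e / (2 * K) * norm (t *\<^sub>R u)"
      using d(2)[of "z + t *\<^sub>R u"] n[of t 0] hK t h by (simp add: G.scaleR)
    have "\<bar>F (z + t *\<^sub>R u + h *\<^sub>R v) u - F (z + t *\<^sub>R u) u - h * G v\<bar>
        \<le> e / (2 * K) * norm (t *\<^sub>R u + h *\<^sub>R v) + e / (2 * K) * norm (t *\<^sub>R u)"
      using b1 b2 by linarith
    also have "\<dots> = e / (2 * K) * (norm (t *\<^sub>R u + h *\<^sub>R v) + norm (t *\<^sub>R u))" by (simp add: algebra_simps)
    also have "\<dots> \<le> e / (2 * K) * (h * K)"
    proof (rule mult_left_mono)
      have "norm (t *\<^sub>R u + h *\<^sub>R v) + norm (t *\<^sub>R u) \<le> (t * norm u + h * norm v) + t * norm u"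
        using norm_triangle_ineq[of "t *\<^sub>R u" "h *\<^sub>R v"] t h by simp
      also have "\<dots> \<le> (h * norm u + h * norm v) + h * norm u"
        using t h by (intro add_mono mult_right_mono) auto
      also have "\<dots> \<le> h * K" using h by (simp add: K_def algebra_simps)
      finally show "norm (t *\<^sub>R u + h *\<^sub>R v) + norm (t *\<^sub>R u) \<le> h * K" .
    qed (use \<open>e > 0\<close> K in auto)
    also have "\<dots> < h * e" using K h \<open>e > 0\<close> by (simp add: field_simps)
    finally have 1: "\<bar>F (z + t *\<^sub>R u + h *\<^sub>R v) u - F (z + t *\<^sub>R u) u - h * G v\<bar> < h * e" .
    have "(f (z + h *\<^sub>R u + h *\<^sub>R v) - f (z + h *\<^sub>R u) - f (z + h *\<^sub>R v) + f z) / h\<^sup>2 - G v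
      = (F (z + t *\<^sub>R u + h *\<^sub>R v) u - F (z + t *\<^sub>R u) u - h * G v) / h"
    proof -
      have "f (z + h *\<^sub>R u + h *\<^sub>R v) - f (z + h *\<^sub>R u) - f (z + h *\<^sub>R v) + f z
          = h * (F (z + t *\<^sub>R u + h *\<^sub>R v) u - F (z + t *\<^sub>R u) u)"
        using t(2) by (simp add: \<phi>_def)
      then show ?thesis using h by (simp only:) (simp add: field_simps power2_eq_square)
    qed
    then show ?thesis using 1 h
      by (simp only: abs_divide) (simp add: pos_divide_less_eq mult.commute)
  qed
  show "\<forall>\<^sub>F h in at_right 0. dist ((f (z + h *\<^sub>R u + h *\<^sub>R v) - f (z + h *\<^sub>R u) - f (z + h *\<^sub>R v) + f z) / h\<^sup>2) (G v) < e"
    unfolding eventually_at_right_field dist_real_def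
    using main d(1) r(1) K by (intro exI[of _ "min d r / K"]) auto
qed

text \<open>The second difference is symmetric in \<open>u\<close> and \<open>v\<close>, so the
  limits for the two orders coincide.\<close>

lemma mixed_partials_commute:
  fixes f :: "complex \<Rightarrow> real"
  assumes "open U" "z \<in> U" "\<And>w. w \<in> U \<Longrightarrow> (f has_derivative F w) (at w)"
    and "((\<lambda>w. F w u) has_derivative G) (at z)" "((\<lambda>w. F w v) has_derivative H) (at z)"
  shows "G v = H u"
proof -
  have "((\<lambda>h. (f (z + h *\<^sub>R u + h *\<^sub>R v) - f (z + h *\<^sub>R u) - f (z + h *\<^sub>R v) + f z) / h\<^sup>2)
    \<longlongrightarrow> H u) (at_right 0)"
    using second_difference_tendsto[OF assms(1-3,5), of u] by (simp add: algebra_simps)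
  with second_difference_tendsto[OF assms(1-4), of v] show ?thesis
    by (intro tendsto_unique[of "at_right (0::real)"]) auto
qed

text \<open>Symmetry along 1 and \<i> for the real and for the imaginary part gives two real
  identities, which together are the complex one. It later yields the holomorphy of
  \<open>q\<close>.\<close>

lemma wirtinger_commute:
  assumes "open U" "z \<in> U" "\<And>w. w \<in> U \<Longrightarrow> has_wirtinger f (P w) (Q w) w"
    and "has_wirtinger P p1 p2 z" "has_wirtinger Q q1 q2 z"
  shows "p2 = q1"
proof -
  have D: "(f has_derivative (\<lambda>h. P w * h + Q w * cnj h)) (at w)" if "w \<in> U" for w
    using assms(3)[OF that] by (simp add: has_wirtinger_def)
  have DP: "(P has_derivative (\<lambda>h. p1 * h + p2 * cnj h)) (at z)"
   and DQ: "(Q has_derivative (\<lambda>h. q1 * h + q2 * cnj h)) (at z)"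
    using assms(4,5) by (simp_all add: has_wirtinger_def)
  have d: "((\<lambda>w. P w * c + Q w * cnj c) has_derivative
      (\<lambda>h. (p1 * h + p2 * cnj h) * c + (q1 * h + q2 * cnj h) * cnj c)) (at z)" for c
    by (intro has_derivative_add has_derivative_mult_left DP DQ)
  have "Re ((p1 * \<i> + p2 * cnj \<i>) * 1 + (q1 * \<i> + q2 * cnj \<i>) * cnj 1) =
        Re ((p1 * 1 + p2 * cnj 1) * \<i> + (q1 * 1 + q2 * cnj 1) * cnj \<i>)"
    by (rule mixed_partials_commute[OF assms(1,2) has_derivative_Re[OF D] has_derivative_Re[OF d] has_derivative_Re[OF d]])
  moreover have "Im ((p1 * \<i> + p2 * cnj \<i>) * 1 + (q1 * \<i> + q2 * cnj \<i>) * cnj 1) =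
        Im ((p1 * 1 + p2 * cnj 1) * \<i> + (q1 * 1 + q2 * cnj 1) * cnj \<i>)"
    by (rule mixed_partials_commute[OF assms(1,2) has_derivative_Im[OF D] has_derivative_Im[OF d] has_derivative_Im[OF d]])
  ultimately show ?thesis by (simp add: complex_eq_iff)
qed

section \<open>Curvature and the Liouville equation\<close>

text \<open>\<open>A\<close> is twice the z-derivative of \<open>u\<close>, and the Laplacian is
  four times the mixed second Wirtinger derivative.\<close>

lemma laplacian_eqI:
  assumes "open U" "z \<in> U" "\<And>w. w \<in> U \<Longrightarrow> (u has_derivative (\<lambda>h. Re (A w * h))) (at w)"
    and A: "has_wirtinger A b c z"
  shows "laplacian u z = 2 * Re c"
proof -
  have D: "((\<lambda>w. frechet_derivative u (at w) v) has_derivative (\<lambda>h. Re ((b * h + c * cnj h) * v))) (at z)" for v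
  proof (rule has_derivative_transform_within_open[OF _ assms(1,2)])
    show "((\<lambda>w. Re (A w * v)) has_derivative (\<lambda>h. Re ((b * h + c * cnj h) * v))) (at z)"
      using A unfolding has_wirtinger_def by (intro has_derivative_Re has_derivative_mult_left)
    show "Re (A w * v) = frechet_derivative u (at w) v" if "w \<in> U" for w
      using frechet_derivative_eqI[OF assms(3)[OF that]] by simp
  qed
  show ?thesis
    unfolding laplacian_def using frechet_derivative_eqI[OF D[of 1]] frechet_derivative_eqI[OF D[of \<i>]]
    by simp
qed

lemma Re_divide_of_real_mult: "Re (x / of_real r * h) = Re (x * h) * inverse r"
  by (cases "r = 0") (simp_all add: Re_divide_of_real Im_divide_of_real field_simps)

text \<open>Half the logarithm of Re^2 + Im^2 is used, which avoids choosing a branch of log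
  f.\<close>

lemma has_derivative_ln_cmod:
  assumes "(f has_field_derivative f') (at z)" "f z \<noteq> 0"
  shows "((\<lambda>w. ln (cmod (f w))) has_derivative (\<lambda>h. Re (f' / f z * h))) (at z)"
proof -
  have pos: "Re (f z) ^ 2 + Im (f z) ^ 2 > 0"
    using assms(2) by (simp add: complex_eq_iff sum_power2_gt_zero_iff)
  have f: "(f has_derivative (\<lambda>h. f' * h)) (at z)"
    using assms(1) by (simp add: has_field_derivative_def)
  have 1: "((\<lambda>w. 1 / 2 * ln ((Re (f w))^2 + (Im (f w))^2)) has_derivative
     (\<lambda>h. (2 * Re (f z) * Re (f' * h) + 2 * Im (f z) * Im (f' * h)) * inverse ((Re (f z))^2 + (Im (f z))^2) / 2)) (at z)"
    using has_derivative_mult_right[OF has_derivative_ln[OF pos has_derivative_add[OF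
      has_derivative_power[OF has_derivative_Re[OF f], of 2] has_derivative_power[OF has_derivative_Im[OF f], of 2]]], of "1 / 2"]
    by (rule has_derivative_eq_rhs) (simp add: fun_eq_iff algebra_simps add_divide_distrib diff_divide_distrib)
  have l1: "ln (cmod w) = 1 / 2 * ln ((Re w)^2 + (Im w)^2)" for w
    by (cases "w = 0") (simp_all add: cmod_def ln_sqrt sum_power2_gt_zero_iff complex_eq_iff)
  have l2: "(2 * Re (f z) * Re (f' * h) + 2 * Im (f z) * Im (f' * h)) * inverse ((Re (f z))^2 + (Im (f z))^2) / 2
      = Re (f' / f z * h)" for h
  proof -
    have "f' / f z * h = f' * cnj (f z) / of_real ((Re (f z))^2 + (Im (f z))^2) * h"
      using complex_div_cnj[of f' "f z"] by (simp add: cmod_power2)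
    then have "Re (f' / f z * h) = Re (f' * cnj (f z) * h) * inverse ((Re (f z))^2 + (Im (f z))^2)"
      by (simp only: Re_divide_of_real_mult)
    then show ?thesis by (simp add: algebra_simps)
  qed
  show ?thesis using 1 by (simp only: l1 l2)
qed

section \<open>Density and curvature of the pullback under \<open>f1 / f2\<close>\<close>

context
  fixes U :: "complex set" and f1 f2 G :: "complex \<Rightarrow> complex"
  assumes op: "open U" and hol: "f1 holomorphic_on U" "f2 holomorphic_on U" "G holomorphic_on U"
    and W: "\<And>z. z \<in> U \<Longrightarrow> deriv f1 z * f2 z - f1 z * deriv f2 z = G z"
    and G0: "\<And>z. z \<in> U \<Longrightarrow> G z \<noteq> 0"
begin

abbreviation (input) "nsq z \<equiv> (cmod (f1 z))\<^sup>2 + (cmod (f2 z))\<^sup>2"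
text \<open>For g = f1 / f2 one has g' = G / f2^2, so this is 4 |g'|^2 / (1 + |g|^2)^2 with
  denominators cleared. In this form the zeros of \<open>f2\<close>, which are the poles of g, are
  harmless.\<close>

abbreviation (input) "dens z \<equiv> 4 * (cmod (G z))\<^sup>2 / (nsq z)\<^sup>2"

lemma nsq_pos: "z \<in> U \<Longrightarrow> nsq z > 0"
  using W[of z] G0[of z] by (auto simp: sum_power2_gt_zero_iff)

lemma dens_pos: "z \<in> U \<Longrightarrow> dens z > 0"
  by (intro divide_pos_pos mult_pos_pos zero_less_power nsq_pos) (use G0[of z] in auto)

lemma dens_smooth: "smooth_on dens U"
  unfolding smooth_on_def
proof
  fix k
  have "C_k_on k (\<lambda>z. 4 * (cmod (G z))\<^sup>2 * inverse ((nsq z)\<^sup>2)) U"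
    by (intro C_k_on_mult C_k_on_const C_k_on_cmod_squared C_k_on_inverse C_k_on_power C_k_on_add op hol
      power_not_zero less_imp_neq[OF nsq_pos, THEN not_sym])
  then show "C_k_on k dens U" by (simp add: divide_inverse)
qed

text \<open>ln |G| is harmonic, and the mixed derivative of ln S is |G|^2 / S^2. Hence the Laplacian
  of ln dens is - 8 |G|^2 / S^2 = - 2 dens.\<close>

lemma dens_curvature:
  assumes z: "z \<in> U"
  shows "gauss_curvature dens z = 1"
proof -
  define S where "S = (\<lambda>w. f1 w * cnj (f1 w) + f2 w * cnj (f2 w))"
  define T where "T = (\<lambda>w. deriv f1 w * cnj (f1 w) + deriv f2 w * cnj (f2 w))"
  \<comment> \<open>Twice the z-derivative of ln dens, in the form that \<open>laplacian_eqI\<close>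
    expects.\<close>
  define A where "A w = 2 * (deriv G w / G w) - 4 * (T w / S w)" for w
  have S_nsq: "S w = of_real (nsq w)" for w
    by (simp only: S_def of_real_add complex_norm_square)
  have d: "(f1 has_field_derivative deriv f1 w) (at w)" "(f2 has_field_derivative deriv f2 w) (at w)"
    "(G has_field_derivative deriv G w) (at w)" if "w \<in> U" for w
    using hol op that by (auto intro: holomorphic_derivI)
  have dd: "(deriv f1 has_field_derivative deriv (deriv f1) w) (at w)"
    "(deriv f2 has_field_derivative deriv (deriv f2) w) (at w)"
    "(deriv G has_field_derivative deriv (deriv G) w) (at w)" if "w \<in> U" for w
    using hol op that by (auto intro!: holomorphic_derivI holomorphic_deriv)
  note wi = has_wirtinger_holomorphic
  have wS: "has_wirtinger S (T w) (cnj (T w)) w" if "w \<in> U" for w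
  proof -
    have "has_wirtinger S
      (deriv f1 w * cnj (f1 w) + f1 w * cnj 0 + (deriv f2 w * cnj (f2 w) + f2 w * cnj 0))
      (0 * cnj (f1 w) + f1 w * cnj (deriv f1 w) + (0 * cnj (f2 w) + f2 w * cnj (deriv f2 w))) w"
      unfolding S_def
      by (intro has_wirtinger_add has_wirtinger_mult has_wirtinger_cnj wi d that)
    then show ?thesis by (simp add: T_def algebra_simps)
  qed
  have wT: "has_wirtinger T
      (deriv (deriv f1) w * cnj (f1 w) + deriv f1 w * cnj 0 + (deriv (deriv f2) w * cnj (f2 w) + deriv f2 w * cnj 0))
      (0 * cnj (f1 w) + deriv f1 w * cnj (deriv f1 w) + (0 * cnj (f2 w) + deriv f2 w * cnj (deriv f2 w))) w"
    if "w \<in> U" for w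
    unfolding T_def
    by (intro has_wirtinger_add has_wirtinger_mult has_wirtinger_cnj wi d dd that)
  have S0: "S w \<noteq> 0" if "w \<in> U" for w
    using nsq_pos[OF that] unfolding S_nsq by (metis less_irrefl of_real_eq_0_iff)
  have wA: "\<exists>b. has_wirtinger A b (- 4 * (cmod (G w))\<^sup>2 / (nsq w)\<^sup>2) w" if w: "w \<in> U" for w
  proof -
    have "\<exists>b. has_wirtinger A b (2 * ((0 * G w - deriv G w * 0) / (G w)\<^sup>2) -
      4 * (((0 * cnj (f1 w) + deriv f1 w * cnj (deriv f1 w) + (0 * cnj (f2 w) + deriv f2 w * cnj (deriv f2 w))) * S w - T w * cnj (T w)) / (S w)\<^sup>2)) w"
      unfolding A_def
      using has_wirtinger_diff[OF has_wirtinger_cmult[OF has_wirtinger_divide[OF wi[OF dd(3)[OF w]] wi[OF d(3)[OF w]] G0[OF w]], of 2]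
        has_wirtinger_cmult[OF has_wirtinger_divide[OF wT[OF w] wS[OF w] S0[OF w]], of 4]] by blast
    moreover
    \<comment> \<open>Lagrange's identity: the numerator in the mixed derivative of ln S is the
      squared modulus of the Wronskian.\<close>
    have "(deriv f1 w * cnj (deriv f1 w) + deriv f2 w * cnj (deriv f2 w)) * S w - T w * cnj (T w)
       = (deriv f1 w * f2 w - f1 w * deriv f2 w) * cnj (deriv f1 w * f2 w - f1 w * deriv f2 w)"
      by (simp add: S_def T_def algebra_simps)
    then have "(0 * cnj (f1 w) + deriv f1 w * cnj (deriv f1 w) + (0 * cnj (f2 w) + deriv f2 w * cnj (deriv f2 w))) * S w
      - T w * cnj (T w) = of_real ((cmod (G w))\<^sup>2)"
      unfolding W[OF w] by (simp only: complex_norm_square mult_zero_left add_0_left)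
    ultimately obtain b where "has_wirtinger A b (2 * ((0 * G w - deriv G w * 0) / (G w)\<^sup>2) - 4 * (of_real ((cmod (G w))\<^sup>2) / (S w)\<^sup>2)) w"
      by metis
    then show ?thesis by (intro exI[of _ b]) (simp add: S_nsq)
  qed
  have u: "((\<lambda>w. ln (dens w)) has_derivative (\<lambda>h. Re (A w * h))) (at w)" if w: "w \<in> U" for w
  proof -
    have S': "(S has_derivative (\<lambda>h. T w * h + cnj (T w) * cnj h)) (at w)"
      using wS[OF w] by (simp add: has_wirtinger_def)
    have ReS: "Re (S v) = nsq v" for v by (simp add: S_nsq)
    have N: "(nsq has_derivative (\<lambda>h. 2 * Re (T w * h))) (at w)"
      using has_derivative_Re[OF S'] unfolding ReS by (simp add: algebra_simps)
    have "((\<lambda>v. ln 4 + 2 * ln (cmod (G v)) - 2 * ln (nsq v)) has_derivative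
      (\<lambda>h. 0 + 2 * Re (deriv G w / G w * h) - 2 * (2 * Re (T w * h) * inverse (nsq w)))) (at w)"
      using nsq_pos[OF w] G0[OF w]
      by (intro has_derivative_diff has_derivative_add has_derivative_const has_derivative_mult_right
        has_derivative_ln has_derivative_ln_cmod N d w) auto
    moreover have "0 + 2 * Re (deriv G w / G w * h) - 2 * (2 * Re (T w * h) * inverse (nsq w)) = Re (A w * h)" for h
    proof -
      have "Re (T w / S w * h) = Re (T w * h) * inverse (nsq w)"
        unfolding S_nsq by (rule Re_divide_of_real_mult)
      moreover have "A w * h = 2 *\<^sub>R (deriv G w / G w * h) - 4 *\<^sub>R (T w / S w * h)"
        by (simp add: A_def scaleR_conv_of_real algebra_simps)
      ultimately show ?thesis by (simp only: minus_complex.sel scaleR_complex.sel)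
    qed
    ultimately have "((\<lambda>v. ln 4 + 2 * ln (cmod (G v)) - 2 * ln (nsq v)) has_derivative (\<lambda>h. Re (A w * h))) (at w)"
      by simp
    then show ?thesis
    proof (rule has_derivative_transform_within_open[OF _ op w])
      fix v assume v: "v \<in> U"
      have log_expand: "ln 4 + 2 * ln g - 2 * ln n = ln (4 * g\<^sup>2 / n\<^sup>2)" if "0 < g" "0 < n" for g n :: real
        using that by (simp add: ln_mult ln_div ln_realpow)
      have "cmod (G v) > 0" using G0[OF v] by simp
      then show "ln 4 + 2 * ln (cmod (G v)) - 2 * ln (nsq v) = ln (dens v)"
        using nsq_pos[OF v] by (rule log_expand)
    qed
  qed
  obtain b where b: "has_wirtinger A b (- 4 * (cmod (G z))\<^sup>2 / (nsq z)\<^sup>2) z"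
    using wA[OF z] by blast
  have "laplacian (\<lambda>w. ln (dens w)) z = 2 * Re (of_real (- 4 * (cmod (G z))\<^sup>2 / (nsq z)\<^sup>2))"
    using laplacian_eqI[OF op z u b] by simp
  then have "laplacian (\<lambda>w. ln (dens w)) z = - 2 * dens z"
    unfolding Re_complex_of_real by simp
  moreover have "- (- 2 * d) / (2 * d) = 1" if "d > 0" for d :: real
    using that by simp
  ultimately show ?thesis
    using dens_pos[OF z] unfolding gauss_curvature_def by (simp only:)
qed

end

text \<open>With \<open>u = ln \<rho>\<close>, the functions below are \<open>y = 2 e\<^bsup>-u/2\<^esup>\<close>, \<open>a = y\<^sub>z\<close>, \<open>b = y\<^bsub>z \<bar>z\<^esub>\<close>, and
  \<open>2 q = u\<^bsub>zz\<^esub> - u\<^sub>z\<^sup>2 / 2\<close>, whose holomorphy expresses the Liouville equation.\<close>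

definition liouville_data ::
  "(complex \<Rightarrow> real) \<Rightarrow> complex set \<Rightarrow> (complex \<Rightarrow> complex) \<Rightarrow> (complex \<Rightarrow> complex) \<Rightarrow> (complex \<Rightarrow> complex) \<Rightarrow> bool"
  where "liouville_data \<rho> U a b q \<longleftrightarrow> q holomorphic_on U \<and> (\<forall>z\<in>U. \<rho> z > 0 \<and>
    has_wirtinger (\<lambda>w. of_real (2 / sqrt (\<rho> w))) (a z) (cnj (a z)) z \<and>
    has_wirtinger a (- q z * of_real (2 / sqrt (\<rho> z))) (b z) z \<and>
    has_wirtinger b (- q z * cnj (a z)) (- cnj (q z) * a z) z \<and>
    of_real (2 / sqrt (\<rho> z)) * b z - a z * cnj (a z) = 1)"

text \<open>A real linear map of the plane splits into a complex linear and a conjugate linear part.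
  Applied to \<open>B\<close>, whose conjugate derivative is identified only afterwards.\<close>

lemma real_linear_wirtinger:
  fixes f :: "complex \<Rightarrow> complex"
  assumes "(f has_derivative D) (at z)"
  shows "\<exists>p q. has_wirtinger f p q z"
proof -
  interpret D: bounded_linear D using assms by (rule has_derivative_bounded_linear)
  have "D h = (D 1 - \<i> * D \<i>) / 2 * h + (D 1 + \<i> * D \<i>) / 2 * cnj h" for h
  proof -
    have "D h = D (Re h *\<^sub>R 1 + Im h *\<^sub>R \<i>)" by (rule arg_cong[where f=D]) (simp add: complex_eq_iff)
    also have "\<dots> = Re h * D 1 + Im h * D \<i>" unfolding D.add D.scaleR by (simp add: scaleR_conv_of_real)
    also have "\<dots> = (D 1 - \<i> * D \<i>) / 2 * h + (D 1 + \<i> * D \<i>) / 2 * cnj h"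
      by (simp add: complex_eq_iff field_simps)
    finally show ?thesis .
  qed
  then have "D = (\<lambda>h. (D 1 - \<i> * D \<i>) / 2 * h + (D 1 + \<i> * D \<i>) / 2 * cnj h)" by blast
  then show ?thesis using assms unfolding has_wirtinger_def by metis
qed

text \<open>Curvature 1 means A_zbar = - \<rho> for A = 2 u_z, and the rest is differentiation. In
  particular q_zbar = - \<rho> A / 8 + \<rho> A / 8 = 0.\<close>

lemma liouville_data_exists:
  assumes op: "open U" and sm: "smooth_on \<rho> U" and pos: "\<And>z. z \<in> U \<Longrightarrow> \<rho> z > 0"
    and K: "\<And>z. z \<in> U \<Longrightarrow> gauss_curvature \<rho> z = 1"
  shows "\<exists>a b q. liouville_data \<rho> U a b q"
proof -
  define u where "u = (\<lambda>z. ln (\<rho> z))"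
  \<comment> \<open>Three derivatives suffice: \<open>q\<close> contains second derivatives of
    \<open>u\<close> and is differentiated once.\<close>
  have u3: "C_k_on (Suc (Suc (Suc 0))) u U"
    unfolding u_def using sm by (intro C_k_on_ln op pos) (auto simp: smooth_on_def)
  define D where "D = (\<lambda>f v z. frechet_derivative f (at z) (v::complex) :: real)"
  define u1 where "u1 = D u 1"
  define u2 where "u2 = D u \<i>"
  have u12: "C_k_on (Suc (Suc 0)) u1 U" "C_k_on (Suc (Suc 0)) u2 U"
    using C_k_on_SucE(2)[OF u3] by (auto simp: u1_def u2_def D_def)
  have lin: "(f has_derivative (\<lambda>h. D f 1 z * Re h + D f \<i> z * Im h)) (at z)"
    if "C_k_on (Suc k) f U" "z \<in> U" for f k z
  proof -
    have d: "(f has_derivative frechet_derivative f (at z)) (at z)"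
      using C_k_on_SucE(1)[OF that] .
    interpret L: bounded_linear "frechet_derivative f (at z)" using d by (rule has_derivative_bounded_linear)
    have "frechet_derivative f (at z) h = D f 1 z * Re h + D f \<i> z * Im h" for h
    proof -
      have "frechet_derivative f (at z) h = frechet_derivative f (at z) (Re h *\<^sub>R 1 + Im h *\<^sub>R \<i>)"
        by (rule arg_cong[where f="frechet_derivative f (at z)"]) (simp add: complex_eq_iff)
      then show ?thesis unfolding L.add L.scaleR by (simp add: D_def)
    qed
    then have "frechet_derivative f (at z) = (\<lambda>h. D f 1 z * Re h + D f \<i> z * Im h)" by blast
    with d show ?thesis by simp
  qed
  have sym: "D u1 \<i> z = D u2 1 z" if "z \<in> U" for z
    using mixed_partials_commute[OF op that lin[OF u3], of 1 "\<lambda>h. D u1 1 z * Re h + D u1 \<i> z * Im h" \<i>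
      "\<lambda>h. D u2 1 z * Re h + D u2 \<i> z * Im h"] lin[OF u12(1) that] lin[OF u12(2) that]
    by (simp add: u1_def u2_def)
  \<comment> \<open>\<open>A\<close> is u_x - \<i> u_y = 2 u_z, and \<open>B\<close> is the
    z-derivative of \<open>A\<close>.\<close>
  define A where "A = (\<lambda>z. Complex (u1 z) (- u2 z))"
  define B where "B = (\<lambda>z. Complex ((D u1 1 z - D u2 \<i> z) / 2) (- D u1 \<i> z))"
  have Du: "(u has_derivative (\<lambda>h. Re (A z * h))) (at z)" if "z \<in> U" for z
    using lin[OF u3 that] by (simp add: A_def u1_def u2_def)
  have complex_der: "((\<lambda>w. Complex (f w) (g w)) has_derivative (\<lambda>h. Complex (f' h) (g' h))) (at z)"
    if "(f has_derivative f') (at z)" "(g has_derivative g') (at z)" for f g f' g' z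
    using that unfolding Complex_eq
    by (auto intro!: derivative_eq_intros)
  have DA0: "has_wirtinger A (B z) (of_real ((D u1 1 z + D u2 \<i> z) / 2)) z" if "z \<in> U" for z
  proof -
    have "(A has_derivative (\<lambda>h. Complex (D u1 1 z * Re h + D u1 \<i> z * Im h) (- (D u2 1 z * Re h + D u2 \<i> z * Im h)))) (at z)"
      unfolding A_def by (intro complex_der has_derivative_minus lin[OF u12(1) that] lin[OF u12(2) that])
    moreover have "Complex (D u1 1 z * Re h + D u1 \<i> z * Im h) (- (D u2 1 z * Re h + D u2 \<i> z * Im h))
      = B z * h + of_real ((D u1 1 z + D u2 \<i> z) / 2) * cnj h" for h
      using sym[OF that] by (simp add: B_def complex_eq_iff field_simps)
    ultimately show ?thesis by (simp add: has_wirtinger_def)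
  qed
  have DA: "has_wirtinger A (B z) (- of_real (\<rho> z)) z" if z: "z \<in> U" for z
  proof -
    have "laplacian u z = 2 * Re (of_real ((D u1 1 z + D u2 \<i> z) / 2))"
      by (rule laplacian_eqI[OF op z Du DA0[OF z]])
    moreover have "laplacian u z = - 2 * \<rho> z"
      using K[OF z] pos[OF z] unfolding gauss_curvature_def u_def by (simp add: field_simps)
    ultimately have "(D u1 1 z + D u2 \<i> z) / 2 = - \<rho> z" by simp
    then show ?thesis using DA0[OF z] by (metis of_real_minus)
  qed
  have \<rho>_eq: "\<rho> z = exp (u z)" if "z \<in> U" for z using pos[OF that] by (simp add: u_def)
  have of_real_wirt: "has_wirtinger (\<lambda>w. of_real (f w)) (p / 2) (cnj p / 2) z"
    if "(f has_derivative (\<lambda>h. Re (p * h))) (at z)" for f p z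
  proof -
    have "of_real (Re (p * h)) = p / 2 * h + cnj p / 2 * cnj h" for h
      by (simp add: complex_eq_iff field_simps)
    moreover have "((\<lambda>w. complex_of_real (f w)) has_derivative (\<lambda>h. of_real (Re (p * h)))) (at z)"
      by (rule has_derivative_of_real[OF that])
    ultimately show ?thesis
      by (simp only: has_wirtinger_def)
  qed
  have D\<rho>: "has_wirtinger (\<lambda>w. of_real (\<rho> w)) (of_real (\<rho> z) * A z / 2) (of_real (\<rho> z) * cnj (A z) / 2) z" if z: "z \<in> U" for z
  proof -
    have "((\<lambda>w. exp (u w)) has_derivative (\<lambda>h. Re (of_real (\<rho> z) * A z * h))) (at z)"
      using has_derivative_exp[OF Du[OF z]] \<rho>_eq[OF z] by (simp add: algebra_simps)
    from of_real_wirt[OF this]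
    have "has_wirtinger (\<lambda>w. of_real (exp (u w))) (of_real (\<rho> z) * A z / 2) (of_real (\<rho> z) * cnj (A z) / 2) z"
      by simp
    then show ?thesis
      by (rule has_wirtinger_cong[OF _ op z]) (simp only: \<rho>_eq)
  qed
  define y where "y = (\<lambda>z. complex_of_real (2 / sqrt (\<rho> z)))"
  \<comment> \<open>Since y = 2 exp (- u / 2), this is y_z. Below, \<open>b\<close> is defined by
    the determinant relation and not as a derivative; that it is the mixed derivative of
    \<open>y\<close> is the Liouville equation, established in \<open>Da\<close>.\<close>
  define a where "a = (\<lambda>z. - y z * A z / 4)"
  define b where "b = (\<lambda>z. (a z * cnj (a z) + 1) / y z)"
  define q where "q = (\<lambda>z. B z / 4 - (A z)\<^sup>2 / 16)"
  have y0: "y z \<noteq> 0" if "z \<in> U" for z using pos[OF that] by (simp add: y_def)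
  have cy: "cnj (y z) = y z" for z by (simp add: y_def)
  have y\<rho>: "(y z)\<^sup>2 * of_real (\<rho> z) = 4" if "z \<in> U" for z
    using pos[OF that] by (simp add: y_def power_divide flip: of_real_power of_real_mult)
  have Dy: "has_wirtinger y (a z) (cnj (a z)) z" if z: "z \<in> U" for z
  proof -
    have d: "((\<lambda>w. 2 * exp (- u w / 2)) has_derivative (\<lambda>h. Re (- of_real (2 / sqrt (\<rho> z)) * A z / 2 * h))) (at z)"
    proof -
      have "((\<lambda>w. 2 * exp (- u w / 2)) has_derivative (\<lambda>h. 2 * (exp (- u z / 2) * (- Re (A z * h) / 2)))) (at z)"
        by (auto intro!: derivative_eq_intros Du z simp: fun_eq_iff field_simps)
      moreover have e1: "exp (- u z / 2) = 1 / sqrt (\<rho> z)"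
      proof -
        have "exp (- u z / 2) = \<rho> z powr (-1/2)" using pos[OF z] by (simp add: powr_def u_def)
        then show ?thesis using pos[OF z] by (simp add: powr_minus_divide powr_half_sqrt)
      qed
      moreover have e2: "2 * ((1 / sqrt (\<rho> z)) * (- Re (A z * h) / 2)) = Re (- of_real (2 / sqrt (\<rho> z)) * A z / 2 * h)" for h
      proof -
        have "- of_real (2 / sqrt (\<rho> z)) * A z / 2 * h = (- A z) / of_real (sqrt (\<rho> z)) * h" by simp
        then have "Re (- of_real (2 / sqrt (\<rho> z)) * A z / 2 * h) = Re (- A z * h) * inverse (sqrt (\<rho> z))"
          by (simp only: Re_divide_of_real_mult)
        then have e: "Re (- of_real (2 / sqrt (\<rho> z)) * A z / 2 * h) = - Re (A z * h) * inverse (sqrt (\<rho> z))"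
          by (simp only: mult_minus_left uminus_complex.sel)
        have g: "2 * (1 / s * (- x / 2)) = - x * inverse s" for x s :: real
          by (cases "s = 0") (simp_all add: field_simps)
        show ?thesis unfolding e by (rule g)
      qed
      ultimately show ?thesis by (simp only: e1 e2)
    qed
    have e: "2 * exp (- u w / 2) = 2 / sqrt (\<rho> w)" if "w \<in> U" for w
    proof -
      have "exp (- u w / 2) = \<rho> w powr (-1/2)" using pos[OF that] by (simp add: powr_def u_def)
      then show ?thesis using pos[OF that] by (simp add: powr_minus_divide powr_half_sqrt)
    qed
    have "has_wirtinger (\<lambda>w. of_real (2 * exp (- u w / 2))) (a z) (cnj (a z)) z"
      using of_real_wirt[OF d] by (simp add: a_def y_def mult.commute)
    then show ?thesis
      by (rule has_wirtinger_cong[OF _ op z]) (simp only: e y_def)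
  qed
  have Da: "has_wirtinger a (- q z * y z) (b z) z" if z: "z \<in> U" for z
  proof -
    have "has_wirtinger (\<lambda>w. (- 1 / 4) * (y w * A w)) ((- 1 / 4) * (a z * A z + y z * B z))
      ((- 1 / 4) * (cnj (a z) * A z + y z * - of_real (\<rho> z))) z"
      by (intro has_wirtinger_cmult has_wirtinger_mult Dy DA z)
    moreover have "(\<lambda>w. (- 1 / 4) * (y w * A w)) = a" by (simp add: a_def fun_eq_iff)
    moreover have "(- 1 / 4) * (a z * A z + y z * B z) = - q z * y z"
      by (simp add: a_def q_def power2_eq_square field_simps)
    moreover have "(- 1 / 4) * (cnj (a z) * A z + y z * - of_real (\<rho> z)) = b z"
    proof -
      have "b z * y z = a z * cnj (a z) + 1" using y0[OF z] by (simp add: b_def)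
      also have "\<dots> = y z * ((- 1 / 4) * (cnj (a z) * A z + y z * - of_real (\<rho> z)))"
        using y\<rho>[OF z] by (simp add: a_def cy power2_eq_square algebra_simps)
      finally have "y z * ((- 1 / 4) * (cnj (a z) * A z + y z * - of_real (\<rho> z))) = y z * b z"
        by (simp only: mult.commute)
      then show ?thesis using y0[OF z] mult_left_cancel by blast
    qed
    ultimately show ?thesis by metis
  qed
  have Dca: "has_wirtinger (\<lambda>w. cnj (a w)) (cnj (b z)) (- cnj (q z) * y z) z" if z: "z \<in> U" for z
    using has_wirtinger_cnj[OF Da[OF z]] by (simp add: cy)
  have cb: "cnj (b z) = b z" for z by (simp add: b_def cy mult.commute)
  have by_eq: "y z * b z - a z * cnj (a z) = 1" if "z \<in> U" for z
    using y0[OF that] by (simp add: b_def)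
  have Db: "has_wirtinger b (- q z * cnj (a z)) (- cnj (q z) * a z) z" if z: "z \<in> U" for z
  proof -
    have "has_wirtinger b
      (((- q z * y z * cnj (a z) + a z * cnj (b z) + 0) * y z - (a z * cnj (a z) + 1) * a z) / (y z)\<^sup>2)
      (((b z * cnj (a z) + a z * (- cnj (q z) * y z) + 0) * y z - (a z * cnj (a z) + 1) * cnj (a z)) / (y z)\<^sup>2) z"
      unfolding b_def
      by (intro has_wirtinger_divide has_wirtinger_add has_wirtinger_mult has_wirtinger_const
        Da[unfolded b_def] Dca[unfolded b_def] Dy z y0)
    moreover have "a z * cnj (a z) + 1 = y z * b z" using by_eq[OF z] by (simp add: algebra_simps)
    moreover have "((- q z * y z * cnj (a z) + a z * cnj (b z) + 0) * y z - (y z * b z) * a z) / (y z)\<^sup>2 = - q z * cnj (a z)"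
      "((b z * cnj (a z) + a z * (- cnj (q z) * y z) + 0) * y z - (y z * b z) * cnj (a z)) / (y z)\<^sup>2 = - cnj (q z) * a z"
      using y0[OF z] by (simp_all add: cb power2_eq_square field_simps)
    ultimately show ?thesis by (simp only:)
  qed
  have qhol: "q holomorphic_on U"
  proof -
    have "q field_differentiable (at z)" if z: "z \<in> U" for z
    proof -
      have lB: "((\<lambda>w. B w) has_derivative (\<lambda>h. Complex
         ((frechet_derivative (D u1 1) (at z) h - frechet_derivative (D u2 \<i>) (at z) h) / 2)
         (- frechet_derivative (D u1 \<i>) (at z) h))) (at z)"
        unfolding B_def divide_inverse
        using C_k_on_SucE(1)[OF C_k_on_SucE(2)[OF u12(1)] z] C_k_on_SucE(1)[OF C_k_on_SucE(2)[OF u12(2)] z]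
        by (intro complex_der has_derivative_minus has_derivative_mult_left has_derivative_diff)
          (auto simp: D_def[abs_def])
      obtain p1 p2 where p: "has_wirtinger B p1 p2 z"
        using real_linear_wirtinger[OF lB] by auto
      \<comment> \<open>Commuting the two derivatives of \<open>A\<close> gives B_zbar = - \<rho>_z,
        which cancels against the conjugate derivative of A^2.\<close>
      have "has_wirtinger (\<lambda>w. - 1 * of_real (\<rho> w)) (- 1 * (of_real (\<rho> z) * A z / 2)) (- 1 * (of_real (\<rho> z) * cnj (A z) / 2)) z"
        by (intro has_wirtinger_cmult D\<rho> z)
      then have p2: "p2 = - 1 * (of_real (\<rho> z) * A z / 2)"
        using DA by (intro wirtinger_commute[OF op z _ p]) auto
      have "has_wirtinger (\<lambda>w. (1/4) * B w - (1/16) * (A w * A w))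
        ((1/4) * p1 - (1/16) * (B z * A z + A z * B z))
        ((1/4) * p2 - (1/16) * (- of_real (\<rho> z) * A z + A z * - of_real (\<rho> z))) z"
        by (intro has_wirtinger_diff has_wirtinger_cmult has_wirtinger_mult p DA z)
      moreover have "(1/4) * p2 - (1/16) * (- of_real (\<rho> z) * A z + A z * - of_real (\<rho> z)) = 0"
        by (simp add: p2)
      moreover have "(\<lambda>w. (1/4) * B w - (1/16) * (A w * A w)) = q"
        by (simp add: q_def fun_eq_iff power2_eq_square)
      ultimately have "has_wirtinger q ((1/4) * p1 - (1/16) * (B z * A z + A z * B z)) 0 z" by metis
      then have "(q has_field_derivative ((1/4) * p1 - (1/16) * (B z * A z + A z * B z))) (at z)"
        by (simp add: has_wirtinger_def has_field_derivative_def)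
      then show ?thesis by (auto simp: field_differentiable_def)
    qed
    then show ?thesis by (simp add: holomorphic_on_def field_differentiable_at_within)
  qed
  show ?thesis
    unfolding liouville_data_def
    using qhol pos Dy Da Db by_eq unfolding y_def by blast
qed

section \<open>Second order linear equations on starlike domains\<close>

text \<open>Picard iteration for w' = v, v' = - q w, with primitives on the starlike domain in place
  of path integrals.\<close>

lemma linear_ode_starlike:
  fixes q :: "complex \<Rightarrow> complex"
  assumes S: "open S" "z0 \<in> S" and seg: "\<And>z. z \<in> S \<Longrightarrow> closed_segment z0 z \<subseteq> S"
    and q: "q holomorphic_on S"
  shows "\<exists>w v. w z0 = c0 \<and> v z0 = c1 \<and> (\<forall>z\<in>S. (w has_field_derivative v z) (at z) \<and>
    (v has_field_derivative - q z * w z) (at z))"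
proof -
  have "\<exists>g. g z0 = 0 \<and> (\<forall>z\<in>S. (g has_field_derivative f z) (at z))" if f: "f holomorphic_on S" for f
  proof -
    obtain g where g: "\<forall>z\<in>S. (g has_field_derivative f z) (at z)"
    proof -
      have "starlike S" using S seg by (auto simp: starlike_def)
      moreover have "f field_differentiable at x" if "x \<in> S - {}" for x
        using f S that by (auto simp: holomorphic_on_imp_differentiable_at)
      ultimately show ?thesis
        using holomorphic_starlike_primitive[of S f "{}"] S f holomorphic_on_imp_continuous_on that by blast
    qed
    show ?thesis
      by (rule exI[of _ "\<lambda>z. g z - g z0"]) (use g in \<open>auto intro!: derivative_eq_intros\<close>)
  qed
  then obtain P where P0: "\<And>f. f holomorphic_on S \<Longrightarrow> P f z0 = 0"
    and P: "\<And>f z. f holomorphic_on S \<Longrightarrow> z \<in> S \<Longrightarrow> (P f has_field_derivative f z) (at z)"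
    by metis
  have Phol: "P f holomorphic_on S" if "f holomorphic_on S" for f
    using P[OF that] S by (auto simp: holomorphic_on_open)
  \<comment> \<open>\<open>f n\<close> and \<open>g n\<close> are the increments of the iteration,
    so the solution is their sum; each one integrates the previous increment of the other
    equation.\<close>
  define F where "F = rec_nat (\<lambda>z. c0, \<lambda>z. c1) (\<lambda>n fg. (P (snd fg), P (\<lambda>z. - q z * fst fg z)))"
  define f where "f n = fst (F n)" for n
  define g where "g n = snd (F n)" for n
  have f0: "f 0 = (\<lambda>z. c0)" and g0: "g 0 = (\<lambda>z. c1)"
    and fS: "f (Suc n) = P (g n)" and gS: "g (Suc n) = P (\<lambda>z. - q z * f n z)" for n
    by (simp_all add: f_def g_def F_def)
  have hol: "f n holomorphic_on S \<and> g n holomorphic_on S" for n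
    by (induction n) (auto simp: f0 g0 fS gS intro!: Phol holomorphic_intros q)
  have hol': "(\<lambda>z. - q z * f n z) holomorphic_on S" for n
    using hol by (intro holomorphic_intros q) auto
  \<comment> \<open>The constant initial terms have derivative 0, so the differentiated series are
    the original ones shifted by one place. This gives the equations for the sums at the
    end.\<close>
  define f' where "f' n = (case n of 0 \<Rightarrow> (\<lambda>z. 0) | Suc m \<Rightarrow> g m)" for n
  define g' where "g' n = (case n of 0 \<Rightarrow> (\<lambda>z. 0) | Suc m \<Rightarrow> (\<lambda>z. - q z * f m z))" for n
  have df: "(f n has_field_derivative f' n z) (at z)" if "z \<in> S" for n z
    using P[of "g _", OF _ that] hol by (cases n) (auto simp: f0 fS f'_def)
  have dg: "(g n has_field_derivative g' n z) (at z)" if "z \<in> S" for n z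
    using P[OF hol' that] by (cases n) (auto simp: g0 gS g'_def)
  define C where "C = max (cmod c0) (cmod c1)"
  have C0: "C \<ge> 0" by (simp add: C_def le_max_iff_disj)
  \<comment> \<open>Estimates along one segment, by comparing derivatives in \<open>t\<close>.
    \<open>K\<close> must dominate both coefficients of the system, 1 and q, each multiplied by the
    length of the segment.\<close>
  have bound: "cmod (f n (z0 + of_real t * (x - z0))) \<le> C * (K * t) ^ n / fact n \<and>
      cmod (g n (z0 + of_real t * (x - z0))) \<le> C * (K * t) ^ n / fact n"
    if x: "x \<in> S" and K: "cmod (x - z0) \<le> K" "\<And>t. t \<in> {0..1} \<Longrightarrow> cmod (q (z0 + of_real t * (x - z0))) * cmod (x - z0) \<le> K"
      and t: "t \<in> {0..1}" for x K t n
    using t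
  proof (induction n arbitrary: t)
    case 0
    show ?case by (simp add: f0 g0 C_def)
  next
    case (Suc n)
    have K0: "K \<ge> 0" using K(1) norm_ge_zero order_trans by blast
    have inS: "z0 + of_real s * (x - z0) \<in> S" if "s \<in> {0..1}" for s :: real
    proof -
      have "z0 + of_real s * (x - z0) \<in> closed_segment z0 x"
        using that unfolding closed_segment_def
        by (auto intro!: exI[of _ s] simp: scaleR_conv_of_real algebra_simps)
      then show ?thesis using seg[OF x] by auto
    qed
    have key: "cmod (h (z0 + of_real t * (x - z0))) \<le> C * (K * t) ^ Suc n / fact (Suc n)"
      if h: "h z0 = 0" "\<And>z. z \<in> S \<Longrightarrow> (h has_field_derivative h' z) (at z)"
        and h': "\<And>s. s \<in> {0..1} \<Longrightarrow> cmod (h' (z0 + of_real s * (x - z0))) * cmod (x - z0) \<le> K * (C * (K * s) ^ n / fact n)"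
      for h h'
    proof (cases "t = 0")
      case False
      with Suc.prems have t: "0 < t" "t \<le> 1" by auto
      define \<phi> where "\<phi> = (\<lambda>s::real. h (z0 + of_real s * (x - z0)))"
      define \<psi> where "\<psi> = (\<lambda>s. C * (K * s) ^ Suc n / fact (Suc n))"
      have d1: "(\<phi> has_vector_derivative (h' (z0 + of_real s * (x - z0)) * (x - z0))) (at s)" if "s \<in> {0..1}" for s
      proof -
        have "((\<lambda>s. z0 + of_real s * (x - z0)) has_vector_derivative (x - z0)) (at s)"
          by (auto intro!: derivative_eq_intros)
        from field_vector_diff_chain_at[OF this h(2)[OF inS[OF that]]]
        show ?thesis by (simp add: \<phi>_def o_def mult.commute)
      qed
      have d2: "(\<psi> has_vector_derivative (K * (C * (K * s) ^ n / fact n))) (at s)" for s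
      proof -
        have "((\<lambda>s. (K * s) ^ Suc n) has_real_derivative (1 + of_nat n) * (K * (K * s) ^ n)) (at s)"
          by (rule DERIV_power_Suc) (auto intro!: derivative_eq_intros)
        from DERIV_cdivide[OF DERIV_cmult[OF this, of C], of "fact (Suc n)"]
        have "(\<psi> has_real_derivative (C * ((1 + of_nat n) * (K * (K * s) ^ n)) / fact (Suc n))) (at s)"
          unfolding \<psi>_def .
        moreover have "C * ((1 + of_nat n) * (K * (K * s) ^ n)) / fact (Suc n) = K * (C * (K * s) ^ n / fact n)"
        proof -
          have "C * (m * (K * p)) / (m * f) = K * (C * p / f)" if "m \<noteq> 0" for m p f :: real
            using that by simp
          from this[of "1 + of_nat n"] show ?thesis by (simp add: add_pos_nonneg less_imp_neq[THEN not_sym])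
        qed
        ultimately show ?thesis by (simp only: has_real_derivative_iff_has_vector_derivative)
      qed
      have "norm (\<phi> t - \<phi> 0) \<le> \<psi> t - \<psi> 0"
      proof (rule differentiable_bound_general[OF t(1), where f'="\<lambda>s. h' (z0 + of_real s * (x - z0)) * (x - z0)"
          and \<phi>'="\<lambda>s. K * (C * (K * s) ^ n / fact n)"])
        show "continuous_on {0..t} \<phi>"
          by (intro continuous_at_imp_continuous_on ballI has_vector_derivative_continuous[OF d1])
            (use t in auto)
        show "continuous_on {0..t} \<psi>"
          by (intro continuous_at_imp_continuous_on ballI has_vector_derivative_continuous[OF d2])
      qed (use d1 d2 h' t in \<open>auto simp: norm_mult\<close>)
      then show ?thesis by (simp add: \<phi>_def \<psi>_def h(1))
    qed (use h(1) in simp)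
    show ?case
    proof
      show "cmod (f (Suc n) (z0 + of_real t * (x - z0))) \<le> C * (K * t) ^ Suc n / fact (Suc n)"
        unfolding fS
      proof (rule key)
        show "cmod (g n (z0 + of_real s * (x - z0))) * cmod (x - z0) \<le> K * (C * (K * s) ^ n / fact n)"
          if "s \<in> {0..1}" for s
        proof -
          have "cmod (g n (z0 + of_real s * (x - z0))) * cmod (x - z0) \<le> (C * (K * s) ^ n / fact n) * K"
            using Suc.IH[OF that] K K0 C0 that by (intro mult_mono) auto
          then show ?thesis by (simp add: mult.commute)
        qed
      qed (use P0 P hol in auto)
      show "cmod (g (Suc n) (z0 + of_real t * (x - z0))) \<le> C * (K * t) ^ Suc n / fact (Suc n)"
        unfolding gS
      proof (rule key)
        show "cmod (- q (z0 + of_real s * (x - z0)) * f n (z0 + of_real s * (x - z0))) * cmod (x - z0)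
            \<le> K * (C * (K * s) ^ n / fact n)"
          if "s \<in> {0..1}" for s
        proof -
          have "(cmod (q (z0 + of_real s * (x - z0))) * cmod (x - z0)) * cmod (f n (z0 + of_real s * (x - z0)))
            \<le> K * (C * (K * s) ^ n / fact n)"
            using Suc.IH[OF that] K K0 C0 that by (intro mult_mono) auto
          then show ?thesis by (simp add: norm_mult mult_ac)
        qed
      qed (use P0 P hol' in auto)
    qed
  qed
  have loc: "\<exists>d h. 0 < d \<and> summable h \<and> (\<forall>n. \<forall>y\<in>ball x d \<inter> S. cmod (f n y) \<le> h n \<and> cmod (g n y) \<le> h n)"
    if x: "x \<in> S" for x
  proof -
    obtain d where d: "d > 0" "cball x d \<subseteq> S" using S(1) x open_contains_cball by blast
    \<comment> \<open>The segments from \<open>z0\<close> to a closed ball around \<open>x\<close>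
      fill a compact set, so one bound on \<open>q\<close> serves all of them; this gives locally
      uniform convergence.\<close>
    define T where "T = (\<lambda>(t, y). z0 + of_real t * (y - z0)) ` ({0..1::real} \<times> cball x d)"
    have "compact T" unfolding T_def
      by (intro compact_continuous_image compact_Times compact_cball compact_Icc)
        (auto intro!: continuous_intros simp: case_prod_unfold)
    moreover have "T \<subseteq> S"
    proof -
      have "z0 + of_real t * (y - z0) \<in> S" if "t \<in> {0..1}" "y \<in> cball x d" for t :: real and y
      proof -
        have "z0 + of_real t * (y - z0) \<in> closed_segment z0 y"
          using that unfolding closed_segment_def
          by (auto intro!: exI[of _ t] simp: scaleR_conv_of_real algebra_simps)
        then show ?thesis using seg d(2) that by blast
      qed
      then show ?thesis by (auto simp: T_def)
    qed
    ultimately have "bounded (q ` T)"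
      using q by (meson compact_continuous_image compact_imp_bounded continuous_on_subset holomorphic_on_imp_continuous_on)
    then obtain M where M: "\<And>z. z \<in> T \<Longrightarrow> cmod (q z) \<le> M" by (auto simp: bounded_iff)
    define R where "R = cmod (x - z0) + d"
    define K where "K = max 1 M * R"
    have "cmod (f n y) \<le> C * K ^ n / fact n \<and> cmod (g n y) \<le> C * K ^ n / fact n" if y: "y \<in> ball x d \<inter> S" for n y
    proof -
      have yR: "cmod (y - z0) \<le> R"
        using y norm_triangle_ineq[of "y - x" "x - z0"] by (auto simp: R_def dist_norm norm_minus_commute)
      have 1: "cmod (y - z0) \<le> K"
      proof -
        have "1 * cmod (y - z0) \<le> max 1 M * R" using yR by (intro mult_mono) auto
        then show ?thesis by (simp add: K_def)
      qed
      have 2: "cmod (q (z0 + of_real t * (y - z0))) * cmod (y - z0) \<le> K" if "t \<in> {0..1}" for t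
      proof -
        have "z0 + of_real t * (y - z0) \<in> T" using that y by (force simp: T_def)
        then have "cmod (q (z0 + of_real t * (y - z0))) \<le> max 1 M" using M by fastforce
        then show ?thesis unfolding K_def using yR by (intro mult_mono) auto
      qed
      show ?thesis using bound[of y K 1 n] 1 2 y by auto
    qed
    moreover have "summable (\<lambda>n. C * K ^ n / fact n)"
      using summable_mult[OF summable_exp[of K], of C] by (simp add: field_simps)
    ultimately show ?thesis using d(1) by blast
  qed
  have "\<exists>w w'. \<forall>x\<in>S. ((\<lambda>n. f n x) sums w x) \<and> ((\<lambda>n. f' n x) sums w' x) \<and> (w has_field_derivative w' x) (at x)"
  proof (rule series_and_derivative_comparison_local[OF S(1) df])
    fix x assume "x \<in> S"
    from loc[OF this] obtain d h where "0 < d" "summable h" "\<forall>n. \<forall>y\<in>ball x d \<inter> S. cmod (f n y) \<le> h n" by blast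
    then show "\<exists>d h. 0 < d \<and> summable h \<and> (\<forall>\<^sub>F n in sequentially. \<forall>y\<in>ball x d \<inter> S. cmod (f n y) \<le> h n)"
      by (intro exI[of _ d] exI[of _ h]) auto
  qed
  then obtain w w' where w: "\<And>x. x \<in> S \<Longrightarrow> (\<lambda>n. f n x) sums w x" "\<And>x. x \<in> S \<Longrightarrow> (\<lambda>n. f' n x) sums w' x"
    "\<And>x. x \<in> S \<Longrightarrow> (w has_field_derivative w' x) (at x)" by blast
  have "\<exists>v v'. \<forall>x\<in>S. ((\<lambda>n. g n x) sums v x) \<and> ((\<lambda>n. g' n x) sums v' x) \<and> (v has_field_derivative v' x) (at x)"
  proof (rule series_and_derivative_comparison_local[OF S(1) dg])
    fix x assume "x \<in> S"
    from loc[OF this] obtain d h where "0 < d" "summable h" "\<forall>n. \<forall>y\<in>ball x d \<inter> S. cmod (g n y) \<le> h n" by blast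
    then show "\<exists>d h. 0 < d \<and> summable h \<and> (\<forall>\<^sub>F n in sequentially. \<forall>y\<in>ball x d \<inter> S. cmod (g n y) \<le> h n)"
      by (intro exI[of _ d] exI[of _ h]) auto
  qed
  then obtain v v' where v: "\<And>x. x \<in> S \<Longrightarrow> (\<lambda>n. g n x) sums v x" "\<And>x. x \<in> S \<Longrightarrow> (\<lambda>n. g' n x) sums v' x"
    "\<And>x. x \<in> S \<Longrightarrow> (v has_field_derivative v' x) (at x)" by blast
  have w'v: "w' x = v x" if "x \<in> S" for x
    using sums_Suc[of "\<lambda>n. f' n x" "v x"] v(1)[OF that] w(2)[OF that] sums_unique2 by (auto simp: f'_def)
  have v'w: "v' x = - q x * w x" if "x \<in> S" for x
    using sums_Suc[of "\<lambda>n. g' n x" "- q x * w x"] sums_mult[OF w(1)[OF that], of "- q x"] v(2)[OF that] sums_unique2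
    by (auto simp: g'_def)
  have "f (Suc n) z0 = 0" "g (Suc n) z0 = 0" for n
    using P0 hol hol' by (auto simp: fS gS)
  then have "(\<lambda>n. f (Suc n) z0) sums 0" "(\<lambda>n. g (Suc n) z0) sums 0" by auto
  then have "(\<lambda>n. f n z0) sums c0" "(\<lambda>n. g n z0) sums c1"
    using sums_Suc[of "\<lambda>n. f n z0" 0] sums_Suc[of "\<lambda>n. g n z0" 0] by (auto simp: f0 g0)
  then have "w z0 = c0" "v z0 = c1" using w(1)[OF S(2)] v(1)[OF S(2)] sums_unique2 by blast+
  then show ?thesis using w(3) v(3) w'v v'w by metis
qed

section \<open>Unitary frames\<close>

text \<open>The quotient \<open>w1 / w2\<close> of a unitary frame is a developing map of \<open>\<rho> dz d\<bar>z\<close>.\<close>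

definition unitary_frame ::
  "(complex \<Rightarrow> real) \<Rightarrow> (complex \<Rightarrow> complex) \<Rightarrow> complex set \<Rightarrow> (complex \<Rightarrow> complex) \<Rightarrow> (complex \<Rightarrow> complex) \<Rightarrow> bool" where
  "unitary_frame \<rho> q S w1 w2 \<longleftrightarrow> (\<exists>v1 v2. \<forall>z\<in>S.
     (w1 has_field_derivative v1 z) (at z) \<and> (v1 has_field_derivative - q z * w1 z) (at z) \<and>
     (w2 has_field_derivative v2 z) (at z) \<and> (v2 has_field_derivative - q z * w2 z) (at z) \<and>
     w1 z * v2 z - v1 z * w2 z = 1 \<and>
     w1 z * cnj (w1 z) + w2 z * cnj (w2 z) = of_real (2 / sqrt (\<rho> z)))"

lemma has_wirtinger_zero_constant:
  assumes "open S" "connected S" "\<And>z. z \<in> S \<Longrightarrow> has_wirtinger f 0 0 z" "x \<in> S" "y \<in> S"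
  shows "f x = f y"
  using has_derivative_zero_unique_connected[OF assms(1,2) _ assms(4,5), of f] assms(3)
  by (simp add: has_wirtinger_def)

text \<open>The initial values factor the matrix \<open>(y, a; cnj a, b)\<close>, of determinant \<open>1\<close>, as \<open>W\<^sup>* W\<close>. The
  quantities \<open>c\<close> in the proof are the entries of \<open>W\<^bsup>-*\<^esup> (y, a; cnj a, b) W\<^bsup>-1\<^esup>\<close>, which the system makes
  constant.\<close>

lemma unitary_frame_exists:
  assumes data: "liouville_data \<rho> U a b q" and "S \<subseteq> U"
    and S: "open S" "z0 \<in> S" and seg: "\<And>z. z \<in> S \<Longrightarrow> closed_segment z0 z \<subseteq> S"
  shows "\<exists>w1 w2. unitary_frame \<rho> q S w1 w2"
proof -
  define y where "y = (\<lambda>z. complex_of_real (2 / sqrt (\<rho> z)))"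
  have q: "q holomorphic_on S" and pos: "\<And>z. z \<in> S \<Longrightarrow> \<rho> z > 0"
    and Dy: "\<And>z. z \<in> S \<Longrightarrow> has_wirtinger y (a z) (cnj (a z)) z"
    and Da: "\<And>z. z \<in> S \<Longrightarrow> has_wirtinger a (- q z * y z) (b z) z"
    and Db: "\<And>z. z \<in> S \<Longrightarrow> has_wirtinger b (- q z * cnj (a z)) (- cnj (q z) * a z) z"
    and det: "\<And>z. z \<in> S \<Longrightarrow> y z * b z - a z * cnj (a z) = 1"
    using data \<open>S \<subseteq> U\<close> holomorphic_on_subset unfolding liouville_data_def y_def by blast+
  have cy: "cnj (y z) = y z" for z by (simp add: y_def)
  have y0: "y z \<noteq> 0" if "z \<in> S" for z using pos[OF that] by (simp add: y_def)
  have cb: "cnj (b z) = b z" if "z \<in> S" for z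
  proof -
    have "y z * b z = 1 + a z * cnj (a z)" using det[OF that] by (simp add: algebra_simps)
    moreover from arg_cong[OF this, of cnj] have "y z * cnj (b z) = 1 + a z * cnj (a z)"
      by (simp add: cy mult.commute)
    ultimately have "y z * b z = y z * cnj (b z)" by simp
    then show ?thesis using y0[OF that] by simp
  qed
  have "connected S"
    by (rule starlike_imp_connected) (use S seg in \<open>unfold starlike_def, blast\<close>)
  \<comment> \<open>Cholesky factorisation at \<open>z0\<close>: with s^2 = y, the initial values
    form a triangular matrix with diagonal s, 1/s and determinant 1.\<close>
  define s where "s = complex_of_real (sqrt (2 / sqrt (\<rho> z0)))"
  have s2: "s * s = y z0" using pos[OF S(2)] by (simp add: s_def y_def flip: of_real_mult)
  have s0: "s \<noteq> 0" using s2 y0[OF S(2)] by auto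
  have cs: "cnj s = s" by (simp add: s_def)
  obtain w1 v1 where w1: "w1 z0 = s" "v1 z0 = a z0 / s"
    and d1: "\<And>z. z \<in> S \<Longrightarrow> (w1 has_field_derivative v1 z) (at z)" "\<And>z. z \<in> S \<Longrightarrow> (v1 has_field_derivative - q z * w1 z) (at z)"
    using linear_ode_starlike[OF S seg q, of s "a z0 / s"] by blast
  obtain w2 v2 where w2: "w2 z0 = 0" "v2 z0 = 1 / s"
    and d2: "\<And>z. z \<in> S \<Longrightarrow> (w2 has_field_derivative v2 z) (at z)" "\<And>z. z \<in> S \<Longrightarrow> (v2 has_field_derivative - q z * w2 z) (at z)"
    using linear_ode_starlike[OF S seg q, of 0 "1 / s"] by blast
  note wi = has_wirtinger_holomorphic
  have Wr: "w1 z * v2 z - v1 z * w2 z = 1" if "z \<in> S" for z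
  proof -
    have "has_wirtinger (\<lambda>z. w1 z * v2 z - v1 z * w2 z) 0 0 z" if "z \<in> S" for z
    proof -
      have "has_wirtinger (\<lambda>z. w1 z * v2 z - v1 z * w2 z)
        (v1 z * v2 z + w1 z * (- q z * w2 z) - ((- q z * w1 z) * w2 z + v1 z * v2 z))
        (0 * v2 z + w1 z * 0 - (0 * w2 z + v1 z * 0)) z"
        by (intro has_wirtinger_diff has_wirtinger_mult wi d1 d2 that)
      then show ?thesis by simp
    qed
    from has_wirtinger_zero_constant[OF S(1) \<open>connected S\<close> this that S(2)]
    show ?thesis using s0 by (simp add: w1 w2)
  qed
  define c where "c w v w' v' z = b z * (w z * cnj (w' z)) - cnj (a z) * (v z * cnj (w' z))
     - a z * (w z * cnj (v' z)) + y z * (v z * cnj (v' z))" for w v w' v' :: "complex \<Rightarrow> complex" and z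
  have const: "c w v w' v' z = c w v w' v' z0"
    if "z \<in> S" and d: "\<And>z. z \<in> S \<Longrightarrow> (w has_field_derivative v z) (at z)" "\<And>z. z \<in> S \<Longrightarrow> (v has_field_derivative - q z * w z) (at z)"
     "\<And>z. z \<in> S \<Longrightarrow> (w' has_field_derivative v' z) (at z)" "\<And>z. z \<in> S \<Longrightarrow> (v' has_field_derivative - q z * w' z) (at z)"
    for w v w' v' z
  proof -
    have "has_wirtinger (c w v w' v') 0 0 z" if z: "z \<in> S" for z
    proof -
      note wd = wi[OF d(1)[OF z]] wi[OF d(2)[OF z]] has_wirtinger_cnj[OF wi[OF d(3)[OF z]]] has_wirtinger_cnj[OF wi[OF d(4)[OF z]]]
      have Dca: "has_wirtinger (\<lambda>w. cnj (a w)) (b z) (- cnj (q z) * y z) z"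
        using has_wirtinger_cnj[OF Da[OF z]] by (simp add: cy cb[OF z])
      have "has_wirtinger (c w v w' v')
        ((- q z * cnj (a z)) * (w z * cnj (w' z)) + b z * (v z * cnj (w' z) + w z * cnj 0)
          - (b z * (v z * cnj (w' z)) + cnj (a z) * ((- q z * w z) * cnj (w' z) + v z * cnj 0))
          - ((- q z * y z) * (w z * cnj (v' z)) + a z * (v z * cnj (v' z) + w z * cnj 0))
          + (a z * (v z * cnj (v' z)) + y z * ((- q z * w z) * cnj (v' z) + v z * cnj 0)))
        ((- cnj (q z) * a z) * (w z * cnj (w' z)) + b z * (0 * cnj (w' z) + w z * cnj (v' z))
          - ((- cnj (q z) * y z) * (v z * cnj (w' z)) + cnj (a z) * (0 * cnj (w' z) + v z * cnj (v' z)))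
          - (b z * (w z * cnj (v' z)) + a z * (0 * cnj (v' z) + w z * cnj (- q z * w' z)))
          + (cnj (a z) * (v z * cnj (v' z)) + y z * (0 * cnj (v' z) + v z * cnj (- q z * w' z)))) z"
        unfolding c_def
        by (intro has_wirtinger_add has_wirtinger_diff has_wirtinger_mult wd Dy Da Db Dca z)
      moreover have "((- q z * cnj (a z)) * (w z * cnj (w' z)) + b z * (v z * cnj (w' z) + w z * cnj 0)
          - (b z * (v z * cnj (w' z)) + cnj (a z) * ((- q z * w z) * cnj (w' z) + v z * cnj 0))
          - ((- q z * y z) * (w z * cnj (v' z)) + a z * (v z * cnj (v' z) + w z * cnj 0))
          + (a z * (v z * cnj (v' z)) + y z * ((- q z * w z) * cnj (v' z) + v z * cnj 0))) = 0"
        by (simp add: algebra_simps)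
      moreover have "((- cnj (q z) * a z) * (w z * cnj (w' z)) + b z * (0 * cnj (w' z) + w z * cnj (v' z))
          - ((- cnj (q z) * y z) * (v z * cnj (w' z)) + cnj (a z) * (0 * cnj (w' z) + v z * cnj (v' z)))
          - (b z * (w z * cnj (v' z)) + a z * (0 * cnj (v' z) + w z * cnj (- q z * w' z)))
          + (cnj (a z) * (v z * cnj (v' z)) + y z * (0 * cnj (v' z) + v z * cnj (- q z * w' z)))) = 0"
        by (simp add: algebra_simps)
      ultimately show ?thesis by simp
    qed
    from has_wirtinger_zero_constant[OF S(1) \<open>connected S\<close> this \<open>z \<in> S\<close> S(2)] show ?thesis .
  qed
  have ys: "y z0 / (s * s) = 1" using s2 y0[OF S(2)] by simp
  have c11: "c w1 v1 w1 v1 z = 1" if "z \<in> S" for z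
  proof -
    have "c w1 v1 w1 v1 z0 = b z0 * (s * s) - 2 * (a z0 * cnj (a z0)) + y z0 / (s * s) * (a z0 * cnj (a z0))"
      using s0 by (simp add: c_def w1 cs field_simps)
    also have "\<dots> = 1" unfolding ys unfolding s2 using det[OF S(2)] by (simp add: algebra_simps)
    finally show ?thesis using const[OF that d1 d1] by simp
  qed
  have c22: "c w2 v2 w2 v2 z = 1" if "z \<in> S" for z
    using const[OF that d2 d2] ys by (simp add: c_def w2 cs)
  have c12: "c w1 v1 w2 v2 z = 0" if "z \<in> S" for z
    using const[OF that d1 d2] s0 by (simp add: c_def w1 w2 cs s2[symmetric])
  have c21: "c w2 v2 w1 v1 z = 0" if "z \<in> S" for z
    using const[OF that d2 d1] s0 by (simp add: c_def w1 w2 cs s2[symmetric])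
  have "w1 z * cnj (w1 z) + w2 z * cnj (w2 z) = y z" if z: "z \<in> S" for z
  proof -
    \<comment> \<open>Once the four constants form the identity matrix, this identity solves for
      \<open>y\<close>; the Wronskian enters through its squared modulus.\<close>
    have "c w1 v1 w1 v1 z * (w2 z * cnj (w2 z)) - c w1 v1 w2 v2 z * (w2 z * cnj (w1 z))
      - c w2 v2 w1 v1 z * (w1 z * cnj (w2 z)) + c w2 v2 w2 v2 z * (w1 z * cnj (w1 z))
      = y z * ((w1 z * v2 z - v1 z * w2 z) * cnj (w1 z * v2 z - v1 z * w2 z))"
      by (simp add: c_def algebra_simps)
    then show ?thesis unfolding c11[OF z] c12[OF z] c21[OF z] c22[OF z] Wr[OF z] by (simp add: algebra_simps)
  qed
  then show ?thesis
    unfolding unitary_frame_def using d1 d2 Wr unfolding y_def by blast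
qed

lemma unitary_frame_subset: "unitary_frame \<rho> q S w1 w2 \<Longrightarrow> T \<subseteq> S \<Longrightarrow> unitary_frame \<rho> q T w1 w2"
  unfolding unitary_frame_def by blast

text \<open>SU(2) acts on frames: determinant 1 preserves the Wronskian, and unitarity preserves the
  norm.\<close>

lemma unitary_frame_rotate:
  assumes "unitary_frame \<rho> q S w1 w2" "\<alpha> * cnj \<alpha> + \<beta> * cnj \<beta> = 1"
  shows "unitary_frame \<rho> q S (\<lambda>z. \<alpha> * w1 z + \<beta> * w2 z) (\<lambda>z. - cnj \<beta> * w1 z + cnj \<alpha> * w2 z)"
proof -
  obtain v1 v2 where d: "\<And>z. z \<in> S \<Longrightarrow> (w1 has_field_derivative v1 z) (at z)"
     "\<And>z. z \<in> S \<Longrightarrow> (v1 has_field_derivative - q z * w1 z) (at z)"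
     "\<And>z. z \<in> S \<Longrightarrow> (w2 has_field_derivative v2 z) (at z)"
     "\<And>z. z \<in> S \<Longrightarrow> (v2 has_field_derivative - q z * w2 z) (at z)"
    and wr: "\<And>z. z \<in> S \<Longrightarrow> w1 z * v2 z - v1 z * w2 z = 1"
    and n: "\<And>z. z \<in> S \<Longrightarrow> w1 z * cnj (w1 z) + w2 z * cnj (w2 z) = of_real (2 / sqrt (\<rho> z))"
    using assms(1) unfolding unitary_frame_def by blast
  have lin: "((\<lambda>z. a * f z + b * g z) has_field_derivative D) (at z)"
    if "(f has_field_derivative f') (at z)" "(g has_field_derivative g') (at z)" "D = a * f' + b * g'" for f g f' g' a b D z
    using that by (auto intro!: derivative_eq_intros)
  show ?thesis
    unfolding unitary_frame_def
  proof (intro exI ballI conjI)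
    fix z assume z: "z \<in> S"
    show "((\<lambda>z. \<alpha> * w1 z + \<beta> * w2 z) has_field_derivative \<alpha> * v1 z + \<beta> * v2 z) (at z)"
      "((\<lambda>z. - cnj \<beta> * w1 z + cnj \<alpha> * w2 z) has_field_derivative - cnj \<beta> * v1 z + cnj \<alpha> * v2 z) (at z)"
      by (rule lin[OF d(1)[OF z] d(3)[OF z] refl])+
    show "((\<lambda>z. \<alpha> * v1 z + \<beta> * v2 z) has_field_derivative - q z * (\<alpha> * w1 z + \<beta> * w2 z)) (at z)"
      "((\<lambda>z. - cnj \<beta> * v1 z + cnj \<alpha> * v2 z) has_field_derivative - q z * (- cnj \<beta> * w1 z + cnj \<alpha> * w2 z)) (at z)"
      by (rule lin[OF d(2)[OF z] d(4)[OF z]], simp add: algebra_simps)+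
    have "(\<alpha> * w1 z + \<beta> * w2 z) * (- cnj \<beta> * v1 z + cnj \<alpha> * v2 z) - (\<alpha> * v1 z + \<beta> * v2 z) * (- cnj \<beta> * w1 z + cnj \<alpha> * w2 z)
      = (\<alpha> * cnj \<alpha> + \<beta> * cnj \<beta>) * (w1 z * v2 z - v1 z * w2 z)" by (simp add: algebra_simps)
    then show "(\<alpha> * w1 z + \<beta> * w2 z) * (- cnj \<beta> * v1 z + cnj \<alpha> * v2 z) - (\<alpha> * v1 z + \<beta> * v2 z) * (- cnj \<beta> * w1 z + cnj \<alpha> * w2 z) = 1"
      unfolding assms(2) wr[OF z] by simp
    have "(\<alpha> * w1 z + \<beta> * w2 z) * cnj (\<alpha> * w1 z + \<beta> * w2 z) + (- cnj \<beta> * w1 z + cnj \<alpha> * w2 z) * cnj (- cnj \<beta> * w1 z + cnj \<alpha> * w2 z)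
      = (\<alpha> * cnj \<alpha> + \<beta> * cnj \<beta>) * (w1 z * cnj (w1 z) + w2 z * cnj (w2 z))" by (simp add: algebra_simps)
    then show "(\<alpha> * w1 z + \<beta> * w2 z) * cnj (\<alpha> * w1 z + \<beta> * w2 z) + (- cnj \<beta> * w1 z + cnj \<alpha> * w2 z) * cnj (- cnj \<beta> * w1 z + cnj \<alpha> * w2 z)
      = of_real (2 / sqrt (\<rho> z))"
      unfolding assms(2) n[OF z] by simp
  qed
qed

text \<open>Both frames are bases of solutions of one linear equation, so a constant matrix relates
  them. Differentiating the common norm shows that their Gram matrices agree, which makes this
  matrix unitary.\<close>

lemma unitary_frame_unique:
  assumes "open S" "connected S" "S \<noteq> {}"
    and w: "unitary_frame \<rho> q S w1 w2" and x: "unitary_frame \<rho> q S x1 x2"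
  shows "\<exists>\<alpha> \<beta>. \<alpha> * cnj \<alpha> + \<beta> * cnj \<beta> = 1 \<and>
    (\<forall>z\<in>S. w1 z = \<alpha> * x1 z + \<beta> * x2 z \<and> w2 z = - cnj \<beta> * x1 z + cnj \<alpha> * x2 z)"
proof -
  obtain v1 v2 where dw: "\<And>z. z \<in> S \<Longrightarrow> (w1 has_field_derivative v1 z) (at z)"
     "\<And>z. z \<in> S \<Longrightarrow> (v1 has_field_derivative - q z * w1 z) (at z)"
     "\<And>z. z \<in> S \<Longrightarrow> (w2 has_field_derivative v2 z) (at z)"
     "\<And>z. z \<in> S \<Longrightarrow> (v2 has_field_derivative - q z * w2 z) (at z)"
    and wrw: "\<And>z. z \<in> S \<Longrightarrow> w1 z * v2 z - v1 z * w2 z = 1"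
    and nw: "\<And>z. z \<in> S \<Longrightarrow> w1 z * cnj (w1 z) + w2 z * cnj (w2 z) = of_real (2 / sqrt (\<rho> z))"
    using w unfolding unitary_frame_def by blast
  obtain y1 y2 where dx: "\<And>z. z \<in> S \<Longrightarrow> (x1 has_field_derivative y1 z) (at z)"
     "\<And>z. z \<in> S \<Longrightarrow> (y1 has_field_derivative - q z * x1 z) (at z)"
     "\<And>z. z \<in> S \<Longrightarrow> (x2 has_field_derivative y2 z) (at z)"
     "\<And>z. z \<in> S \<Longrightarrow> (y2 has_field_derivative - q z * x2 z) (at z)"
    and wrx: "\<And>z. z \<in> S \<Longrightarrow> x1 z * y2 z - y1 z * x2 z = 1"
    and nx: "\<And>z. z \<in> S \<Longrightarrow> x1 z * cnj (x1 z) + x2 z * cnj (x2 z) = of_real (2 / sqrt (\<rho> z))"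
    using x unfolding unitary_frame_def by blast
  note wi = has_wirtinger_holomorphic
  have grad: "has_wirtinger (\<lambda>z. f z * cnj (f' z) + g z * cnj (g' z)) (df * cnj (f' z) + dg * cnj (g' z))
       (f z * cnj df' + g z * cnj dg') z"
    if "(f has_field_derivative df) (at z)" "(g has_field_derivative dg) (at z)"
       "(f' has_field_derivative df') (at z)" "(g' has_field_derivative dg') (at z)" for f g f' g' df dg df' dg' z
  proof -
    have "has_wirtinger (\<lambda>z. f z * cnj (f' z) + g z * cnj (g' z)) (df * cnj (f' z) + f z * cnj 0 + (dg * cnj (g' z) + g z * cnj 0))
       (0 * cnj (f' z) + f z * cnj df' + (0 * cnj (g' z) + g z * cnj dg')) z"
      by (intro has_wirtinger_add has_wirtinger_mult wi has_wirtinger_cnj that)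
    then show ?thesis by simp
  qed
  have n1: "v1 z * cnj (w1 z) + v2 z * cnj (w2 z) = y1 z * cnj (x1 z) + y2 z * cnj (x2 z)" if z: "z \<in> S" for z
  proof -
    have "has_wirtinger (\<lambda>z. w1 z * cnj (w1 z) + w2 z * cnj (w2 z)) (y1 z * cnj (x1 z) + y2 z * cnj (x2 z))
       (x1 z * cnj (y1 z) + x2 z * cnj (y2 z)) z"
      by (rule has_wirtinger_cong[OF grad[OF dx(1,3,1,3)[OF z]] assms(1) z]) (simp only: nw nx)
    from has_wirtinger_unique(1)[OF grad[OF dw(1,3,1,3)[OF z]] this] show ?thesis .
  qed
  have n2: "v1 z * cnj (v1 z) + v2 z * cnj (v2 z) = y1 z * cnj (y1 z) + y2 z * cnj (y2 z)" if z: "z \<in> S" for z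
  proof -
    have "has_wirtinger (\<lambda>z. v1 z * cnj (w1 z) + v2 z * cnj (w2 z)) (- q z * x1 z * cnj (x1 z) + - q z * x2 z * cnj (x2 z))
       (y1 z * cnj (y1 z) + y2 z * cnj (y2 z)) z"
      by (rule has_wirtinger_cong[OF grad[OF dx(2,4,1,3)[OF z]] assms(1) z]) (simp only: n1)
    from has_wirtinger_unique(2)[OF grad[OF dw(2,4,1,3)[OF z]] this] show ?thesis .
  qed
  obtain z0 where z0: "z0 \<in> S" using assms(3) by blast
  \<comment> \<open>Cramer's rule for w1 = \<alpha> x1 + \<beta> x2 and its derivative. As
    Wronskians of solutions, these coefficients are constant.\<close>
  define \<alpha> where "\<alpha> z = w1 z * y2 z - v1 z * x2 z" for z
  define \<beta> where "\<beta> z = v1 z * x1 z - w1 z * y1 z" for z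
  have "has_wirtinger \<alpha> 0 0 z" if z: "z \<in> S" for z
  proof -
    have "has_wirtinger \<alpha> (v1 z * y2 z + w1 z * (- q z * x2 z) - ((- q z * w1 z) * x2 z + v1 z * y2 z))
      (0 * y2 z + w1 z * 0 - (0 * x2 z + v1 z * 0)) z"
      unfolding \<alpha>_def by (intro has_wirtinger_diff has_wirtinger_mult wi dw dx z)
    then show ?thesis by simp
  qed
  then have \<alpha>: "\<alpha> z = \<alpha> z0" if "z \<in> S" for z
    using has_wirtinger_zero_constant[OF assms(1,2)] that z0 by blast
  have "has_wirtinger \<beta> 0 0 z" if z: "z \<in> S" for z
  proof -
    have "has_wirtinger \<beta> ((- q z * w1 z) * x1 z + v1 z * y1 z - (v1 z * y1 z + w1 z * (- q z * x1 z)))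
      (0 * x1 z + v1 z * 0 - (0 * y1 z + w1 z * 0)) z"
      unfolding \<beta>_def by (intro has_wirtinger_diff has_wirtinger_mult wi dw dx z)
    then show ?thesis by simp
  qed
  then have \<beta>: "\<beta> z = \<beta> z0" if "z \<in> S" for z
    using has_wirtinger_zero_constant[OF assms(1,2)] that z0 by blast
  have main: "w1 z = \<alpha> z * x1 z + \<beta> z * x2 z \<and> w2 z = - cnj (\<beta> z) * x1 z + cnj (\<alpha> z) * x2 z
    \<and> \<alpha> z * cnj (\<alpha> z) + \<beta> z * cnj (\<beta> z) = 1" if z: "z \<in> S" for z
  proof -
    define y where "y = w1 z * cnj (w1 z) + w2 z * cnj (w2 z)"
    define a where "a = v1 z * cnj (w1 z) + v2 z * cnj (w2 z)"
    define a' where "a' = w1 z * cnj (v1 z) + w2 z * cnj (v2 z)"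
    define b where "b = v1 z * cnj (v1 z) + v2 z * cnj (v2 z)"
    have cw: "cnj (w1 z) * cnj (v2 z) - cnj (v1 z) * cnj (w2 z) = 1"
      and cx: "cnj (x1 z) * cnj (y2 z) - cnj (y1 z) * cnj (x2 z) = 1"
      using arg_cong[OF wrw[OF z], of cnj] arg_cong[OF wrx[OF z], of cnj] by simp_all
    have yx: "y = x1 z * cnj (x1 z) + x2 z * cnj (x2 z)" using nw[OF z] nx[OF z] by (simp add: y_def)
    have ax: "a = y1 z * cnj (x1 z) + y2 z * cnj (x2 z)" using n1[OF z] by (simp add: a_def)
    have ax': "a' = x1 z * cnj (y1 z) + x2 z * cnj (y2 z)"
      using arg_cong[OF n1[OF z], of cnj] by (simp add: a'_def mult.commute)
    have bx: "b = y1 z * cnj (y1 z) + y2 z * cnj (y2 z)" using n2[OF z] by (simp add: b_def)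
    have det: "y * b - a * a' = 1"
    proof -
      have "y * b - a * a' = (w1 z * v2 z - v1 z * w2 z) * (cnj (w1 z) * cnj (v2 z) - cnj (v1 z) * cnj (w2 z))"
        by (simp add: y_def a_def a'_def b_def algebra_simps)
      then show ?thesis using cw wrw[OF z] by simp
    qed
    \<comment> \<open>The Gram matrix and the conjugate of a frame recover the frame. As the Gram
      matrix is shared and has determinant 1, the second row of the change of basis is determined by
      the conjugate of the first.\<close>
    have W: "w1 z = cnj (v2 z) * y - cnj (w2 z) * a'" "v1 z = cnj (v2 z) * a - cnj (w2 z) * b"
      "w2 z = cnj (w1 z) * a' - cnj (v1 z) * y" "v2 z = cnj (w1 z) * b - cnj (v1 z) * a"
    proof -
      have "cnj (v2 z) * y - cnj (w2 z) * a' = w1 z * (cnj (w1 z) * cnj (v2 z) - cnj (v1 z) * cnj (w2 z))"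
        "cnj (v2 z) * a - cnj (w2 z) * b = v1 z * (cnj (w1 z) * cnj (v2 z) - cnj (v1 z) * cnj (w2 z))"
        "cnj (w1 z) * a' - cnj (v1 z) * y = w2 z * (cnj (w1 z) * cnj (v2 z) - cnj (v1 z) * cnj (w2 z))"
        "cnj (w1 z) * b - cnj (v1 z) * a = v2 z * (cnj (w1 z) * cnj (v2 z) - cnj (v1 z) * cnj (w2 z))"
        by (simp_all add: y_def a_def a'_def b_def algebra_simps)
      then show "w1 z = cnj (v2 z) * y - cnj (w2 z) * a'" "v1 z = cnj (v2 z) * a - cnj (w2 z) * b"
      "w2 z = cnj (w1 z) * a' - cnj (v1 z) * y" "v2 z = cnj (w1 z) * b - cnj (v1 z) * a"
        unfolding cw by simp_all
    qed
    have X: "x1 z = cnj (y2 z) * y - cnj (x2 z) * a'" "y1 z = cnj (y2 z) * a - cnj (x2 z) * b"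
    proof -
      have "cnj (y2 z) * y - cnj (x2 z) * a' = x1 z * (cnj (x1 z) * cnj (y2 z) - cnj (y1 z) * cnj (x2 z))"
        "cnj (y2 z) * a - cnj (x2 z) * b = y1 z * (cnj (x1 z) * cnj (y2 z) - cnj (y1 z) * cnj (x2 z))"
        by (simp_all add: yx ax ax' bx algebra_simps)
      then show "x1 z = cnj (y2 z) * y - cnj (x2 z) * a'" "y1 z = cnj (y2 z) * a - cnj (x2 z) * b"
        unfolding cx by simp_all
    qed
    have \<gamma>: "w2 z * y2 z - v2 z * x2 z = - cnj (\<beta> z)"
    proof -
      have "\<beta> z = (cnj (v2 z) * a - cnj (w2 z) * b) * (cnj (y2 z) * y - cnj (x2 z) * a')
        - (cnj (v2 z) * y - cnj (w2 z) * a') * (cnj (y2 z) * a - cnj (x2 z) * b)"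
        unfolding \<beta>_def W(1,2)[symmetric] X[symmetric] by (rule refl)
      also have "\<dots> = (cnj (v2 z) * cnj (x2 z) - cnj (w2 z) * cnj (y2 z)) * (y * b - a * a')"
        by (simp add: algebra_simps)
      finally show ?thesis unfolding det by simp
    qed
    have \<delta>: "v2 z * x1 z - w2 z * y1 z = cnj (\<alpha> z)"
    proof -
      have "v2 z * x1 z - w2 z * y1 z = (cnj (w1 z) * b - cnj (v1 z) * a) * (cnj (y2 z) * y - cnj (x2 z) * a')
        - (cnj (w1 z) * a' - cnj (v1 z) * y) * (cnj (y2 z) * a - cnj (x2 z) * b)"
        unfolding W(3,4)[symmetric] X[symmetric] by (rule refl)
      also have "\<dots> = (cnj (w1 z) * cnj (y2 z) - cnj (v1 z) * cnj (x2 z)) * (y * b - a * a')"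
        by (simp add: algebra_simps)
      finally show ?thesis unfolding det by (simp add: \<alpha>_def)
    qed
    have "\<alpha> z * x1 z + \<beta> z * x2 z = w1 z * (x1 z * y2 z - y1 z * x2 z)"
      by (simp add: \<alpha>_def \<beta>_def algebra_simps)
    moreover have "- cnj (\<beta> z) * x1 z + cnj (\<alpha> z) * x2 z = w2 z * (x1 z * y2 z - y1 z * x2 z)"
      unfolding \<gamma>[symmetric] \<delta>[symmetric] by (simp add: algebra_simps)
    moreover have "\<alpha> z * cnj (\<alpha> z) + \<beta> z * cnj (\<beta> z) = (w1 z * v2 z - v1 z * w2 z) * (x1 z * y2 z - y1 z * x2 z)"
    proof -
      have "\<alpha> z * cnj (\<alpha> z) + \<beta> z * cnj (\<beta> z) = \<alpha> z * (v2 z * x1 z - w2 z * y1 z) - \<beta> z * (w2 z * y2 z - v2 z * x2 z)"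
        unfolding \<gamma> \<delta> by simp
      then show ?thesis by (simp add: \<alpha>_def \<beta>_def algebra_simps)
    qed
    ultimately show ?thesis unfolding wrw[OF z] wrx[OF z] by simp
  qed
  show ?thesis using main \<alpha> \<beta> z0 by metis
qed

section \<open>Monodromy around a puncture\<close>

text \<open>(s, t) is a unit left eigenvector, with eigenvalue \<open>\<kappa>\<close>, of the SU(2)
  matrix with first row (\<alpha>, \<beta>). By conjugation (- cnj t, cnj s) is then one for cnj
  \<kappa>.\<close>

lemma su2_diagonalise:
  assumes "\<alpha> * cnj \<alpha> + \<beta> * cnj \<beta> = 1"
  shows "\<exists>s t \<kappa>. s * cnj s + t * cnj t = 1 \<and> \<kappa> * cnj \<kappa> = 1 \<and>
    s * \<alpha> - t * cnj \<beta> = \<kappa> * s \<and> s * \<beta> + t * cnj \<alpha> = \<kappa> * t"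
proof (cases "\<beta> = 0")
  case True
  then show ?thesis using assms by (intro exI[of _ 1] exI[of _ 0] exI[of _ \<alpha>]) auto
next
  case False
  define c where "c = Re \<alpha>"
  \<comment> \<open>The characteristic polynomial is x^2 - 2 c x + 1, whose roots lie on the unit
    circle because c^2 \<le> 1.\<close>
  define \<kappa> where "\<kappa> = Complex c (sqrt (1 - c\<^sup>2))"
  have "complex_of_real ((cmod \<alpha>)\<^sup>2 + (cmod \<beta>)\<^sup>2) = of_real 1"
    unfolding of_real_add complex_norm_square using assms by simp
  then have "(cmod \<alpha>)\<^sup>2 + (cmod \<beta>)\<^sup>2 = 1"
    unfolding of_real_eq_iff .
  then have "c\<^sup>2 \<le> 1"
    unfolding c_def cmod_power2 using zero_le_power2[of "Im \<alpha>"] zero_le_power2[of "cmod \<beta>"] cmod_power2[of \<beta>] by linarith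
  then have \<kappa>: "\<kappa> * cnj \<kappa> = 1"
    by (simp add: \<kappa>_def complex_mult_cnj complex_eq_iff)
  have l2: "\<kappa> + cnj \<kappa> = \<alpha> + cnj \<alpha>" by (simp add: \<kappa>_def c_def complex_eq_iff)
  have quad: "\<kappa> * \<kappa> + 1 = \<kappa> * (\<alpha> + cnj \<alpha>)"
    unfolding l2[symmetric] using \<kappa> by (simp add: algebra_simps)
  define n where "n = sqrt ((cmod \<beta>)\<^sup>2 + (cmod (\<alpha> - \<kappa>))\<^sup>2)"
  have n: "n > 0" using False by (simp add: n_def add_pos_nonneg)
  have n2: "of_real n * of_real n = cnj \<beta> * \<beta> + (\<alpha> - \<kappa>) * cnj (\<alpha> - \<kappa>)"
  proof -
    have "n * n = (cmod \<beta>)\<^sup>2 + (cmod (\<alpha> - \<kappa>))\<^sup>2" by (simp add: n_def)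
    then have "of_real n * of_real n = complex_of_real ((cmod \<beta>)\<^sup>2 + (cmod (\<alpha> - \<kappa>))\<^sup>2)"
      unfolding of_real_mult[symmetric] by simp
    then show ?thesis unfolding of_real_add complex_norm_square by (simp add: mult.commute)
  qed
  \<comment> \<open>The first eigenvector equation reads s (\<alpha> - \<kappa>) = t cnj \<beta>.
    For \<beta> = 0 this solution could be zero, hence the separate case.\<close>
  define s where "s = cnj \<beta> / of_real n"
  define t where "t = (\<alpha> - \<kappa>) / of_real n"
  have "s * cnj s + t * cnj t = (cnj \<beta> * \<beta> + (\<alpha> - \<kappa>) * cnj (\<alpha> - \<kappa>)) / (of_real n * of_real n)"
    by (simp only: s_def t_def complex_cnj_divide complex_cnj_complex_of_real times_divide_times_eq
      add_divide_distrib complex_cnj_cnj)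
  also have "\<dots> = 1" unfolding n2[symmetric] using n by simp
  finally have "s * cnj s + t * cnj t = 1" .
  moreover have "s * \<alpha> - t * cnj \<beta> = \<kappa> * s"
    using n by (simp add: s_def t_def field_simps)
  moreover have "s * \<beta> + t * cnj \<alpha> = \<kappa> * t"
  proof -
    have "cnj \<beta> * \<beta> + (\<alpha> - \<kappa>) * cnj \<alpha> = \<kappa> * (\<alpha> - \<kappa>)"
      using assms quad by (simp add: algebra_simps)
    then have "(cnj \<beta> * \<beta> + (\<alpha> - \<kappa>) * cnj \<alpha>) / of_real n = \<kappa> * (\<alpha> - \<kappa>) / of_real n" by simp
    then show ?thesis by (simp add: s_def t_def add_divide_distrib)
  qed
  ultimately show ?thesis using \<kappa> by blast
qed

lemma su2_norm:
  assumes st: "s * cnj s + t * cnj t = 1"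
  shows "(cmod (s * x + t * y))\<^sup>2 + (cmod (- cnj t * x + cnj s * y))\<^sup>2 = (cmod x)\<^sup>2 + (cmod y)\<^sup>2"
proof -
  have "(s * x + t * y) * cnj (s * x + t * y) + (- cnj t * x + cnj s * y) * cnj (- cnj t * x + cnj s * y)
     = (s * cnj s + t * cnj t) * (x * cnj x + y * cnj y)" by (simp add: algebra_simps)
  then have "complex_of_real ((cmod (s * x + t * y))\<^sup>2 + (cmod (- cnj t * x + cnj s * y))\<^sup>2) = of_real ((cmod x)\<^sup>2 + (cmod y)\<^sup>2)"
    unfolding st of_real_add complex_norm_square by simp
  then show ?thesis using of_real_eq_iff by blast
qed

text \<open>The plane cut along the real axis outside \<open>A\<close>. For an interval
  \<open>A\<close> it is starlike about each point of \<open>A\<close>, and all such domains contain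
  both open half-planes, where branches can be compared.\<close>

definition slit :: "real set \<Rightarrow> complex set" where
  "slit A = {z. Im z \<noteq> 0 \<or> Re z \<in> A}"

lemma open_slit: "open A \<Longrightarrow> open (slit A)"
proof -
  assume "open A"
  then have "open (Re -` A)" by (intro open_vimage continuous_intros) auto
  moreover have "open {z. Im z \<noteq> 0}" by (intro open_Collect_neq continuous_intros)
  moreover have "slit A = {z. Im z \<noteq> 0} \<union> Re -` A" by (auto simp: slit_def)
  ultimately show ?thesis by auto
qed

lemma slit_segment:
  assumes "convex A" "a \<in> A" "z \<in> slit A"
  shows "closed_segment (of_real a) z \<subseteq> slit A"
proof
  fix x assume "x \<in> closed_segment (of_real a) z"
  then obtain t where t: "0 \<le> t" "t \<le> 1" "x = (1 - t) *\<^sub>R of_real a + t *\<^sub>R z"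
    by (auto simp: closed_segment_def)
  show "x \<in> slit A"
  proof (cases "Im z = 0 \<or> t = 0")
    case True
    then have "Re x \<in> A"
    proof
      assume "Im z = 0"
      then have "Re z \<in> A" using assms(3) by (simp add: slit_def)
      then have "(1 - t) *\<^sub>R a + t *\<^sub>R Re z \<in> A"
        using assms(1,2) t(1,2) by (intro convexD) auto
      then show ?thesis by (simp add: t(3))
    qed (use assms(2) t(3) in simp)
    then show ?thesis by (simp add: slit_def)
  qed (simp add: t(3) slit_def)
qed

section \<open>Branches of the logarithm at a real point\<close>

definition log_right :: "real \<Rightarrow> complex \<Rightarrow> complex" where
  "log_right p z = Ln (z - of_real p)"

text \<open>The shift by \<i> pi makes this branch agree with \<open>log_right\<close> above the
  real axis; below it, the difference is 2 pi \<i>, the increment around \<open>p\<close>.\<close>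

definition log_left :: "real \<Rightarrow> complex \<Rightarrow> complex" where
  "log_left p z = Ln (of_real p - z) + \<i> * pi"

lemma log_right_deriv:
  "z \<in> slit {p<..} \<Longrightarrow> (log_right p has_field_derivative 1 / (z - of_real p)) (at z)"
  unfolding log_right_def slit_def
  by (auto intro!: derivative_eq_intros simp: complex_nonpos_Reals_iff inverse_eq_divide)

lemma log_left_deriv:
  "z \<in> slit {..<p} \<Longrightarrow> (log_left p has_field_derivative 1 / (z - of_real p)) (at z)"
  unfolding log_left_def slit_def
  by (auto intro!: derivative_eq_intros simp: complex_nonpos_Reals_iff divide_simps)

lemma log_left_upper: "Im z > 0 \<Longrightarrow> log_left p z = log_right p z"
  using Ln_minus[of "z - of_real p"] unfolding log_left_def log_right_def by (cases "z = of_real p") auto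

lemma log_left_lower: "Im z < 0 \<Longrightarrow> log_left p z = log_right p z + 2 * pi * \<i>"
  using Ln_minus[of "z - of_real p"] unfolding log_left_def log_right_def by (cases "z = of_real p") auto

lemma log_holomorphic:
  "T \<subseteq> slit {p<..} \<Longrightarrow> log_right p holomorphic_on T" "T \<subseteq> slit {..<p} \<Longrightarrow> log_left p holomorphic_on T"
  using log_right_deriv log_left_deriv field_differentiable_at_within field_differentiable_def
  unfolding holomorphic_on_def by blast+

lemma cmod_exp_log:
  assumes "z \<noteq> of_real p"
  shows "cmod (exp (of_real \<alpha> * log_right p z)) = cmod (z - of_real p) powr \<alpha>"
    "cmod (exp (of_real \<alpha> * log_left p z)) = cmod (z - of_real p) powr \<alpha>"
  using assms by (simp_all add: log_right_def log_left_def powr_def Re_Ln norm_minus_commute)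

text \<open>Both ends of the normalisation matter: exponents below 1 lead to removable
  singularities, and nonnegative ones keep the powers bounded at the point.\<close>

lemma exists_fractional_exponent:
  assumes "c * cnj c = 1"
  shows "\<exists>\<alpha>::real. 0 \<le> \<alpha> \<and> \<alpha> < 1 \<and> exp (of_real \<alpha> * (2 * pi * \<i>)) = c"
proof -
  have "complex_of_real ((cmod c)\<^sup>2) = of_real 1"
    unfolding complex_norm_square using assms by simp
  then have "cmod c = 1"
    unfolding of_real_eq_iff by (simp add: power2_eq_1_iff)
      (use norm_ge_zero[of c] in linarith)
  then show ?thesis
    using Arg2pi_eq[of c] Arg2pi_ge_0[of c] Arg2pi_lt_2pi[of c]
    by (intro exI[of _ "Arg2pi c / (2 * pi)"]) (auto simp: field_simps)
qed

text \<open>Division by the matching branch of (z - p)^\<alpha> cancels the factor between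
  \<open>l\<close> and \<open>r\<close> below the axis, so the quotient is single-valued off
  \<open>p\<close>. Boundedness of \<open>r\<close> and \<open>l\<close> together with \<alpha> < 1
  removes the singularity.\<close>

lemma glue_puncture:
  assumes \<Omega>: "open \<Omega>" "of_real p \<in> \<Omega>"
    and r: "r holomorphic_on \<Omega> \<inter> slit {p<..}" and l: "l holomorphic_on \<Omega> \<inter> slit {..<p}"
    and up: "\<And>z. z \<in> \<Omega> \<Longrightarrow> Im z > 0 \<Longrightarrow> l z = r z"
    and low: "\<And>z. z \<in> \<Omega> \<Longrightarrow> Im z < 0 \<Longrightarrow> l z = exp (of_real \<alpha> * (2 * pi * \<i>)) * r z"
    and \<alpha>: "\<alpha> < 1"
    and bd: "\<forall>\<^sub>F z in at (of_real p). (z \<in> slit {p<..} \<longrightarrow> cmod (r z) \<le> B) \<and> (z \<in> slit {..<p} \<longrightarrow> cmod (l z) \<le> B)"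
  shows "\<exists>h. h holomorphic_on \<Omega> \<and>
    (\<forall>z\<in>\<Omega> \<inter> slit {p<..}. r z = exp (of_real \<alpha> * log_right p z) * h z) \<and>
    (\<forall>z\<in>\<Omega> \<inter> slit {..<p}. l z = exp (of_real \<alpha> * log_left p z) * h z)"
proof -
  let ?R = "\<Omega> \<inter> slit {p<..}" and ?L = "\<Omega> \<inter> slit {..<p}"
  define k where "k z = (if z \<in> slit {p<..} then r z * exp (- (of_real \<alpha> * log_right p z))
    else l z * exp (- (of_real \<alpha> * log_left p z)))" for z
  have kL: "k z = l z * exp (- (of_real \<alpha> * log_left p z))" if z: "z \<in> ?L" for z
  proof (cases "z \<in> slit {p<..}")
    case True
    then have "Im z \<noteq> 0" using z by (auto simp: slit_def)
    then consider "Im z > 0" | "Im z < 0" by linarith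
    then show ?thesis
    proof cases
      case 1
      then show ?thesis using True up[of z] z by (simp add: k_def log_left_upper)
    next
      case 2
      have "- (of_real \<alpha> * (x + y)) = - (of_real \<alpha> * x) - of_real \<alpha> * y" for x y :: complex
        by (simp add: algebra_simps)
      then have "exp (- (of_real \<alpha> * (x + y))) = exp (- (of_real \<alpha> * x)) / exp (of_real \<alpha> * y)" for x y :: complex
        by (simp only: exp_diff)
      moreover have "k z = r z * exp (- (of_real \<alpha> * log_right p z))" using True by (simp add: k_def)
      ultimately show ?thesis using low[of z] z 2 by (simp only: log_left_lower) simp
    qed
  qed (simp add: k_def)
  have kR: "k z = r z * exp (- (of_real \<alpha> * log_right p z))" if z: "z \<in> ?R" for z
    using z by (simp add: k_def)
  have "k holomorphic_on ?R"
    by (rule holomorphic_transform[of "\<lambda>z. r z * exp (- (of_real \<alpha> * log_right p z))"])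
      (auto intro!: holomorphic_intros r log_holomorphic simp: kR)
  moreover have "k holomorphic_on ?L"
    by (rule holomorphic_transform[of "\<lambda>z. l z * exp (- (of_real \<alpha> * log_left p z))"])
      (auto intro!: holomorphic_intros l log_holomorphic simp: kL)
  moreover have "\<Omega> - {of_real p} = ?R \<union> ?L"
    by (auto simp: slit_def complex_eq_iff)
  ultimately have kh: "k holomorphic_on \<Omega> - {of_real p}"
    using \<Omega>(1) by (simp add: holomorphic_on_Un open_slit open_Int)
  \<comment> \<open>Riemann's criterion: \<open>k\<close> grows at most like |z - p|^(- \<alpha>),
    which is weaker than a simple pole.\<close>
  have "((\<lambda>z. (z - of_real p) * k z) \<longlongrightarrow> 0) (at (of_real p))"
  proof (rule Lim_null_comparison)
    have "\<forall>\<^sub>F z in at (of_real p). z \<in> \<Omega> - {of_real p}"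
      using \<Omega> eventually_at_in_open by blast
    with bd show "\<forall>\<^sub>F z in at (of_real p). norm ((z - of_real p) * k z) \<le> \<bar>B\<bar> * cmod (z - of_real p) powr (1 - \<alpha>)"
    proof eventually_elim
      case (elim z)
      have z: "z \<noteq> of_real p" using elim by simp
      have "cmod (k z) \<le> \<bar>B\<bar> * cmod (z - of_real p) powr (- \<alpha>)"
      proof (cases "z \<in> slit {p<..}")
        case True
        then have "cmod (r z) \<le> \<bar>B\<bar>" using elim by fastforce
        then show ?thesis using True cmod_exp_log(1)[OF z, of "-\<alpha>"]
          by (simp add: k_def norm_mult mult_right_mono)
      next
        case False
        then have "z \<in> slit {..<p}" using z by (auto simp: slit_def complex_eq_iff)
        then have "cmod (l z) \<le> \<bar>B\<bar>" using elim by fastforce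
        then show ?thesis using False cmod_exp_log(2)[OF z, of "-\<alpha>"]
          by (simp add: k_def norm_mult mult_right_mono)
      qed
      then have "cmod (z - of_real p) * cmod (k z) \<le> cmod (z - of_real p) * (\<bar>B\<bar> * cmod (z - of_real p) powr (- \<alpha>))"
        by (rule mult_left_mono) simp
      also have "\<dots> = \<bar>B\<bar> * cmod (z - of_real p) powr (1 - \<alpha>)"
        using z by (simp add: powr_diff powr_minus_divide)
      finally show ?case by (simp add: norm_mult)
    qed
    have "((\<lambda>z. cmod (z - of_real p)) \<longlongrightarrow> 0) (at (of_real p))"
      by (intro tendsto_eq_intros) auto
    then have "((\<lambda>z. cmod (z - of_real p) powr (1 - \<alpha>)) \<longlongrightarrow> 0 powr (1 - \<alpha>)) (at (of_real p))"
      using \<alpha> by (intro tendsto_powr') auto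
    then show "((\<lambda>z. \<bar>B\<bar> * cmod (z - of_real p) powr (1 - \<alpha>)) \<longlongrightarrow> 0) (at (of_real p))"
      using tendsto_mult_right_zero by auto
  qed
  then obtain h where h: "h holomorphic_on \<Omega>" "\<And>z. z \<in> \<Omega> - {of_real p} \<Longrightarrow> h z = k z"
    using holomorphic_on_extend_lim[OF kh] \<Omega> by (metis interior_open)
  have ne: "z \<noteq> of_real p" if "z \<in> ?R \<or> z \<in> ?L" for z using that by (auto simp: slit_def)
  show ?thesis
  proof (intro exI conjI ballI)
    show "r z = exp (of_real \<alpha> * log_right p z) * h z" if "z \<in> ?R" for z
      using h(2)[of z] ne[of z] that kR[OF that] by (simp add: exp_minus field_simps)
    show "l z = exp (of_real \<alpha> * log_left p z) * h z" if "z \<in> ?L" for z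
      using h(2)[of z] ne[of z] that kL[OF that] by (simp add: exp_minus field_simps)
  qed (rule h(1))
qed

text \<open>Below the axis the branches differ by \<open>\<epsilon>\<close> times an SU(2) matrix,
  where \<open>\<epsilon>\<close> stems from a scalar prefactor. The eigenvectors are glued one at a
  time; their eigenvalues multiply to \<epsilon>^2.\<close>

lemma puncture_monodromy:
  assumes \<Omega>: "open \<Omega>" "of_real p \<in> \<Omega>"
    and r: "r1 holomorphic_on \<Omega> \<inter> slit {p<..}" "r2 holomorphic_on \<Omega> \<inter> slit {p<..}"
    and l: "l1 holomorphic_on \<Omega> \<inter> slit {..<p}" "l2 holomorphic_on \<Omega> \<inter> slit {..<p}"
    and up: "\<And>z. z \<in> \<Omega> \<Longrightarrow> Im z > 0 \<Longrightarrow> l1 z = r1 z \<and> l2 z = r2 z"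
    and low: "\<And>z. z \<in> \<Omega> \<Longrightarrow> Im z < 0 \<Longrightarrow> l1 z = \<epsilon> * (a * r1 z + b * r2 z) \<and> l2 z = \<epsilon> * (- cnj b * r1 z + cnj a * r2 z)"
    and unit: "a * cnj a + b * cnj b = 1" "\<epsilon> * cnj \<epsilon> = 1"
    and Yr: "\<And>z. z \<in> \<Omega> \<inter> slit {p<..} \<Longrightarrow> (cmod (r1 z))\<^sup>2 + (cmod (r2 z))\<^sup>2 = Y z"
    and Yl: "\<And>z. z \<in> \<Omega> \<inter> slit {..<p} \<Longrightarrow> (cmod (l1 z))\<^sup>2 + (cmod (l2 z))\<^sup>2 = Y z"
    and lim: "(Y \<longlongrightarrow> Y0) (at (of_real p))" "Y0 > 0"
  obtains s t \<alpha>1 \<alpha>2 h1 h2 where "s * cnj s + t * cnj t = 1" "0 \<le> \<alpha>1" "\<alpha>1 < 1" "0 \<le> \<alpha>2" "\<alpha>2 < 1"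
    "exp (of_real (\<alpha>1 + \<alpha>2) * (2 * pi * \<i>)) = \<epsilon> * \<epsilon>"
    "h1 holomorphic_on \<Omega>" "h2 holomorphic_on \<Omega>"
    "\<And>z. z \<in> \<Omega> \<inter> slit {p<..} \<Longrightarrow> s * r1 z + t * r2 z = exp (of_real \<alpha>1 * log_right p z) * h1 z"
    "\<And>z. z \<in> \<Omega> \<inter> slit {p<..} \<Longrightarrow> - cnj t * r1 z + cnj s * r2 z = exp (of_real \<alpha>2 * log_right p z) * h2 z"
    "\<And>z. z \<in> \<Omega> \<inter> slit {..<p} \<Longrightarrow> s * l1 z + t * l2 z = exp (of_real \<alpha>1 * log_left p z) * h1 z"
    "\<And>z. z \<in> \<Omega> \<inter> slit {..<p} \<Longrightarrow> - cnj t * l1 z + cnj s * l2 z = exp (of_real \<alpha>2 * log_left p z) * h2 z"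
    "\<alpha>1 = 0 \<and> h1 (of_real p) \<noteq> 0 \<or> \<alpha>2 = 0 \<and> h2 (of_real p) \<noteq> 0"
proof -
  obtain s t \<kappa> where st: "s * cnj s + t * cnj t = 1" and \<kappa>: "\<kappa> * cnj \<kappa> = 1"
    and e1: "s * a - t * cnj b = \<kappa> * s" "s * b + t * cnj a = \<kappa> * t"
    using su2_diagonalise[OF unit(1)] by blast
  have e2: "- cnj t * a - cnj s * cnj b = - cnj \<kappa> * cnj t" "- cnj t * b + cnj s * cnj a = cnj \<kappa> * cnj s"
    using arg_cong[OF e1(2), of cnj] arg_cong[OF e1(1), of cnj] by (simp_all add: algebra_simps)
  have u1: "(\<epsilon> * \<kappa>) * cnj (\<epsilon> * \<kappa>) = 1"
  proof -
    have "(\<epsilon> * \<kappa>) * cnj (\<epsilon> * \<kappa>) = (\<epsilon> * cnj \<epsilon>) * (\<kappa> * cnj \<kappa>)" by (simp add: mult_ac)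
    then show ?thesis using unit \<kappa> by simp
  qed
  have u2: "(\<epsilon> * cnj \<kappa>) * cnj (\<epsilon> * cnj \<kappa>) = 1"
  proof -
    have "(\<epsilon> * cnj \<kappa>) * cnj (\<epsilon> * cnj \<kappa>) = (\<epsilon> * cnj \<epsilon>) * (\<kappa> * cnj \<kappa>)" by (simp add: mult_ac)
    then show ?thesis using unit \<kappa> by simp
  qed
  obtain \<alpha>1 where \<alpha>1: "0 \<le> \<alpha>1" "\<alpha>1 < 1" "exp (of_real \<alpha>1 * (2 * pi * \<i>)) = \<epsilon> * \<kappa>"
    using exists_fractional_exponent[OF u1] by blast
  obtain \<alpha>2 where \<alpha>2: "0 \<le> \<alpha>2" "\<alpha>2 < 1" "exp (of_real \<alpha>2 * (2 * pi * \<i>)) = \<epsilon> * cnj \<kappa>"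
    using exists_fractional_exponent[OF u2] by blast
  note rot = su2_norm[OF st]
  have "\<forall>\<^sub>F z in at (of_real p). Y z < Y0 + 1" using lim(1) by (rule order_tendstoD) simp
  moreover have "\<forall>\<^sub>F z in at (of_real p). z \<in> \<Omega>" using \<Omega> eventually_at_in_open' by blast
  ultimately have bd: "\<forall>\<^sub>F z in at (of_real p).
     (z \<in> slit {p<..} \<longrightarrow> cmod (s * r1 z + t * r2 z) \<le> Y0 + 1 \<and> cmod (- cnj t * r1 z + cnj s * r2 z) \<le> Y0 + 1) \<and>
     (z \<in> slit {..<p} \<longrightarrow> cmod (s * l1 z + t * l2 z) \<le> Y0 + 1 \<and> cmod (- cnj t * l1 z + cnj s * l2 z) \<le> Y0 + 1)"
  proof eventually_elim
    case (elim z)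
    have aux: "cmod x \<le> Y0 + 1 \<and> cmod y \<le> Y0 + 1" if "(cmod x)\<^sup>2 + (cmod y)\<^sup>2 = Y z" for x y
    proof -
      have "c \<le> Y0 + 1" if "c\<^sup>2 \<le> Y0 + 1" for c :: real
      proof (rule ccontr)
        assume "\<not> c \<le> Y0 + 1"
        then have "c > Y0 + 1" "c > 1" using lim(2) by auto
        then have "c * 1 < c * c" by (intro mult_strict_left_mono) auto
        then show False using that \<open>c > Y0 + 1\<close> by (simp add: power2_eq_square)
      qed
      moreover have "(cmod x)\<^sup>2 \<le> Y0 + 1" "(cmod y)\<^sup>2 \<le> Y0 + 1"
        using that elim zero_le_power2[of "cmod x"] zero_le_power2[of "cmod y"] by linarith+
      ultimately show ?thesis by blast
    qed
    show ?case
    proof (intro conjI[of "_ \<longrightarrow> _"] impI)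
      assume "z \<in> slit {p<..}"
      then show "cmod (s * r1 z + t * r2 z) \<le> Y0 + 1 \<and> cmod (- cnj t * r1 z + cnj s * r2 z) \<le> Y0 + 1"
        using elim by (intro aux) (simp only: rot Yr Int_iff)
    next
      assume "z \<in> slit {..<p}"
      then show "cmod (s * l1 z + t * l2 z) \<le> Y0 + 1 \<and> cmod (- cnj t * l1 z + cnj s * l2 z) \<le> Y0 + 1"
        using elim by (intro aux) (simp only: rot Yl Int_iff)
    qed
  qed
  have "\<exists>h. h holomorphic_on \<Omega> \<and>
    (\<forall>z\<in>\<Omega> \<inter> slit {p<..}. s * r1 z + t * r2 z = exp (of_real \<alpha>1 * log_right p z) * h z) \<and>
    (\<forall>z\<in>\<Omega> \<inter> slit {..<p}. s * l1 z + t * l2 z = exp (of_real \<alpha>1 * log_left p z) * h z)"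
  proof (rule glue_puncture[OF \<Omega>, where B = "Y0 + 1"])
    show "s * l1 z + t * l2 z = exp (of_real \<alpha>1 * (2 * pi * \<i>)) * (s * r1 z + t * r2 z)" if "z \<in> \<Omega>" "Im z < 0" for z
    proof -
      have "s * l1 z + t * l2 z = \<epsilon> * ((s * a - t * cnj b) * r1 z + (s * b + t * cnj a) * r2 z)"
        unfolding low[OF that, THEN conjunct1] low[OF that, THEN conjunct2] by (simp add: algebra_simps)
      then show ?thesis unfolding e1 \<alpha>1(3) by (simp add: algebra_simps)
    qed
    show "\<forall>\<^sub>F z in at (of_real p). (z \<in> slit {p<..} \<longrightarrow> cmod (s * r1 z + t * r2 z) \<le> Y0 + 1)
        \<and> (z \<in> slit {..<p} \<longrightarrow> cmod (s * l1 z + t * l2 z) \<le> Y0 + 1)"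
      by (rule eventually_mono[OF bd]) blast
  qed (use up \<alpha>1 in \<open>auto intro!: holomorphic_intros r l\<close>)
  then obtain h1 where h1: "h1 holomorphic_on \<Omega>"
    "\<And>z. z \<in> \<Omega> \<inter> slit {p<..} \<Longrightarrow> s * r1 z + t * r2 z = exp (of_real \<alpha>1 * log_right p z) * h1 z"
    "\<And>z. z \<in> \<Omega> \<inter> slit {..<p} \<Longrightarrow> s * l1 z + t * l2 z = exp (of_real \<alpha>1 * log_left p z) * h1 z" by blast
  have "\<exists>h. h holomorphic_on \<Omega> \<and>
    (\<forall>z\<in>\<Omega> \<inter> slit {p<..}. - cnj t * r1 z + cnj s * r2 z = exp (of_real \<alpha>2 * log_right p z) * h z) \<and>
    (\<forall>z\<in>\<Omega> \<inter> slit {..<p}. - cnj t * l1 z + cnj s * l2 z = exp (of_real \<alpha>2 * log_left p z) * h z)"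
  proof (rule glue_puncture[OF \<Omega>, where B = "Y0 + 1"])
    show "- cnj t * l1 z + cnj s * l2 z = exp (of_real \<alpha>2 * (2 * pi * \<i>)) * (- cnj t * r1 z + cnj s * r2 z)" if "z \<in> \<Omega>" "Im z < 0" for z
    proof -
      have "- cnj t * l1 z + cnj s * l2 z = \<epsilon> * ((- cnj t * a - cnj s * cnj b) * r1 z + (- cnj t * b + cnj s * cnj a) * r2 z)"
        unfolding low[OF that, THEN conjunct1] low[OF that, THEN conjunct2] by (simp add: algebra_simps)
      then show ?thesis unfolding e2 \<alpha>2(3) by (simp add: algebra_simps)
    qed
    show "\<forall>\<^sub>F z in at (of_real p). (z \<in> slit {p<..} \<longrightarrow> cmod (- cnj t * r1 z + cnj s * r2 z) \<le> Y0 + 1)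
        \<and> (z \<in> slit {..<p} \<longrightarrow> cmod (- cnj t * l1 z + cnj s * l2 z) \<le> Y0 + 1)"
      by (rule eventually_mono[OF bd]) blast
  qed (use up \<alpha>2 in \<open>auto intro!: holomorphic_intros r l\<close>)
  then obtain h2 where h2: "h2 holomorphic_on \<Omega>"
    "\<And>z. z \<in> \<Omega> \<inter> slit {p<..} \<Longrightarrow> - cnj t * r1 z + cnj s * r2 z = exp (of_real \<alpha>2 * log_right p z) * h2 z"
    "\<And>z. z \<in> \<Omega> \<inter> slit {..<p} \<Longrightarrow> - cnj t * l1 z + cnj s * l2 z = exp (of_real \<alpha>2 * log_left p z) * h2 z" by blast
  have "exp (of_real (\<alpha>1 + \<alpha>2) * (2 * pi * \<i>)) = (\<epsilon> * \<kappa>) * (\<epsilon> * cnj \<kappa>)"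
    unfolding \<alpha>1(3)[symmetric] \<alpha>2(3)[symmetric] by (simp add: distrib_right exp_add)
  also have "\<dots> = \<epsilon> * \<epsilon> * (\<kappa> * cnj \<kappa>)" by (simp add: mult_ac)
  finally have prod: "exp (of_real (\<alpha>1 + \<alpha>2) * (2 * pi * \<i>)) = \<epsilon> * \<epsilon>" using \<kappa> by simp
  \<comment> \<open>Otherwise both components tend to 0 along the real axis from the right, against
    Y0 > 0.\<close>
  have nz: "\<alpha>1 = 0 \<and> h1 (of_real p) \<noteq> 0 \<or> \<alpha>2 = 0 \<and> h2 (of_real p) \<noteq> 0"
  proof (rule ccontr)
    assume contra: "\<not> ?thesis"
    have flim: "LIM x at_right 0. of_real p + complex_of_real x :> at (of_real p)"
      unfolding filterlim_at
      by (auto intro!: tendsto_eq_intros simp: eventually_at_filter)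
    have small: "((\<lambda>x. (x powr \<alpha> * cmod (h (of_real p + complex_of_real x)))\<^sup>2) \<longlongrightarrow> 0) (at_right 0)"
      if "h holomorphic_on \<Omega>" "\<alpha> \<ge> 0" "\<not> (\<alpha> = 0 \<and> h (of_real p) \<noteq> 0)" for h and \<alpha> :: real
    proof -
      have "isCont h (of_real p)"
        using that(1) \<Omega> holomorphic_on_imp_continuous_on continuous_on_eq_continuous_at by blast
      then have "(h \<longlongrightarrow> h (of_real p)) (at (of_real p))" by (simp add: isCont_def)
      then have hl: "((\<lambda>x. h (of_real p + complex_of_real x)) \<longlongrightarrow> h (of_real p)) (at_right 0)"
        using flim by (rule filterlim_compose)
      show ?thesis
      proof (cases "\<alpha> = 0")
        case True
        then have "((\<lambda>x. (1 * cmod (h (of_real p + complex_of_real x)))\<^sup>2) \<longlongrightarrow> 0) (at_right 0)"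
          using that(3) hl by (auto intro!: tendsto_eq_intros)
        then show ?thesis
          by (rule Lim_transform_eventually) (auto simp: True eventually_at_filter)
      next
        case False
        then have "((\<lambda>x::real. x powr \<alpha>) \<longlongrightarrow> 0 powr \<alpha>) (at_right 0)"
          using that(2) by (intro tendsto_powr') (auto intro!: tendsto_eq_intros simp: eventually_at_filter)
        then have "((\<lambda>x::real. x powr \<alpha>) \<longlongrightarrow> 0) (at_right 0)" using False by simp
        then show ?thesis using tendsto_power[OF tendsto_mult[OF _ tendsto_norm[OF hl]], of _ 0 2] by simp
      qed
    qed
    have "((\<lambda>x. (x powr \<alpha>1 * cmod (h1 (of_real p + complex_of_real x)))\<^sup>2 + (x powr \<alpha>2 * cmod (h2 (of_real p + complex_of_real x)))\<^sup>2) \<longlongrightarrow> 0 + 0) (at_right 0)"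
      using contra h1(1) h2(1) \<alpha>1 \<alpha>2 by (intro tendsto_add small) auto
    moreover have "((\<lambda>x. Y (of_real p + complex_of_real x)) \<longlongrightarrow> Y0) (at_right 0)"
      using lim(1) flim by (rule filterlim_compose)
    moreover have "\<forall>\<^sub>F x in at_right 0. Y (of_real p + complex_of_real x) =
        (x powr \<alpha>1 * cmod (h1 (of_real p + complex_of_real x)))\<^sup>2 + (x powr \<alpha>2 * cmod (h2 (of_real p + complex_of_real x)))\<^sup>2"
    proof -
      have "\<forall>\<^sub>F z in at (of_real p). z \<in> \<Omega>" using \<Omega> eventually_at_in_open' by blast
      then have "\<forall>\<^sub>F x in at_right 0. of_real p + complex_of_real x \<in> \<Omega>"
        using flim by (rule eventually_compose_filterlim)
      moreover have "\<forall>\<^sub>F x in at_right 0. x > (0::real)" by (simp add: eventually_at_filter)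
      ultimately show ?thesis
      proof eventually_elim
        case (elim x)
        define z where "z = of_real p + complex_of_real x"
        have z: "z \<in> \<Omega> \<inter> slit {p<..}" "z \<noteq> of_real p" "cmod (z - of_real p) = x"
          using elim by (auto simp: z_def slit_def)
        have "Y z = (cmod (s * r1 z + t * r2 z))\<^sup>2 + (cmod (- cnj t * r1 z + cnj s * r2 z))\<^sup>2"
          unfolding rot using Yr[OF z(1)] by simp
        then show ?case
          unfolding h1(2)[OF z(1)] h2(2)[OF z(1)] norm_mult cmod_exp_log[OF z(2)] z(3) by (simp add: z_def)
      qed
    qed
    ultimately have "((\<lambda>x. Y (of_real p + complex_of_real x)) \<longlongrightarrow> 0 + 0) (at_right 0)"
      "((\<lambda>x. Y (of_real p + complex_of_real x)) \<longlongrightarrow> Y0) (at_right 0)"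
      by (auto simp: tendsto_cong)
    from tendsto_unique[OF _ this] show False using lim(2) by simp
  qed
  show ?thesis
    using that[OF st \<alpha>1(1,2) \<alpha>2(1,2) prod h1(1) h2(1) h1(2) h2(2) h1(3) h2(3) nz] .
qed

section \<open>The developing map of a metric with three conical points\<close>

text \<open>Removes the transition between neighbouring frames above the axis, so that the one below
  it is the monodromy.\<close>

lemma unitary_frame_align:
  assumes H: "open H" "connected H" "H \<noteq> {}" "H \<subseteq> S" "H \<subseteq> T"
    and w: "unitary_frame \<rho> q S w1 w2" and x: "unitary_frame \<rho> q T x1 x2"
  obtains y1 y2 where "unitary_frame \<rho> q T y1 y2" "\<And>z. z \<in> H \<Longrightarrow> y1 z = w1 z \<and> y2 z = w2 z"
proof -
  obtain a b where ab: "a * cnj a + b * cnj b = 1"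
    "\<forall>z\<in>H. w1 z = a * x1 z + b * x2 z \<and> w2 z = - cnj b * x1 z + cnj a * x2 z"
    using unitary_frame_unique[OF H(1-3) unitary_frame_subset[OF w H(4)] unitary_frame_subset[OF x H(5)]] by blast
  show ?thesis
    by (rule that[OF unitary_frame_rotate[OF x ab(1)]]) (use ab(2) in auto)
qed

lemma unitary_frame_holomorphic:
  assumes "open S" "unitary_frame \<rho> q S w1 w2"
  shows "w1 holomorphic_on S" "w2 holomorphic_on S"
  using assms unfolding unitary_frame_def holomorphic_on_open[OF assms(1)] by blast+

lemma unitary_frame_norm:
  assumes "unitary_frame \<rho> q S w1 w2" "z \<in> S"
  shows "(cmod (w1 z))\<^sup>2 + (cmod (w2 z))\<^sup>2 = 2 / sqrt (\<rho> z)"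
proof -
  have "complex_of_real ((cmod (w1 z))\<^sup>2 + (cmod (w2 z))\<^sup>2) = of_real (2 / sqrt (\<rho> z))"
    using assms unfolding unitary_frame_def of_real_add complex_norm_square by blast
  then show ?thesis unfolding of_real_eq_iff .
qed

text \<open>The derivative of the factor \<open>\<psi>\<close> cancels, so the Wronskian 1 is just
  multiplied by \<psi>^2.\<close>

lemma unitary_frame_wronskian:
  assumes S: "open S" and w: "unitary_frame \<rho> q S w1 w2" and z: "z \<in> S" and \<psi>: "\<psi> holomorphic_on S"
    and F: "\<And>z. z \<in> S \<Longrightarrow> F1 z = \<psi> z * w1 z" "\<And>z. z \<in> S \<Longrightarrow> F2 z = \<psi> z * w2 z"
  shows "F1 z * deriv F2 z - deriv F1 z * F2 z = (\<psi> z)\<^sup>2"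
proof -
  obtain v1 v2 where d: "(w1 has_field_derivative v1) (at z)" "(w2 has_field_derivative v2) (at z)"
    and wr: "w1 z * v2 - v1 * w2 z = 1"
    using w z unfolding unitary_frame_def by blast
  have d\<psi>: "(\<psi> has_field_derivative deriv \<psi> z) (at z)" using \<psi> S z by (rule holomorphic_derivI)
  have "(F1 has_field_derivative deriv \<psi> z * w1 z + v1 * \<psi> z) (at z)"
    by (rule has_field_derivative_transform_within_open[OF DERIV_mult[OF d\<psi> d(1)] S z]) (simp add: F)
  moreover have "(F2 has_field_derivative deriv \<psi> z * w2 z + v2 * \<psi> z) (at z)"
    by (rule has_field_derivative_transform_within_open[OF DERIV_mult[OF d\<psi> d(2)] S z]) (simp add: F)
  ultimately have "deriv F1 z = deriv \<psi> z * w1 z + v1 * \<psi> z" "deriv F2 z = deriv \<psi> z * w2 z + v2 * \<psi> z"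
    by (auto intro: DERIV_imp_deriv)
  then have "F1 z * deriv F2 z - deriv F1 z * F2 z = (\<psi> z)\<^sup>2 * (w1 z * v2 - v1 * w2 z)"
    by (simp add: F[OF z] power2_eq_square algebra_simps)
  then show ?thesis unfolding wr by simp
qed

lemma exp_2pi_eq_1_iff: "exp (of_real x * (2 * pi * \<i>)) = 1 \<longleftrightarrow> (x::real) \<in> \<int>"
proof -
  have "exp (of_real x * (2 * pi * \<i>)) = 1 \<longleftrightarrow> (\<exists>n::int. x * (2 * pi) = of_int (2 * n) * pi)"
    by (simp add: exp_eq_1)
  also have "\<dots> \<longleftrightarrow> (\<exists>n::int. x = of_int n)" by simp
  finally show ?thesis by (auto elim: Ints_cases)
qed

text \<open>For f = z^\<alpha> h this is z^(1 - \<alpha>) (f' k - f k'). It is \<open>wr\<close> at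
  a stage where \<open>h\<close> and \<open>k\<close> are known to be entire but not yet
  polynomial.\<close>

definition exp_wronskian :: "real \<Rightarrow> (complex \<Rightarrow> complex) \<Rightarrow> (complex \<Rightarrow> complex) \<Rightarrow> complex \<Rightarrow> complex" where
  "exp_wronskian \<alpha> h k z = of_real \<alpha> * h z * k z + z * (deriv h z * k z - h z * deriv k z)"

text \<open>Only moduli enter the metric, and they do not depend on the branch of the power.\<close>

lemma wronskian_exp_log:
  assumes h: "h holomorphic_on UNIV" "k holomorphic_on UNIV" and z: "z \<in> slit {0<..}"
    and F: "\<And>z. z \<in> slit {0<..} \<Longrightarrow> f z = exp (of_real \<alpha> * log_right 0 z) * h z" "\<And>z. z \<in> slit {0<..} \<Longrightarrow> g z = k z"
  shows "cmod (f z * deriv g z - deriv f z * g z) = cmod z powr (\<alpha> - 1) * cmod (exp_wronskian \<alpha> h k z)"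
proof -
  have S: "open (slit {0<..})" by (simp add: open_slit)
  have z0: "z \<noteq> 0" using z by (auto simp: slit_def)
  have dh: "(h has_field_derivative deriv h z) (at z)" "(k has_field_derivative deriv k z) (at z)"
    using h by (auto intro: holomorphic_derivI)
  have dl: "(log_right 0 has_field_derivative 1 / z) (at z)" using log_right_deriv[OF z] by simp
  define E where "E = exp (of_real \<alpha> * log_right 0 z)"
  have "((\<lambda>z. exp (of_real \<alpha> * log_right 0 z) * h z) has_field_derivative (E * (of_real \<alpha> * (1 / z))) * h z + deriv h z * E) (at z)"
    unfolding E_def by (intro DERIV_mult DERIV_fun_exp DERIV_cmult dh dl)
  then have "(f has_field_derivative (E * (of_real \<alpha> * (1 / z))) * h z + deriv h z * E) (at z)"
    by (rule has_field_derivative_transform_within_open[OF _ S z]) (simp add: F)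
  moreover have "(g has_field_derivative deriv k z) (at z)"
    by (rule has_field_derivative_transform_within_open[OF dh(2) S z]) (simp add: F)
  ultimately have D: "deriv f z = (E * (of_real \<alpha> * (1 / z))) * h z + deriv h z * E" "deriv g z = deriv k z"
    by (auto intro: DERIV_imp_deriv)
  have "f z * deriv g z - deriv f z * g z = - (E / z * exp_wronskian \<alpha> h k z)"
    unfolding D F[OF z] E_def[symmetric] exp_wronskian_def using z0 by (simp add: field_simps)
  then have "cmod (f z * deriv g z - deriv f z * g z) = cmod E / cmod z * cmod (exp_wronskian \<alpha> h k z)"
    by (simp only: norm_minus_cancel norm_mult norm_divide)
  moreover have "cmod E = cmod z powr \<alpha>" unfolding E_def using cmod_exp_log(1)[of z 0 \<alpha>] z0 by simp
  ultimately show ?thesis using z0 by (simp add: powr_diff)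
qed

text \<open>For \<open>g = z\<^sup>\<nu> p / q\<close> one has \<open>g' = z\<^bsup>\<nu> - 1\<^esup> wr \<nu> p q / q\<^sup>2\<close>.\<close>

definition wr :: "real \<Rightarrow> complex poly \<Rightarrow> complex poly \<Rightarrow> complex poly" where
  "wr \<nu> p q = smult (of_real \<nu>) (p * q) + [:0, 1:] * (pderiv p * q - p * pderiv q)"

lemma poly_wr: "poly (wr \<nu> p q) z =
    of_real \<nu> * poly p z * poly q z + z * (poly (pderiv p) z * poly q z - poly p z * poly (pderiv q) z)"
  by (simp add: wr_def mult.assoc)

lemma polynomial_growth_poly:
  assumes "f holomorphic_on UNIV" "\<And>z. A \<le> cmod z \<Longrightarrow> cmod (f z) \<le> B * cmod z ^ n"
  obtains p where "f = poly p"
proof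
  show "f = poly (\<Sum>k\<le>n. monom ((deriv ^^ k) f 0 / fact k) k)"
  proof
    fix z
    have "f z = (\<Sum>k\<le>n. (deriv ^^ k) f 0 / fact k * z ^ k)"
      by (rule Liouville_polynomial[OF assms])
    then show "f z = poly (\<Sum>k\<le>n. monom ((deriv ^^ k) f 0 / fact k) k) z"
      by (simp add: poly_sum poly_monom)
  qed
qed

text \<open>For large |z| the weight |z|^(2 \<alpha>) is at least 1, so the growth of
  \<open>Y\<close> bounds both functions and Liouville's theorem makes them polynomials.\<close>

lemma polynomial_pair:
  assumes h: "h holomorphic_on UNIV" "k holomorphic_on UNIV" and \<alpha>: "\<alpha> \<ge> 0"
    and norm: "\<And>z. z \<noteq> 0 \<Longrightarrow> z \<noteq> 1 \<Longrightarrow> cmod z powr (2 * \<alpha>) * (cmod (h z))\<^sup>2 + (cmod (k z))\<^sup>2 = Y z"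
    and wr: "\<And>z. z \<in> slit {0<..} \<Longrightarrow> z \<noteq> 1 \<Longrightarrow>
      cmod z powr (\<alpha> - 1) * cmod (exp_wronskian \<alpha> h k z) = cmod z powr \<beta>1 * cmod (z - 1) powr \<beta>2"
    and growth: "\<And>z. A \<le> cmod z \<Longrightarrow> Y z \<le> K * cmod z ^ (2 * m)"
  shows "\<exists>P R. h = poly P \<and> k = poly R \<and>
    (\<forall>z. z \<noteq> 0 \<longrightarrow> z \<noteq> 1 \<longrightarrow> cmod z powr (\<alpha> - 1) * cmod (poly (wr \<alpha> P R) z)
      = cmod z powr \<beta>1 * cmod (z - 1) powr \<beta>2)"
proof -
  have sq: "x \<le> sqrt \<bar>K\<bar> * c ^ m" if "x\<^sup>2 \<le> K * c ^ (2 * m)" "c \<ge> 0" for x c :: real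
  proof (rule power2_le_imp_le)
    have "(sqrt \<bar>K\<bar> * c ^ m)\<^sup>2 = \<bar>K\<bar> * c ^ (2 * m)" by (simp add: power_mult_distrib power_mult mult.commute)
    moreover have "K * c ^ (2 * m) \<le> \<bar>K\<bar> * c ^ (2 * m)" using that(2) by (intro mult_right_mono) auto
    ultimately show "x\<^sup>2 \<le> (sqrt \<bar>K\<bar> * c ^ m)\<^sup>2" using that(1) by linarith
  qed (use that in simp)
  have bk: "cmod (k z) \<le> sqrt \<bar>K\<bar> * cmod z ^ m" and bh: "cmod (h z) \<le> sqrt \<bar>K\<bar> * cmod z ^ m" if z: "max A 2 \<le> cmod z" for z
  proof -
    have z01: "z \<noteq> 0" "z \<noteq> 1" using z by auto
    have one: "1 \<le> cmod z powr (2 * \<alpha>)" using z \<alpha> by (intro ge_one_powr_ge_zero) auto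
    have Yz: "Y z \<le> K * cmod z ^ (2 * m)" using growth z by simp
    have "(cmod (h z))\<^sup>2 \<le> cmod z powr (2 * \<alpha>) * (cmod (h z))\<^sup>2"
      using mult_right_mono[OF one, of "(cmod (h z))\<^sup>2"] by simp
    then have "(cmod (k z))\<^sup>2 \<le> K * cmod z ^ (2 * m)" "(cmod (h z))\<^sup>2 \<le> K * cmod z ^ (2 * m)"
      using norm[OF z01] Yz zero_le_power2[of "cmod (h z)"] zero_le_power2[of "cmod (k z)"] by linarith+
    then show "cmod (k z) \<le> sqrt \<bar>K\<bar> * cmod z ^ m" "cmod (h z) \<le> sqrt \<bar>K\<bar> * cmod z ^ m"
      using sq by auto
  qed
  obtain P where P: "h = poly P" using polynomial_growth_poly[OF h(1) bh] by blast
  obtain R where R: "k = poly R" using polynomial_growth_poly[OF h(2) bk] by blast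
  have dP: "deriv (poly p) = poly (pderiv p)" for p :: "complex poly"
    by (intro ext DERIV_imp_deriv poly_DERIV)
    let ?f = "\<lambda>z. cmod z powr (\<alpha> - 1) * cmod (poly (wr \<alpha> P R) z) - cmod z powr \<beta>1 * cmod (z - 1) powr \<beta>2"
  have z0: "?f z = 0" if "z \<in> slit {0<..}" "z \<noteq> 1" for z
    using wr[OF that] by (simp add: exp_wronskian_def poly_wr P R dP)
  have "?f z = 0" if z: "z \<noteq> 0" "z \<noteq> 1" for z
  proof (cases "z \<in> slit {0<..}")
    case False
    \<comment> \<open>On the negative axis, where the Wronskian identity is not given, it follows by
      continuity from above.\<close>
    have cont: "isCont ?f z"
      using z by (intro continuous_intros) auto
    have "((\<lambda>t. z + \<i> * complex_of_real t) \<longlongrightarrow> z + \<i> * of_real 0) (at_right 0)"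
      by (intro tendsto_intros)
    then have "((\<lambda>t. ?f (z + \<i> * complex_of_real t)) \<longlongrightarrow> ?f z) (at_right 0)"
      by (intro isCont_tendsto_compose[OF cont]) simp
    moreover have "\<forall>\<^sub>F t in at_right 0. ?f (z + \<i> * complex_of_real t) = 0"
    proof -
      have "\<forall>\<^sub>F t in at_right 0. t > (0::real)" by (simp add: eventually_at_filter)
      then show ?thesis
      proof eventually_elim
        case (elim t)
        have "z + \<i> * complex_of_real t \<in> slit {0<..} \<and> z + \<i> * complex_of_real t \<noteq> 1"
          using False elim by (auto simp: slit_def complex_eq_iff)
        then show ?case using z0 by blast
      qed
    qed
    ultimately have l0: "((\<lambda>t. 0) \<longlongrightarrow> ?f z) (at_right (0::real))"
      by (rule Lim_transform_eventually)
    show ?thesis using tendsto_unique[OF _ l0 tendsto_const] by simp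
  qed (use z0 z in blast)
  with P R show ?thesis by (intro exI[of _ P] exI[of _ R]) simp
qed

text \<open>The cone at infinity bounds \<open>\<rho>\<close> from below by a power of |z|. Any
  polynomial bound serves Liouville's theorem, so exponents are rounded up freely.\<close>

lemma growth_at_infinity:
  fixes \<rho> :: "complex \<Rightarrow> real"
  assumes lim: "((\<lambda>w. \<rho> (1 / w) / cmod w ^ 4 / cmod w powr (2 * \<beta>3)) \<longlongrightarrow> C) (at 0)" "C > 0"
  obtains A K m where "\<And>z. A \<le> cmod z \<Longrightarrow>
    cmod z powr \<beta>1 * cmod (z - 1) powr real \<beta>2 * (2 / sqrt (\<rho> z)) \<le> K * cmod z ^ (2 * m)"
proof -
  have "\<forall>\<^sub>F w in at 0. \<rho> (1 / w) / cmod w ^ 4 / cmod w powr (2 * \<beta>3) > C / 2"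
    using lim by (intro order_tendstoD) auto
  then obtain d where d: "d > 0" "\<And>w. w \<noteq> 0 \<Longrightarrow> cmod w < d \<Longrightarrow> \<rho> (1 / w) / cmod w ^ 4 / cmod w powr (2 * \<beta>3) > C / 2"
    unfolding eventually_at by (auto simp: dist_norm)
  \<comment> \<open>\<open>m\<close> alone is at least the true exponent; doubling it lets
    \<open>polynomial_pair\<close> take a square root. The factor 2^\<beta>2 in \<open>K\<close>
    comes from |z - 1| \<le> 2 |z|.\<close>
  define m where "m = nat \<lceil>\<beta>1 + real \<beta>2 + 2 + \<beta>3\<rceil>"
  define K where "K = 2 ^ \<beta>2 * (2 / sqrt (C / 2))"
  show ?thesis
  proof (rule that[of "max 2 (2 / d)" K m])
    fix z assume z: "max 2 (2 / d) \<le> cmod z"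
    have z1: "cmod z \<ge> 2" and zd: "cmod z \<ge> 2 / d" using z by auto
    have "cmod (1 / z) < d"
    proof -
      have "2 \<le> d * cmod z" using zd d(1) by (simp add: field_simps)
      then have "1 < d * cmod z" by simp
      then show ?thesis using z1 by (auto simp: norm_divide divide_simps)
    qed
    then have "\<rho> z / (1 / cmod z) ^ 4 / (1 / cmod z) powr (2 * \<beta>3) > C / 2"
      using d(2)[of "1 / z"] z1 by (simp add: norm_divide) (metis norm_zero not_numeral_le_zero)
    moreover have "(1 / cmod z) ^ 4 * (1 / cmod z) powr (2 * \<beta>3) = cmod z powr (- (4 + 2 * \<beta>3))"
    proof -
      have "(1 / cmod z) ^ 4 = cmod z powr (- 4)" using z1 by (simp add: powr_minus_divide power_one_over)
      moreover have "(1 / cmod z) powr (2 * \<beta>3) = cmod z powr (- (2 * \<beta>3))"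
        using z1 by (simp add: powr_divide powr_minus_divide)
      ultimately show ?thesis by (simp add: powr_add[symmetric])
    qed
    ultimately have "\<rho> z / cmod z powr (- (4 + 2 * \<beta>3)) > C / 2" by simp
    then have lower: "C / 2 * cmod z powr (- (4 + 2 * \<beta>3)) \<le> \<rho> z"
    proof -
      assume *: "C / 2 < \<rho> z / cmod z powr (- (4 + 2 * \<beta>3))"
      have "0 < cmod z powr (- (4 + 2 * \<beta>3))" using z1 by auto
      from *[unfolded pos_less_divide_eq[OF this]] show ?thesis by linarith
    qed
    have "sqrt (C / 2) * cmod z powr (- (2 + \<beta>3)) \<le> sqrt (\<rho> z)"
    proof -
      have "sqrt (C / 2 * cmod z powr (- (4 + 2 * \<beta>3))) = sqrt (C / 2) * cmod z powr (- (2 + \<beta>3))"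
        unfolding real_sqrt_mult by (simp add: powr_half_sqrt[symmetric] powr_powr diff_divide_distrib)
      then show ?thesis using real_sqrt_le_mono[OF lower] by simp
    qed
    moreover have "0 < sqrt (C / 2) * cmod z powr (- (2 + \<beta>3))"
      using lim(2) z1 by (intro mult_pos_pos) auto
    ultimately have "2 / sqrt (\<rho> z) \<le> 2 / (sqrt (C / 2) * cmod z powr (- (2 + \<beta>3)))"
      by (intro frac_le) linarith+
    also have "\<dots> = 2 / sqrt (C / 2) * cmod z powr (2 + \<beta>3)"
      unfolding powr_minus_divide[of _ "2 + \<beta>3"] by simp
    finally have 1: "2 / sqrt (\<rho> z) \<le> 2 / sqrt (C / 2) * cmod z powr (2 + \<beta>3)" .
    have "cmod (z - 1) \<le> 2 * cmod z" using norm_triangle_ineq4[of z 1] z1 by simp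
    then have 2: "cmod (z - 1) powr real \<beta>2 \<le> 2 ^ \<beta>2 * cmod z powr real \<beta>2"
      using powr_mono2[of "real \<beta>2" "cmod (z - 1)" "2 * cmod z"] z1 by (simp add: powr_mult powr_realpow)
    have "cmod z powr \<beta>1 * cmod (z - 1) powr real \<beta>2 * (2 / sqrt (\<rho> z))
       \<le> cmod z powr \<beta>1 * (2 ^ \<beta>2 * cmod z powr real \<beta>2) * (2 / sqrt (C / 2) * cmod z powr (2 + \<beta>3))"
    proof (rule order.trans[OF mult_left_mono[OF 1] mult_right_mono[OF mult_left_mono[OF 2]]])
      show "0 \<le> 2 / sqrt (C / 2) * cmod z powr (2 + \<beta>3)" using lim(2) by simp
    qed auto
    also have "\<dots> = K * cmod z powr (\<beta>1 + real \<beta>2 + 2 + \<beta>3)"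
      by (simp add: K_def powr_add)
    also have "\<dots> \<le> K * cmod z powr real (2 * m)"
      using z1 lim(2) by (intro mult_left_mono powr_mono) (auto simp: K_def m_def; linarith)+
    also have "\<dots> = K * cmod z ^ (2 * m)" using z1 by (subst powr_realpow) auto
    finally show "cmod z powr \<beta>1 * cmod (z - 1) powr real \<beta>2 * (2 / sqrt (\<rho> z)) \<le> K * cmod z ^ (2 * m)" .
  qed
qed

text \<open>As constructed, \<open>\<alpha>\<close> is the fractional exponent in (0, 1), so
  \<open>P\<close> may still vanish at 0; \<open>adapt\<close> will move such zeros into the
  exponent.\<close>

lemma developing_pair_exists:
  fixes \<rho> :: "complex \<Rightarrow> real" and \<beta>1 \<beta>3 :: real and \<beta>2 :: nat
  assumes data: "liouville_data \<rho> (- {0, 1}) a b q"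
    and lim0: "((\<lambda>z. \<rho> z / cmod z powr (2 * \<beta>1)) \<longlongrightarrow> C0) (at 0)" "C0 > 0"
    and lim1: "((\<lambda>z. \<rho> z / cmod (z - 1) powr (2 * real \<beta>2)) \<longlongrightarrow> C1) (at 1)" "C1 > 0"
    and liminf: "((\<lambda>w. \<rho> (1 / w) / cmod w ^ 4 / cmod w powr (2 * \<beta>3)) \<longlongrightarrow> C3) (at 0)" "C3 > 0"
    and \<beta>1: "\<beta>1 \<notin> \<int>"
  obtains \<alpha> :: real and P R :: "complex poly" where "\<alpha> \<notin> \<int>" "poly R 0 \<noteq> 0"
    "poly P 1 \<noteq> 0 \<or> poly R 1 \<noteq> 0"
    "\<And>z. z \<noteq> 0 \<Longrightarrow> z \<noteq> 1 \<Longrightarrow> cmod z powr (2 * \<alpha>) * (cmod (poly P z))\<^sup>2 + (cmod (poly R z))\<^sup>2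
       = cmod z powr \<beta>1 * cmod (z - 1) powr real \<beta>2 * (2 / sqrt (\<rho> z))"
    "\<And>z. z \<noteq> 0 \<Longrightarrow> z \<noteq> 1 \<Longrightarrow> cmod z powr (\<alpha> - 1) * cmod (poly (wr \<alpha> P R) z)
      = cmod z powr \<beta>1 * cmod (z - 1) powr real \<beta>2"
proof -
  define Y where "Y z = cmod z powr \<beta>1 * cmod (z - 1) powr real \<beta>2 * (2 / sqrt (\<rho> z))" for z
  have pos: "\<rho> z > 0" if "z \<noteq> 0" "z \<noteq> 1" for z using data that by (auto simp: liouville_data_def)
  have sqrt_powr: "sqrt (x / c powr (2 * \<beta>)) = sqrt x / c powr \<beta>" for x c \<beta> :: real
    by (simp add: real_sqrt_divide powr_half_sqrt[symmetric] powr_powr)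

  \<comment> \<open>Limits of the squared norm \<open>Y\<close> at 0 and 1\<close>
  have Y0: "(Y \<longlongrightarrow> 2 / sqrt C0) (at 0)"
  proof (rule Lim_transform_eventually)
    have "((\<lambda>z. cmod (z - 1) powr real \<beta>2 * (2 / sqrt (\<rho> z / cmod z powr (2 * \<beta>1)))) \<longlongrightarrow>
      cmod (0 - 1) powr real \<beta>2 * (2 / sqrt C0)) (at 0)"
      using lim0(2) by (intro tendsto_intros lim0) auto
    then show "((\<lambda>z. cmod (z - 1) powr real \<beta>2 * (2 / sqrt (\<rho> z / cmod z powr (2 * \<beta>1)))) \<longlongrightarrow> 2 / sqrt C0) (at 0)"
      by simp
    show "\<forall>\<^sub>F z in at 0. cmod (z - 1) powr real \<beta>2 * (2 / sqrt (\<rho> z / cmod z powr (2 * \<beta>1))) = Y z"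
      unfolding Y_def sqrt_powr by (simp add: mult_ac)
  qed
  have Y1: "(Y \<longlongrightarrow> 2 / sqrt C1) (at 1)"
  proof (rule Lim_transform_eventually)
    have "((\<lambda>z. cmod z powr \<beta>1 * (2 / sqrt (\<rho> z / cmod (z - 1) powr (2 * real \<beta>2)))) \<longlongrightarrow>
      cmod 1 powr \<beta>1 * (2 / sqrt C1)) (at 1)"
      using lim1(2) by (intro tendsto_intros lim1) auto
    then show "((\<lambda>z. cmod z powr \<beta>1 * (2 / sqrt (\<rho> z / cmod (z - 1) powr (2 * real \<beta>2)))) \<longlongrightarrow> 2 / sqrt C1) (at 1)"
      by simp
    show "\<forall>\<^sub>F z in at 1. cmod z powr \<beta>1 * (2 / sqrt (\<rho> z / cmod (z - 1) powr (2 * real \<beta>2))) = Y z"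
      unfolding Y_def sqrt_powr by (simp add: mult_ac)
  qed

  \<comment> \<open>Frames on the slit planes\<close>
  define H where "H = {z. Im z > 0}"
  define L where "L = {z. Im z < 0}"
  have H: "open H" "connected H" "H \<noteq> {}"
    unfolding H_def using convex_halfspace_Im_gt[of 0] open_halfspace_Im_gt[of 0]
    by (auto intro: convex_connected exI[of _ \<i>])
  have L: "open L" "connected L" "L \<noteq> {}"
    unfolding L_def using convex_halfspace_Im_lt[of 0] open_halfspace_Im_lt[of 0]
    by (auto intro: convex_connected exI[of _ "-\<i>"])
  let ?S1 = "slit {..<0}" and ?S2 = "slit {0<..<1}" and ?S3 = "slit {1<..}" and ?\<Omega> = "slit {0<..}"
  have HL: "H \<subseteq> slit A" "L \<subseteq> slit A" for A by (auto simp: H_def L_def slit_def)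
  have op: "open ?S1" "open ?S2" "open ?S3" "open ?\<Omega>" by (simp_all add: open_slit)
  \<comment> \<open>If the interval misses 0 and 1, the slit plane is a starlike part of the doubly
    punctured plane, so a frame exists on it.\<close>
  have frame: "\<exists>w1 w2. unitary_frame \<rho> q (slit A) w1 w2" if "open A" "convex A" "x \<in> A" "0 \<notin> A" "1 \<notin> A" for A x
  proof (rule unitary_frame_exists[OF data])
    show "slit A \<subseteq> - {0, 1}" using that by (auto simp: slit_def)
    show "of_real x \<in> slit A" using that by (simp add: slit_def)
    show "closed_segment (of_real x) z \<subseteq> slit A" if "z \<in> slit A" for z
      using slit_segment[OF \<open>convex A\<close> \<open>x \<in> A\<close> that] .
  qed (use that open_slit in auto)
  obtain m1 m2 where m: "unitary_frame \<rho> q ?S2 m1 m2" using frame[of "{0<..<1}" "1/2"] by auto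
  obtain r1' r2' where "unitary_frame \<rho> q ?S3 r1' r2'" using frame[of "{1<..}" 2] by auto
  then obtain r1 r2 where r: "unitary_frame \<rho> q ?S3 r1 r2" and rm: "\<And>z. z \<in> H \<Longrightarrow> r1 z = m1 z \<and> r2 z = m2 z"
    using unitary_frame_align[OF H HL(1) HL(1) m] by blast
  obtain a1 b1 where ab1: "a1 * cnj a1 + b1 * cnj b1 = 1"
    "\<And>z. z \<in> L \<Longrightarrow> m1 z = a1 * r1 z + b1 * r2 z \<and> m2 z = - cnj b1 * r1 z + cnj a1 * r2 z"
    using unitary_frame_unique[OF L unitary_frame_subset[OF m HL(2)] unitary_frame_subset[OF r HL(2)]] by blast
  define \<psi> where "\<psi> l0 l1 z = exp (of_real (\<beta>1 / 2) * l0 z) * exp (of_real (real \<beta>2 / 2) * l1 z)" for l0 l1 :: "complex \<Rightarrow> complex" and z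
  \<comment> \<open>Each branch of z^(\<beta>1/2) (z - 1)^(\<beta>2/2) uses the logarithms that are
    holomorphic on its slit plane; all three agree above the axis.\<close>
  define \<psi>1 where "\<psi>1 = \<psi> (log_left 0) (log_left 1)"
  define \<psi>2 where "\<psi>2 = \<psi> (log_right 0) (log_left 1)"
  define \<psi>3 where "\<psi>3 = \<psi> (log_right 0) (log_right 1)"
  have sub: "?S1 \<subseteq> slit {..<0}" "?S1 \<subseteq> slit {..<1}" "?S2 \<subseteq> slit {0<..}" "?S2 \<subseteq> slit {..<1}" "?S3 \<subseteq> slit {0<..}" "?S3 \<subseteq> slit {1<..}"
    by (auto simp: slit_def)
  have hol\<psi>: "\<psi>1 holomorphic_on ?S1" "\<psi>2 holomorphic_on ?S2" "\<psi>3 holomorphic_on ?S3"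
    unfolding \<psi>1_def \<psi>2_def \<psi>3_def \<psi>_def
    by (intro holomorphic_intros log_holomorphic sub)+
  have norm\<psi>: "(cmod (\<psi>1 z))\<^sup>2 = cmod z powr \<beta>1 * cmod (z - 1) powr real \<beta>2"
     "(cmod (\<psi>2 z))\<^sup>2 = cmod z powr \<beta>1 * cmod (z - 1) powr real \<beta>2"
     "(cmod (\<psi>3 z))\<^sup>2 = cmod z powr \<beta>1 * cmod (z - 1) powr real \<beta>2" if "z \<noteq> 0" "z \<noteq> 1" for z
  proof -
    have e0: "cmod (exp (of_real \<alpha> * log_right 0 z)) = cmod z powr \<alpha>" "cmod (exp (of_real \<alpha> * log_left 0 z)) = cmod z powr \<alpha>" for \<alpha>
      using cmod_exp_log[of z 0] that by simp_all
    have e1: "cmod (exp (of_real \<alpha> * log_right 1 z)) = cmod (z - 1) powr \<alpha>" "cmod (exp (of_real \<alpha> * log_left 1 z)) = cmod (z - 1) powr \<alpha>" for \<alpha>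
      using cmod_exp_log[of z 1] that by simp_all
    have p: "(x powr (c / 2))\<^sup>2 = x powr c" for x c :: real
      by (simp add: power2_eq_square powr_add[symmetric])
    show "(cmod (\<psi>1 z))\<^sup>2 = cmod z powr \<beta>1 * cmod (z - 1) powr real \<beta>2"
     "(cmod (\<psi>2 z))\<^sup>2 = cmod z powr \<beta>1 * cmod (z - 1) powr real \<beta>2"
     "(cmod (\<psi>3 z))\<^sup>2 = cmod z powr \<beta>1 * cmod (z - 1) powr real \<beta>2"
      unfolding \<psi>1_def \<psi>2_def \<psi>3_def \<psi>_def norm_mult power_mult_distrib e0 e1 p by (rule refl)+
  qed
  have frameY: "(cmod (c * x1))\<^sup>2 + (cmod (c * x2))\<^sup>2 = Y z"
    if "(cmod c)\<^sup>2 = cmod z powr \<beta>1 * cmod (z - 1) powr real \<beta>2" "(cmod x1)\<^sup>2 + (cmod x2)\<^sup>2 = 2 / sqrt (\<rho> z)" for c x1 x2 z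
    unfolding norm_mult power_mult_distrib distrib_left[symmetric] that Y_def by (rule refl)
  have ne: "z \<noteq> 0" "z \<noteq> 1" if "z \<in> ?S1 \<or> z \<in> ?S2 \<or> z \<in> ?S3" for z using that by (auto simp: slit_def)
  \<comment> \<open>The monodromy of the prefactor at 1 and at 0. The squares are exp (2 pi \<i>
    \<beta>2) = 1 and exp (2 pi \<i> \<beta>1).\<close>
  define \<epsilon>1 where "\<epsilon>1 = exp (of_real (real \<beta>2 / 2) * (2 * pi * \<i>))"
  define \<epsilon>0 where "\<epsilon>0 = exp (of_real (\<beta>1 / 2) * (2 * pi * \<i>))"
  have eps: "exp (of_real (c / 2) * (2 * pi * \<i>)) * cnj (exp (of_real (c / 2) * (2 * pi * \<i>))) = 1"
    "exp (of_real (c / 2) * (2 * pi * \<i>)) * exp (of_real (c / 2) * (2 * pi * \<i>)) = exp (of_real c * (2 * pi * \<i>))" for c :: real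
    by (simp_all add: exp_cnj exp_minus exp_add[symmetric] field_simps)
  have \<psi>H: "\<psi>2 z = \<psi>3 z" "\<psi>1 z = \<psi>2 z" if "Im z > 0" for z
    using that by (simp_all add: \<psi>1_def \<psi>2_def \<psi>3_def \<psi>_def log_left_upper)
  have \<psi>L: "\<psi>2 z = \<epsilon>1 * \<psi>3 z" "\<psi>1 z = \<epsilon>0 * \<psi>2 z" if "Im z < 0" for z
    using that by (simp_all add: \<psi>1_def \<psi>2_def \<psi>3_def \<psi>_def log_left_lower \<epsilon>1_def \<epsilon>0_def distrib_left exp_add mult_ac)

  \<comment> \<open>Monodromy at 1\<close>
  have cap: "?\<Omega> \<inter> slit {1<..} = ?S3" "?\<Omega> \<inter> slit {..<1} = ?S2"
    by (auto simp: slit_def)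
  note hm = unitary_frame_holomorphic[OF op(2) m] and hr = unitary_frame_holomorphic[OF op(3) r]
  have one_\<Omega>: "of_real 1 \<in> ?\<Omega>" by (simp add: slit_def)
  obtain s t \<alpha>1 \<alpha>2 h1 h2 where st: "s * cnj s + t * cnj t = 1" and \<alpha>: "0 \<le> \<alpha>1" "\<alpha>1 < 1" "0 \<le> \<alpha>2" "\<alpha>2 < 1"
    "exp (of_real (\<alpha>1 + \<alpha>2) * (2 * pi * \<i>)) = \<epsilon>1 * \<epsilon>1"
    and h: "h1 holomorphic_on ?\<Omega>" "h2 holomorphic_on ?\<Omega>"
    and hS3: "\<And>z. z \<in> ?\<Omega> \<inter> slit {1<..} \<Longrightarrow> s * (\<psi>3 z * r1 z) + t * (\<psi>3 z * r2 z) = exp (of_real \<alpha>1 * log_right 1 z) * h1 z"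
     "\<And>z. z \<in> ?\<Omega> \<inter> slit {1<..} \<Longrightarrow> - cnj t * (\<psi>3 z * r1 z) + cnj s * (\<psi>3 z * r2 z) = exp (of_real \<alpha>2 * log_right 1 z) * h2 z"
    and hS2: "\<And>z. z \<in> ?\<Omega> \<inter> slit {..<1} \<Longrightarrow> s * (\<psi>2 z * m1 z) + t * (\<psi>2 z * m2 z) = exp (of_real \<alpha>1 * log_left 1 z) * h1 z"
     "\<And>z. z \<in> ?\<Omega> \<inter> slit {..<1} \<Longrightarrow> - cnj t * (\<psi>2 z * m1 z) + cnj s * (\<psi>2 z * m2 z) = exp (of_real \<alpha>2 * log_left 1 z) * h2 z"
    and nz: "\<alpha>1 = 0 \<and> h1 (of_real 1) \<noteq> 0 \<or> \<alpha>2 = 0 \<and> h2 (of_real 1) \<noteq> 0"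
  proof (rule puncture_monodromy[of ?\<Omega> 1 "\<lambda>z. \<psi>3 z * r1 z" "\<lambda>z. \<psi>3 z * r2 z" "\<lambda>z. \<psi>2 z * m1 z" "\<lambda>z. \<psi>2 z * m2 z" \<epsilon>1 a1 b1 Y "2 / sqrt C1"])
    show "\<psi>2 z * m1 z = \<psi>3 z * r1 z \<and> \<psi>2 z * m2 z = \<psi>3 z * r2 z" if "Im z > 0" for z
      using rm[of z] that by (simp add: \<psi>H H_def)
    show "\<psi>2 z * m1 z = \<epsilon>1 * (a1 * (\<psi>3 z * r1 z) + b1 * (\<psi>3 z * r2 z)) \<and>
      \<psi>2 z * m2 z = \<epsilon>1 * (- cnj b1 * (\<psi>3 z * r1 z) + cnj a1 * (\<psi>3 z * r2 z))" if "Im z < 0" for z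
    proof -
      have e: "m1 z = a1 * r1 z + b1 * r2 z" "m2 z = - cnj b1 * r1 z + cnj a1 * r2 z"
        using ab1(2)[of z] that by (simp_all add: L_def)
      show ?thesis unfolding e \<psi>L[OF that] by (simp add: algebra_simps)
    qed
    show "(cmod (\<psi>3 z * r1 z))\<^sup>2 + (cmod (\<psi>3 z * r2 z))\<^sup>2 = Y z" if "z \<in> ?\<Omega> \<inter> slit {1<..}" for z
      using that unfolding cap by (intro frameY norm\<psi> unitary_frame_norm[OF r] ne) auto
    show "(cmod (\<psi>2 z * m1 z))\<^sup>2 + (cmod (\<psi>2 z * m2 z))\<^sup>2 = Y z" if "z \<in> ?\<Omega> \<inter> slit {..<1}" for z
      using that unfolding cap by (intro frameY norm\<psi> unitary_frame_norm[OF m] ne) auto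
  qed (use ab1(1) eps(1)[of "real \<beta>2"] Y1 lim1(2) op one_\<Omega> hr hm hol\<psi> in
      \<open>auto simp: cap \<epsilon>1_def intro!: holomorphic_intros\<close>)
  \<comment> \<open>The exponents at 1 have an integral sum. One of them is 0 and the other is below
    1, so both vanish, and \<open>h1\<close>, \<open>h2\<close> extend the rotated frame across
    1.\<close>
  have "exp (of_real (\<alpha>1 + \<alpha>2) * (2 * pi * \<i>)) = 1"
    unfolding \<alpha>(5) \<epsilon>1_def eps(2) unfolding exp_2pi_eq_1_iff by simp
  then have "\<alpha>1 + \<alpha>2 \<in> \<int>" unfolding exp_2pi_eq_1_iff .
  then obtain n :: int where "\<alpha>1 + \<alpha>2 = of_int n" by (rule Ints_cases)
  moreover have "\<alpha>1 + \<alpha>2 < 1" "0 \<le> \<alpha>1 + \<alpha>2" using nz \<alpha>(1-4) by auto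
  ultimately have "\<alpha>1 + \<alpha>2 = 0" by auto
  then have \<alpha>0: "\<alpha>1 = 0" "\<alpha>2 = 0" using \<alpha>(1,3) by auto
  define M1 where "M1 z = s * m1 z + t * m2 z" for z
  define M2 where "M2 z = - cnj t * m1 z + cnj s * m2 z" for z
  define R1 where "R1 z = s * r1 z + t * r2 z" for z
  define R2 where "R2 z = - cnj t * r1 z + cnj s * r2 z" for z
  have M: "unitary_frame \<rho> q ?S2 M1 M2" unfolding M1_def[abs_def] M2_def[abs_def] by (rule unitary_frame_rotate[OF m st])
  have R: "unitary_frame \<rho> q ?S3 R1 R2" unfolding R1_def[abs_def] R2_def[abs_def] by (rule unitary_frame_rotate[OF r st])
  have h3: "h1 z = \<psi>3 z * R1 z" "h2 z = \<psi>3 z * R2 z" if "z \<in> ?S3" for z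
    using hS3[of z] that unfolding cap by (simp_all add: \<alpha>0 R1_def R2_def algebra_simps)
  have h2': "h1 z = \<psi>2 z * M1 z" "h2 z = \<psi>2 z * M2 z" if "z \<in> ?S2" for z
    using hS2[of z] that unfolding cap by (simp_all add: \<alpha>0 M1_def M2_def algebra_simps)
  have \<Omega>_cases: "z \<in> ?S2 \<or> z \<in> ?S3" if "z \<in> ?\<Omega>" "z \<noteq> 1" for z
    using that by (auto simp: slit_def complex_eq_iff)
  have hY: "(cmod (h1 z))\<^sup>2 + (cmod (h2 z))\<^sup>2 = Y z" if z: "z \<in> ?\<Omega>" "z \<noteq> 1" for z
    using \<Omega>_cases[OF z]
  proof
    assume "z \<in> ?S2"
    then show ?thesis unfolding h2'[OF \<open>z \<in> ?S2\<close>] by (intro frameY norm\<psi> unitary_frame_norm[OF M] ne) auto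
  next
    assume "z \<in> ?S3"
    then show ?thesis unfolding h3[OF \<open>z \<in> ?S3\<close>] by (intro frameY norm\<psi> unitary_frame_norm[OF R] ne) auto
  qed
  have hW: "cmod (h1 z * deriv h2 z - deriv h1 z * h2 z) = cmod z powr \<beta>1 * cmod (z - 1) powr real \<beta>2"
    if z: "z \<in> ?\<Omega>" "z \<noteq> 1" for z
    using \<Omega>_cases[OF z]
  proof
    assume S: "z \<in> ?S2"
    have "h1 z * deriv h2 z - deriv h1 z * h2 z = (\<psi>2 z)\<^sup>2"
      by (rule unitary_frame_wronskian[OF op(2) M S hol\<psi>(2) h2'])
    then show ?thesis using norm\<psi>(2)[of z] ne[of z] S by (simp add: norm_power)
  next
    assume S: "z \<in> ?S3"
    have "h1 z * deriv h2 z - deriv h1 z * h2 z = (\<psi>3 z)\<^sup>2"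
      by (rule unitary_frame_wronskian[OF op(3) R S hol\<psi>(3) h3])
    then show ?thesis using norm\<psi>(3)[of z] ne[of z] S by (simp add: norm_power)
  qed

  \<comment> \<open>Monodromy at 0\<close>
  obtain l1' l2' where "unitary_frame \<rho> q ?S1 l1' l2'" using frame[of "{..<0}" "-1"] by auto
  then obtain l1 l2 where l: "unitary_frame \<rho> q ?S1 l1 l2" and lm: "\<And>z. z \<in> H \<Longrightarrow> l1 z = M1 z \<and> l2 z = M2 z"
    using unitary_frame_align[OF H HL(1) HL(1) M] by blast
  obtain a0 b0 where ab0: "a0 * cnj a0 + b0 * cnj b0 = 1"
    "\<And>z. z \<in> L \<Longrightarrow> l1 z = a0 * M1 z + b0 * M2 z \<and> l2 z = - cnj b0 * M1 z + cnj a0 * M2 z"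
    using unitary_frame_unique[OF L unitary_frame_subset[OF l HL(2)] unitary_frame_subset[OF M HL(2)]] by blast
  note hl = unitary_frame_holomorphic[OF op(1) l]
  \<comment> \<open>At 1 the formula for \<open>Y\<close> gives 0, since
    \<open>0 powr x = 0\<close>, while \<open>h1\<close> and \<open>h2\<close> are holomorphic
    there. The corrected value makes the norm identity hold on the whole slit plane.\<close>
  define Y' where "Y' z = (if z = 1 then (cmod (h1 z))\<^sup>2 + (cmod (h2 z))\<^sup>2 else Y z)" for z
  have Y'0: "(Y' \<longlongrightarrow> 2 / sqrt C0) (at (of_real 0))"
  proof (rule Lim_transform_eventually)
    show "(Y \<longlongrightarrow> 2 / sqrt C0) (at (of_real 0))" using Y0 by simp
    have "\<forall>\<^sub>F z in at 0. z \<in> - {1::complex}" by (rule eventually_at_in_open') auto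
    then show "\<forall>\<^sub>F z in at (of_real 0). Y z = Y' z"
      by (simp add: eventually_mono Y'_def)
  qed
  obtain s t \<gamma>1 \<gamma>2 g1 g2 where st: "s * cnj s + t * cnj t = 1" and \<gamma>: "0 \<le> \<gamma>1" "\<gamma>1 < 1" "0 \<le> \<gamma>2" "\<gamma>2 < 1"
    "exp (of_real (\<gamma>1 + \<gamma>2) * (2 * pi * \<i>)) = \<epsilon>0 * \<epsilon>0"
    and g: "g1 holomorphic_on UNIV" "g2 holomorphic_on UNIV"
    and gR: "\<And>z. z \<in> UNIV \<inter> slit {0<..} \<Longrightarrow> s * h1 z + t * h2 z = exp (of_real \<gamma>1 * log_right 0 z) * g1 z"
     "\<And>z. z \<in> UNIV \<inter> slit {0<..} \<Longrightarrow> - cnj t * h1 z + cnj s * h2 z = exp (of_real \<gamma>2 * log_right 0 z) * g2 z"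
    and gL: "\<And>z. z \<in> UNIV \<inter> slit {..<0} \<Longrightarrow> s * (\<psi>1 z * l1 z) + t * (\<psi>1 z * l2 z) = exp (of_real \<gamma>1 * log_left 0 z) * g1 z"
     "\<And>z. z \<in> UNIV \<inter> slit {..<0} \<Longrightarrow> - cnj t * (\<psi>1 z * l1 z) + cnj s * (\<psi>1 z * l2 z) = exp (of_real \<gamma>2 * log_left 0 z) * g2 z"
    and nz: "\<gamma>1 = 0 \<and> g1 (of_real 0) \<noteq> 0 \<or> \<gamma>2 = 0 \<and> g2 (of_real 0) \<noteq> 0"
  proof (rule puncture_monodromy[of UNIV 0 h1 h2 "\<lambda>z. \<psi>1 z * l1 z" "\<lambda>z. \<psi>1 z * l2 z" \<epsilon>0 a0 b0 Y' "2 / sqrt C0"])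
    have S2: "z \<in> ?S2" if "Im z \<noteq> 0" for z using that by (simp add: slit_def)
    show "\<psi>1 z * l1 z = h1 z \<and> \<psi>1 z * l2 z = h2 z" if "Im z > 0" for z
      using lm[of z] that S2[of z] by (simp add: \<psi>H(2) H_def h2')
    show "\<psi>1 z * l1 z = \<epsilon>0 * (a0 * h1 z + b0 * h2 z) \<and>
      \<psi>1 z * l2 z = \<epsilon>0 * (- cnj b0 * h1 z + cnj a0 * h2 z)" if "Im z < 0" for z
    proof -
      have e: "l1 z = a0 * M1 z + b0 * M2 z" "l2 z = - cnj b0 * M1 z + cnj a0 * M2 z"
        using ab0(2)[of z] that by (simp_all add: L_def)
      have "z \<in> ?S2" using that by (intro S2) simp
      show ?thesis unfolding e \<psi>L(2)[OF that] h2'[OF \<open>z \<in> ?S2\<close>] by (simp add: algebra_simps)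
    qed
    show "(cmod (h1 z))\<^sup>2 + (cmod (h2 z))\<^sup>2 = Y' z" if "z \<in> UNIV \<inter> slit {0<..}" for z
      using that hY[of z] by (simp add: Y'_def)
    show "(cmod (\<psi>1 z * l1 z))\<^sup>2 + (cmod (\<psi>1 z * l2 z))\<^sup>2 = Y' z" if "z \<in> UNIV \<inter> slit {..<0}" for z
    proof -
      have "z \<noteq> 1" using that by (auto simp: slit_def)
      then have "Y' z = Y z" by (simp add: Y'_def)
      moreover have "(cmod (\<psi>1 z * l1 z))\<^sup>2 + (cmod (\<psi>1 z * l2 z))\<^sup>2 = Y z"
        using that by (intro frameY norm\<psi> unitary_frame_norm[OF l] ne) auto
      ultimately show ?thesis by simp
    qed
  qed (use ab0(1) eps(1)[of "\<beta>1"] Y'0 lim0(2) op h hl hol\<psi> in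
      \<open>auto simp: \<epsilon>0_def intro!: holomorphic_intros\<close>)
  \<comment> \<open>Since \<beta>1 is not an integer, the two exponents at 0 cannot both
    vanish.\<close>
  have notint: "\<gamma>1 + \<gamma>2 \<notin> \<int>"
  proof
    assume "\<gamma>1 + \<gamma>2 \<in> \<int>"
    then have "exp (of_real \<beta>1 * (2 * pi * \<i>)) = 1"
      using \<gamma>(5) exp_2pi_eq_1_iff[of "\<gamma>1 + \<gamma>2"] unfolding \<epsilon>0_def eps(2) by simp
    then show False using \<beta>1 exp_2pi_eq_1_iff by blast
  qed
  note rot = su2_norm[OF st]
  have gnorm: "cmod z powr (2 * \<gamma>1) * (cmod (g1 z))\<^sup>2 + cmod z powr (2 * \<gamma>2) * (cmod (g2 z))\<^sup>2 = Y z"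
    if z: "z \<noteq> 0" "z \<noteq> 1" for z
  proof -
    have e0: "cmod (exp (of_real \<alpha> * log_right 0 z)) = cmod z powr \<alpha>" "cmod (exp (of_real \<alpha> * log_left 0 z)) = cmod z powr \<alpha>" for \<alpha>
      using cmod_exp_log[of z 0] z by simp_all
    have p: "(x powr c)\<^sup>2 = x powr (2 * c)" for x c :: real
      by (simp add: power2_eq_square powr_add[symmetric])
    show ?thesis
    proof (cases "z \<in> ?\<Omega>")
      case True
      have "(cmod (s * h1 z + t * h2 z))\<^sup>2 + (cmod (- cnj t * h1 z + cnj s * h2 z))\<^sup>2 = Y z"
        unfolding rot using hY[OF True z(2)] .
      then show ?thesis unfolding gR(1)[OF IntI[OF UNIV_I True]] gR(2)[OF IntI[OF UNIV_I True]] norm_mult power_mult_distrib e0 p .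
    next
      case False
      then have S1: "z \<in> ?S1" using z by (auto simp: slit_def complex_eq_iff)
      have "(cmod (s * (\<psi>1 z * l1 z) + t * (\<psi>1 z * l2 z)))\<^sup>2 + (cmod (- cnj t * (\<psi>1 z * l1 z) + cnj s * (\<psi>1 z * l2 z)))\<^sup>2 = Y z"
        unfolding rot using S1 by (intro frameY norm\<psi> unitary_frame_norm[OF l] ne) auto
      then show ?thesis unfolding gL(1)[OF IntI[OF UNIV_I S1]] gL(2)[OF IntI[OF UNIV_I S1]] norm_mult power_mult_distrib e0 p .
    qed
  qed
  \<comment> \<open>A common zero at 1 would contradict the positive limit of \<open>Y\<close>
    there.\<close>
  have g_at_1: "g1 1 \<noteq> 0 \<or> g2 1 \<noteq> 0"
  proof (rule ccontr)
    assume "\<not> ?thesis"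
    then have g0: "g1 1 = 0" "g2 1 = 0" by auto
    have c: "isCont g1 1" "isCont g2 1"
      using g by (auto simp: continuous_on_eq_continuous_at[OF open_UNIV] dest!: holomorphic_on_imp_continuous_on)
    have "((\<lambda>z. cmod z powr (2 * \<gamma>1) * (cmod (g1 z))\<^sup>2 + cmod z powr (2 * \<gamma>2) * (cmod (g2 z))\<^sup>2) \<longlongrightarrow>
      cmod 1 powr (2 * \<gamma>1) * (cmod (g1 1))\<^sup>2 + cmod 1 powr (2 * \<gamma>2) * (cmod (g2 1))\<^sup>2) (at 1)"
      using c by (intro tendsto_intros) (auto simp: isCont_def)
    then have "((\<lambda>z. cmod z powr (2 * \<gamma>1) * (cmod (g1 z))\<^sup>2 + cmod z powr (2 * \<gamma>2) * (cmod (g2 z))\<^sup>2) \<longlongrightarrow> 0) (at 1)"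
      using g0 by simp
    moreover have "\<forall>\<^sub>F z in at 1. cmod z powr (2 * \<gamma>1) * (cmod (g1 z))\<^sup>2 + cmod z powr (2 * \<gamma>2) * (cmod (g2 z))\<^sup>2 = Y z"
    proof -
      have "\<forall>\<^sub>F z in at 1. z \<in> - {0::complex} - {1}" by (rule eventually_at_in_open) auto
      then show ?thesis by (rule eventually_mono) (use gnorm in auto)
    qed
    ultimately have "(Y \<longlongrightarrow> 0) (at 1)" by (rule Lim_transform_eventually)
    from tendsto_unique[OF _ this Y1] show False using lim1(2) by simp
  qed

  \<comment> \<open>Passage to polynomials\<close>
  define u1 where "u1 z = s * h1 z + t * h2 z" for z
  define u2 where "u2 z = - cnj t * h1 z + cnj s * h2 z" for z
  have uW: "cmod (u1 z * deriv u2 z - deriv u1 z * u2 z) = cmod z powr \<beta>1 * cmod (z - 1) powr real \<beta>2"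
    if z: "z \<in> ?\<Omega>" "z \<noteq> 1" for z
  proof -
    have d: "(h1 has_field_derivative deriv h1 z) (at z)" "(h2 has_field_derivative deriv h2 z) (at z)"
      using h op z by (auto intro: holomorphic_derivI)
    have D: "deriv u1 z = s * deriv h1 z + t * deriv h2 z" "deriv u2 z = - cnj t * deriv h1 z + cnj s * deriv h2 z"
      unfolding u1_def[abs_def] u2_def[abs_def]
      by (auto intro!: DERIV_imp_deriv DERIV_add DERIV_cmult d DERIV_diff)
    have "u1 z * deriv u2 z - deriv u1 z * u2 z = (s * cnj s + t * cnj t) * (h1 z * deriv h2 z - deriv h1 z * h2 z)"
      unfolding D u1_def u2_def by (simp add: algebra_simps)
    then show ?thesis using hW[OF z] by (simp add: st)
  qed
  have ue: "u1 z = exp (of_real \<gamma>1 * log_right 0 z) * g1 z" "u2 z = exp (of_real \<gamma>2 * log_right 0 z) * g2 z" if "z \<in> ?\<Omega>" for z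
    using gR[of z] that by (simp_all add: u1_def u2_def)
  obtain A K m where growth: "\<And>z. A \<le> cmod z \<Longrightarrow> Y z \<le> K * cmod z ^ (2 * m)"
    using growth_at_infinity[OF liminf, where ?\<beta>1.0 = \<beta>1 and ?\<beta>2.0 = \<beta>2] unfolding Y_def by blast
  \<comment> \<open>The component with exponent 0 becomes the denominator \<open>R\<close>; the two
    cases differ by exchanging the components.\<close>
  show ?thesis
    using nz
  proof
    assume A2: "\<gamma>2 = 0 \<and> g2 (of_real 0) \<noteq> 0"
    have "\<gamma>1 \<notin> \<int>" using notint A2 by simp
    have n: "cmod z powr (2 * \<gamma>1) * (cmod (g1 z))\<^sup>2 + (cmod (g2 z))\<^sup>2 = Y z" if "z \<noteq> 0" "z \<noteq> 1" for z
      using gnorm[OF that] A2 that by simp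
    have w: "cmod z powr (\<gamma>1 - 1) * cmod (exp_wronskian \<gamma>1 g1 g2 z) = cmod z powr \<beta>1 * cmod (z - 1) powr real \<beta>2"
      if "z \<in> ?\<Omega>" "z \<noteq> 1" for z
      using wronskian_exp_log[OF g that(1), of u1 \<gamma>1 u2] uW[OF that] ue A2 by simp
    obtain P R where PR: "g1 = poly P" "g2 = poly R" and "\<And>z. z \<noteq> 0 \<Longrightarrow> z \<noteq> 1 \<Longrightarrow> cmod z powr (\<gamma>1 - 1) * cmod (poly (wr \<gamma>1 P R) z)
      = cmod z powr \<beta>1 * cmod (z - 1) powr real \<beta>2"
      using polynomial_pair[OF g \<gamma>(1) n w growth] by blast
    with \<open>\<gamma>1 \<notin> \<int>\<close> show ?thesis
      using gnorm A2 g_at_1 by (intro that[of \<gamma>1 R P]) (auto simp: Y_def)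
  next
    assume A1: "\<gamma>1 = 0 \<and> g1 (of_real 0) \<noteq> 0"
    have "\<gamma>2 \<notin> \<int>" using notint A1 by simp
    have n: "cmod z powr (2 * \<gamma>2) * (cmod (g2 z))\<^sup>2 + (cmod (g1 z))\<^sup>2 = Y z" if "z \<noteq> 0" "z \<noteq> 1" for z
      using gnorm[OF that] A1 that by (simp add: add.commute)
    have w: "cmod z powr (\<gamma>2 - 1) * cmod (exp_wronskian \<gamma>2 g2 g1 z) = cmod z powr \<beta>1 * cmod (z - 1) powr real \<beta>2"
      if "z \<in> ?\<Omega>" "z \<noteq> 1" for z
      using wronskian_exp_log[OF g(2,1) that(1), of u2 \<gamma>2 u1] uW[OF that] ue A1
        norm_minus_commute[of "u2 z * deriv u1 z" "deriv u2 z * u1 z"] by (simp add: mult.commute)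
    obtain P R where PR: "g2 = poly P" "g1 = poly R" and "\<And>z. z \<noteq> 0 \<Longrightarrow> z \<noteq> 1 \<Longrightarrow> cmod z powr (\<gamma>2 - 1) * cmod (poly (wr \<gamma>2 P R) z)
      = cmod z powr \<beta>1 * cmod (z - 1) powr real \<beta>2"
      using polynomial_pair[OF g(2,1) \<gamma>(3) n w growth] by blast
    with \<open>\<gamma>2 \<notin> \<int>\<close> show ?thesis
      using gnorm A1 g_at_1 by (intro that[of \<gamma>2 R P]) (auto simp: Y_def add.commute)
  qed
qed

section \<open>The polynomial differential equation\<close>

lemma complex_poly_eqI: "(\<And>z::complex. poly p z = poly q z) \<Longrightarrow> p = q"
  using poly_eq_poly_eq_iff by blast

lemma wr_swap: "wr (- \<nu>) q p = - wr \<nu> p q"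
  by (rule complex_poly_eqI) (simp add: poly_wr algebra_simps)

lemma wr_smult: "wr \<nu> (smult c p) q = smult c (wr \<nu> p q)" "wr \<nu> p (smult c q) = smult c (wr \<nu> p q)"
  by (rule complex_poly_eqI, simp add: poly_wr pderiv_smult algebra_simps)+

lemma wr_add_left: "wr \<nu> (p + p') q = wr \<nu> p q + wr \<nu> p' q"
  by (rule complex_poly_eqI) (simp add: poly_wr pderiv_add algebra_simps)

lemma wr_sum_left: "wr \<nu> (\<Sum>i\<in>I. f i) q = (\<Sum>i\<in>I. wr \<nu> (f i) q)"
proof (induction I rule: infinite_finite_induct)
  case (insert i I)
  then show ?case by (simp add: wr_add_left)
qed (simp_all add: wr_def)

text \<open>The quotient p / q does not change, so only the squared denominator contributes a
  factor.\<close>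

lemma wr_mult_common: "wr \<nu> (G * p) (G * q) = G\<^sup>2 * wr \<nu> p q"
  by (rule complex_poly_eqI) (simp add: poly_wr pderiv_mult power2_eq_square algebra_simps)

text \<open>Both sides come from differentiating the same function z^(\<nu> + 1) p / q; the factor z
  is the difference between z^(\<nu> - 1) and z^\<nu>.\<close>

lemma wr_shift: "wr \<nu> ([:0, 1:] * p) q = [:0, 1:] * wr (\<nu> + 1) p q"
  by (rule complex_poly_eqI) (simp add: poly_wr pderiv_mult pderiv_pCons algebra_simps)

lemma wr_alt: "wr \<nu> p q = smult (of_real \<nu>) (p * q) + (([:0, 1:] * pderiv p) * q - p * ([:0, 1:] * pderiv q))"
  by (rule complex_poly_eqI) (simp add: poly_wr algebra_simps)

lemma coeff_euler: "coeff ([:0, 1:] * pderiv p) k = of_nat k * coeff p k" for p :: "complex poly"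
  by (cases k) (simp_all add: coeff_pCons coeff_pderiv)

lemma degree_euler: "degree ([:0, 1:] * pderiv p) \<le> degree p" for p :: "complex poly"
  by (rule degree_le) (use coeff_euler in \<open>auto simp: coeff_eq_0\<close>)

text \<open>The Euler operator z d/dz multiplies a leading coefficient by the degree. The resulting
  factor is the exponent of z^\<nu> p / q at infinity.\<close>

lemma coeff_wr_degree_sum:
  "coeff (wr \<nu> p q) (degree p + degree q) =
    of_real (\<nu> + real (degree p) - real (degree q)) * lead_coeff p * lead_coeff q"
proof -
  have top: "coeff (a * b) (m + n) = coeff a m * coeff b n"
    if "degree a \<le> m" "degree b \<le> n" for a b :: "complex poly" and m n
  proof -
    have "coeff (a * b) (m + n) = (\<Sum>i\<le>m + n. coeff a i * coeff b (m + n - i))" by (rule coeff_mult)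
    also have "\<dots> = (\<Sum>i\<in>{m}. coeff a i * coeff b (m + n - i))"
    proof (rule sum.mono_neutral_right)
      show "\<forall>i\<in>{..m + n} - {m}. coeff a i * coeff b (m + n - i) = 0"
      proof
        fix i assume i: "i \<in> {..m + n} - {m}"
        then have "i > m \<or> m + n - i > n" by auto
        then show "coeff a i * coeff b (m + n - i) = 0" using that by (auto simp: coeff_eq_0)
      qed
    qed auto
    finally show ?thesis by simp
  qed
  show ?thesis
    unfolding wr_alt
    by (simp only: coeff_add coeff_diff coeff_smult top[OF degree_euler order_refl]
        top[OF order_refl degree_euler] top[OF order_refl order_refl] coeff_euler)
      (simp add: algebra_simps)
qed

lemma degree_wr_le: "degree (wr \<nu> p q) \<le> degree p + degree q"
proof -
  have "degree (smult (of_real \<nu>) (p * q)) \<le> degree p + degree q"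
    using degree_smult_le degree_mult_le order_trans by blast
  moreover have "degree (([:0, 1:] * pderiv p) * q) \<le> degree p + degree q"
    using degree_mult_le[of "[:0, 1:] * pderiv p" q] degree_euler[of p] by linarith
  moreover have "degree (p * ([:0, 1:] * pderiv q)) \<le> degree p + degree q"
    using degree_mult_le[of p "[:0, 1:] * pderiv q"] degree_euler[of q] by linarith
  ultimately show ?thesis unfolding wr_alt by (metis degree_add_le degree_diff_le)
qed

lemma Ints_combine: "\<nu> \<notin> \<int> \<Longrightarrow> \<nu> + real i - real j \<noteq> 0"
proof
  assume "\<nu> \<notin> \<int>" "\<nu> + real i - real j = 0"
  then have "\<nu> = of_int (int j - int i)" by simp
  then show False using \<open>\<nu> \<notin> \<int>\<close> by (metis Ints_of_int)
qed

lemma degree_wr: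
  assumes "\<nu> \<notin> \<int>" "p \<noteq> 0" "q \<noteq> 0"
  shows "degree (wr \<nu> p q) = degree p + degree q" "wr \<nu> p q \<noteq> 0"
proof -
  have "coeff (wr \<nu> p q) (degree p + degree q) \<noteq> 0"
    unfolding coeff_wr_degree_sum using Ints_combine[OF assms(1)] assms(2,3)
    by (simp del: of_real_add of_real_diff)
  then show "degree (wr \<nu> p q) = degree p + degree q" "wr \<nu> p q \<noteq> 0"
    using degree_wr_le[of \<nu> p q] by (auto intro: antisym le_degree)
qed

lemma coprime_complex_poly_iff:
  fixes p q :: "complex poly"
  shows "coprime p q \<longleftrightarrow> \<not> (\<exists>z. poly p z = 0 \<and> poly q z = 0)"
proof
  assume "coprime p q"
  show "\<not> (\<exists>z. poly p z = 0 \<and> poly q z = 0)"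
  proof
    assume "\<exists>z. poly p z = 0 \<and> poly q z = 0"
    then obtain z where "[:- z, 1:] dvd p" "[:- z, 1:] dvd q" by (auto simp: poly_eq_0_iff_dvd)
    with \<open>coprime p q\<close> have "is_unit [:- z, 1:]" by (rule coprime_common_divisor)
    then show False by (simp add: is_unit_iff_degree)
  qed
next
  assume nz: "\<not> (\<exists>z. poly p z = 0 \<and> poly q z = 0)"
  show "coprime p q"
  proof (rule coprimeI)
    fix r assume r: "r dvd p" "r dvd q"
    then have noroot: "poly r z \<noteq> 0" for z
      using nz by (metis dvd_def mult_eq_0_iff poly_mult)
    then have "r \<noteq> 0" by auto
    moreover have "degree r = 0" using noroot alg_closed_imp_poly_has_root[of r] by auto
    ultimately show "is_unit r" by (simp add: is_unit_iff_degree)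
  qed
qed

text \<open>By \<open>normal_pair\<close> the only critical point of \<open>z\<^sup>\<nu> P / R\<close> off \<open>0\<close> and \<open>\<infinity>\<close> is \<open>1\<close>, with multiplicity \<open>m\<close>.\<close>

definition normal_pair :: "real \<Rightarrow> nat \<Rightarrow> complex poly \<Rightarrow> complex poly \<Rightarrow> bool" where
  "normal_pair \<nu> m P R \<longleftrightarrow> \<nu> \<notin> \<int> \<and> coprime P R \<and> (\<exists>c. c \<noteq> 0 \<and> wr \<nu> P R = smult c ([:-1, 1:] ^ m))"

lemma normal_pair_swap: "normal_pair \<nu> m P R \<Longrightarrow> normal_pair (- \<nu>) m R P"
  unfolding normal_pair_def wr_swap
  by (auto simp: coprime_commute intro: exI[of _ "- _"])

lemma normal_pair_smult: "normal_pair \<nu> m P R \<Longrightarrow> a \<noteq> 0 \<Longrightarrow> normal_pair \<nu> m (smult a P) R"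
  unfolding normal_pair_def wr_smult by (auto simp: coprime_complex_poly_iff intro: exI[of _ "a * _"])

text \<open>For nonintegral \<open>\<nu>\<close> the degree of \<open>wr\<close> is exactly the sum
  of the degrees, and its value at 0 is \<nu> P(0) R(0).\<close>

lemma normal_pairD:
  assumes "normal_pair \<nu> m P R"
  shows "P \<noteq> 0" "R \<noteq> 0" "degree P + degree R = m" "poly P 0 \<noteq> 0" "poly R 0 \<noteq> 0"
proof -
  obtain c where c: "\<nu> \<notin> \<int>" "c \<noteq> 0" "wr \<nu> P R = smult c ([:-1, 1:] ^ m)"
    using assms by (auto simp: normal_pair_def)
  have "wr \<nu> P R \<noteq> 0" using c by simp
  then show nz: "P \<noteq> 0" "R \<noteq> 0" by (auto simp: wr_def)
  have "degree (wr \<nu> P R) = m" using c by (simp add: degree_power_eq)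
  then show "degree P + degree R = m" using degree_wr(1)[OF c(1) nz] by simp
  have "poly (wr \<nu> P R) 0 \<noteq> 0" using c by simp
  then show "poly P 0 \<noteq> 0" "poly R 0 \<noteq> 0" by (auto simp: poly_wr)
qed

text \<open>If \<open>R\<close> vanished at 1 to order l, then l \<le> m, so (z - 1)^l would divide
  \<open>wr\<close> and \<open>R\<close>, hence z P R', hence R' by coprimality. But differentiation
  lowers the order.\<close>

lemma normal_pair_root_1:
  assumes "normal_pair \<nu> m P R"
  shows "poly R 1 \<noteq> 0"
proof
  assume R1: "poly R 1 = 0"
  obtain c where c: "coprime P R" "wr \<nu> P R = smult c ([:-1, 1:] ^ m)"
    using assms by (auto simp: normal_pair_def)
  note nz = normal_pairD[OF assms]
  define l where "l = order 1 R"
  have l: "[:-1, 1:] ^ l dvd R" unfolding l_def using order_1[of 1 R] by simp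
  have "l \<le> m" using order_degree[OF nz(2), of 1] nz(3) by (simp add: l_def)
  then have "[:-1, 1:] ^ l dvd wr \<nu> P R"
    unfolding c(2) by (intro dvd_smult le_imp_power_dvd)
  moreover have "wr \<nu> P R = R * (smult (of_real \<nu>) P + [:0, 1:] * pderiv P) - [:0, 1:] * P * pderiv R"
    by (rule complex_poly_eqI) (simp add: poly_wr algebra_simps)
  ultimately have "[:-1, 1:] ^ l dvd [:0, 1:] * P * pderiv R"
    using l by (metis dvd_mult2 dvd_diff_right_iff)
  moreover have "coprime ([:-1, 1:] ^ l) ([:0, 1:] * P)"
  proof -
    have "poly P 1 \<noteq> 0" using c(1) R1 coprime_complex_poly_iff by blast
    then show ?thesis by (auto simp: coprime_complex_poly_iff)
  qed
  ultimately have "[:-1, 1:] ^ l dvd pderiv R" using coprime_dvd_mult_right_iff by blast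
  moreover have "pderiv R \<noteq> 0"
    using R1 nz(2) pderiv_iszero[of R] by auto
  ultimately have "l \<le> order 1 (pderiv R)" using order_divides[of 1 l "pderiv R"] by simp
  then show False using order_pderiv[OF nz(2) R1] by (simp add: l_def)
qed

text \<open>\<open>root_op \<nu> m R = smult c R\<close> is a hypergeometric equation for \<open>R\<close>.\<close>

definition root_op :: "real \<Rightarrow> nat \<Rightarrow> complex poly \<Rightarrow> complex poly" where
  "root_op \<nu> m R = [:0, 1:] * ([:-1, 1:] * pderiv (pderiv R))
     - (smult (of_real \<nu> - 1) [:-1, 1:] + smult (of_nat m) [:0, 1:]) * pderiv R"

text \<open>A two-term recursion. The factors of the second term show the exponents 0 and
  \<open>\<nu>\<close> of the equation at 0.\<close>

lemma coeff_root_op: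
  "coeff (root_op \<nu> m R) k = of_nat k * (of_nat k - of_real \<nu> - of_nat m) * coeff R k
     - (of_nat k + 1) * (of_nat k + 1 - of_real \<nu>) * coeff R (Suc k)"
proof -
  have "root_op \<nu> m R = pCons 0 (pCons 0 (pderiv (pderiv R))) - pCons 0 (pderiv (pderiv R))
     - smult (of_real \<nu> - 1 + of_nat m) (pCons 0 (pderiv R)) + smult (of_real \<nu> - 1) (pderiv R)"
    by (rule complex_poly_eqI) (simp add: root_op_def algebra_simps)
  then show ?thesis
    by (cases k; cases "k - 1") (auto simp: coeff_pCons coeff_pderiv algebra_simps split: nat.splits)
qed

text \<open>The power c (z - 1)^m satisfies (z - 1) W' = m W. Modulo \<open>R\<close>, inserting the
  Wronskian leaves \<open>P\<close> times the operator, so by coprimality \<open>R\<close> divides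
  \<open>root_op \<nu> m R\<close>. Degrees make the quotient constant, and the leading coefficient
  gives its value.\<close>

lemma normal_pair_ode:
  assumes "normal_pair \<nu> m P R"
  shows "root_op \<nu> m R = smult (of_nat (degree R) * (of_nat (degree R) - of_real \<nu> - of_nat m)) R"
proof -
  obtain c where c: "\<nu> \<notin> \<int>" "coprime P R" "wr \<nu> P R = smult c ([:-1, 1:] ^ m)"
    using assms by (auto simp: normal_pair_def)
  note nz = normal_pairD[OF assms]
  have "[:-1, 1:] * pderiv (wr \<nu> P R) = smult (of_nat m) (wr \<nu> P R)"
  proof (cases m)
    case (Suc n)
    show ?thesis unfolding c(3) Suc pderiv_smult pderiv_power_Suc
      by (rule complex_poly_eqI) (simp add: pderiv_pCons algebra_simps)
  qed (simp add: c(3) pderiv_smult)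
  then have "poly [:-1, 1:] z * poly (pderiv (wr \<nu> P R)) z = of_nat m * poly (wr \<nu> P R) z" for z
    by (metis poly_mult poly_smult)
  moreover have "poly (pderiv (wr \<nu> P R)) z =
     (of_real \<nu> + 1) * poly (pderiv P) z * poly R z + (of_real \<nu> - 1) * poly P z * poly (pderiv R) z
     + z * (poly (pderiv (pderiv P)) z * poly R z - poly P z * poly (pderiv (pderiv R)) z)" for z
    unfolding wr_def
    by (simp add: pderiv_add pderiv_smult pderiv_mult pderiv_diff pderiv_pCons algebra_simps)
  ultimately have key: "(z - 1) * ((of_real \<nu> + 1) * poly (pderiv P) z * poly R z + (of_real \<nu> - 1) * poly P z * poly (pderiv R) z
     + z * (poly (pderiv (pderiv P)) z * poly R z - poly P z * poly (pderiv (pderiv R)) z))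
     = of_nat m * (of_real \<nu> * poly P z * poly R z + z * (poly (pderiv P) z * poly R z - poly P z * poly (pderiv R) z))" for z
    unfolding poly_wr by (simp add: algebra_simps)
  have "P * root_op \<nu> m R = R * ([:-1, 1:] * (smult (of_real \<nu> + 1) (pderiv P) + [:0, 1:] * pderiv (pderiv P))
    - smult (of_nat m) (smult (of_real \<nu>) P + [:0, 1:] * pderiv P))"
    by (rule complex_poly_eqI) (use key in \<open>simp add: root_op_def algebra_simps\<close>)
  then have "R dvd P * root_op \<nu> m R" by simp
  then have "R dvd root_op \<nu> m R" using c(2) by (simp add: coprime_dvd_mult_right_iff coprime_commute)
  then obtain S where S: "root_op \<nu> m R = R * S" by (auto simp: dvd_def)
  have "degree (root_op \<nu> m R) \<le> degree R"
    by (rule degree_le) (simp add: coeff_root_op coeff_eq_0)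
  have "degree S = 0"
  proof (cases "S = 0")
    case False
    then show ?thesis using \<open>degree (root_op \<nu> m R) \<le> degree R\<close> nz(2) by (simp add: S degree_mult_eq)
  qed simp
  then obtain s where s: "S = [:s:]" using degree_eq_zeroE by blast
  have "coeff (root_op \<nu> m R) (degree R) = s * lead_coeff R" by (simp add: S s)
  then have "s = of_nat (degree R) * (of_nat (degree R) - of_real \<nu> - of_nat m)"
    using nz(2) by (simp add: coeff_root_op coeff_eq_0)
  then show ?thesis by (simp add: S s)
qed

text \<open>As \<open>\<nu>\<close> is not an integer, the factor in front of the next coefficient
  never vanishes, so the constant term determines all others.\<close>

lemma root_op_unique:
  assumes "\<nu> \<notin> \<int>" "root_op \<nu> m R = smult c R" "root_op \<nu> m S = smult c S" "coeff R 0 \<noteq> 0"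
  shows "S = smult (coeff S 0 / coeff R 0) R"
proof (rule poly_eqI)
  fix k
  show "coeff S k = coeff (smult (coeff S 0 / coeff R 0) R) k"
  proof (induction k)
    case (Suc k)
    have rec: "(of_nat k + 1) * (of_nat k + 1 - of_real \<nu>) * coeff T (Suc k) =
      (of_nat k * (of_nat k - of_real \<nu> - of_nat m) - c) * coeff T k"
      if "root_op \<nu> m T = smult c T" for T
      using arg_cong[OF that, of "\<lambda>p. coeff p k"] by (simp add: coeff_root_op algebra_simps)
    have "(of_nat k + 1) * (of_nat k + 1 - of_real \<nu>) \<noteq> (0::complex)"
    proof -
      have "of_nat k + 1 \<noteq> (0::complex)" by (metis of_nat_Suc of_nat_eq_0_iff add.commute nat.distinct(1))
      moreover have "of_nat k + 1 - of_real \<nu> \<noteq> (0::complex)"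
      proof
        assume "of_nat k + 1 - of_real \<nu> = (0::complex)"
        then have "complex_of_real \<nu> = of_real (real (Suc k))" by (simp add: algebra_simps)
        then have "\<nu> = real (Suc k)" unfolding of_real_eq_iff .
        then show False using assms(1) Ints_of_nat by blast
      qed
      ultimately show ?thesis by simp
    qed
    moreover have "(of_nat k + 1) * (of_nat k + 1 - of_real \<nu>) * coeff S (Suc k) =
      (of_nat k + 1) * (of_nat k + 1 - of_real \<nu>) * (coeff S 0 / coeff R 0 * coeff R (Suc k))"
      using rec[OF assms(2)] rec[OF assms(3)] Suc.IH by (simp add: mult_ac)
    ultimately have "coeff S (Suc k) = coeff S 0 / coeff R 0 * coeff R (Suc k)"
      using mult_left_cancel by blast
    then show ?case by simp
  qed (use assms(4) in simp)
qed

text \<open>Equal degrees give the same constant in the hypergeometric equation, so the denominators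
  are proportional. The numerators follow because \<open>wr \<nu> P R\<close>, for fixed
  \<open>R\<close>, is linear in \<open>P\<close> and nonzero for nonzero \<open>P\<close>.\<close>

lemma normal_pair_unique:
  assumes "normal_pair \<nu> m P R" "normal_pair \<nu> m P' R'" "degree R = degree R'"
  shows "\<exists>\<kappa> s. \<kappa> \<noteq> 0 \<and> s \<noteq> 0 \<and> R' = smult s R \<and> P' = smult (s * \<kappa>) P"
proof -
  note nz = normal_pairD[OF assms(1)] and nz' = normal_pairD[OF assms(2)]
  have nu: "\<nu> \<notin> \<int>" using assms(1) by (simp add: normal_pair_def)
  obtain c where c: "c \<noteq> 0" "wr \<nu> P R = smult c ([:-1, 1:] ^ m)"
    using assms(1) by (auto simp: normal_pair_def)
  obtain c' where c': "c' \<noteq> 0" "wr \<nu> P' R' = smult c' ([:-1, 1:] ^ m)"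
    using assms(2) by (auto simp: normal_pair_def)
  define s where "s = coeff R' 0 / coeff R 0"
  have s: "R' = smult s R" unfolding s_def
    by (rule root_op_unique[OF nu normal_pair_ode[OF assms(1)] normal_pair_ode[OF assms(2), folded assms(3)]])
      (use nz in \<open>simp add: poly_0_coeff_0\<close>)
  then have s0: "s \<noteq> 0" using nz' by auto
  \<comment> \<open>One factor s comes from R' = s R; the other is split off from P' so that s can
    be cancelled as a common factor of the pair.\<close>
  define \<kappa> where "\<kappa> = c' / (s * s * c)"
  have k0: "\<kappa> \<noteq> 0" using c c' s0 by (simp add: \<kappa>_def)
  have "wr \<nu> (P' + smult (- (s * \<kappa>)) P) R = 0"
  proof -
    have "smult s (wr \<nu> P' R) = smult c' ([:-1, 1:] ^ m)" using c'(2) unfolding s wr_smult .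
    then have "wr \<nu> P' R = smult (c' / s) ([:-1, 1:] ^ m)" using s0
      by (metis (no_types, lifting) divide_inverse mult.commute smult_1_left smult_smult left_inverse)
    then show ?thesis unfolding wr_add_left wr_smult c(2)
      using s0 c(1) by (simp add: \<kappa>_def smult_add_left[symmetric] field_simps)
  qed
  then have "P' + smult (- (s * \<kappa>)) P = 0" using degree_wr(2)[OF nu _ nz(2)] by blast
  then have "P' = smult (s * \<kappa>) P" by (simp add: add_eq_0_iff2)
  then show ?thesis using s s0 k0 by blast
qed

section \<open>The equations for the roots\<close>

definition root_prod :: "nat set \<Rightarrow> (nat \<Rightarrow> complex) \<Rightarrow> complex poly" where
  "root_prod I a = (\<Prod>k\<in>I. [:- a k, 1:])"

lemma poly_root_prod: "poly (root_prod I a) z = (\<Prod>k\<in>I. z - a k)"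
  by (simp add: root_prod_def poly_prod)

lemma pderiv_linear_mult: "pderiv ([:- x, 1:] * G) = G + [:- x, 1:] * pderiv G"
  for G :: "complex poly"
  unfolding pderiv_mult by (simp add: pderiv_pCons)

lemma root_prod_remove: "finite I \<Longrightarrow> j \<in> I \<Longrightarrow> root_prod I a = [:- a j, 1:] * root_prod (I - {j}) a"
  by (simp add: root_prod_def prod.remove)

lemma poly_pderiv_root_prod:
  assumes "finite I" "\<And>k. k \<in> I \<Longrightarrow> x \<noteq> a k"
  shows "poly (pderiv (root_prod I a)) x = poly (root_prod I a) x * (\<Sum>k\<in>I. 1 / (x - a k))"
  using assms
proof (induction I rule: finite_induct)
  case (insert i I)
  have "x - a i \<noteq> 0" using insert.prems by auto
  have r: "root_prod (insert i I) a = [:- a i, 1:] * root_prod I a"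
    using insert.hyps by (simp add: root_prod_def)
  have "poly (pderiv (root_prod I a)) x = poly (root_prod I a) x * (\<Sum>k\<in>I. 1 / (x - a k))"
    using insert by blast
  then have "poly (pderiv (root_prod (insert i I) a)) x
      = poly (root_prod I a) x + (x - a i) * (poly (root_prod I a) x * (\<Sum>k\<in>I. 1 / (x - a k)))"
    unfolding r pderiv_linear_mult by (simp add: algebra_simps)
  also have "\<dots> = (x - a i) * poly (root_prod I a) x * (1 / (x - a i) + (\<Sum>k\<in>I. 1 / (x - a k)))"
    using \<open>x - a i \<noteq> 0\<close> by (simp add: distrib_left)
  also have "\<dots> = poly (root_prod (insert i I) a) x * (\<Sum>k\<in>insert i I. 1 / (x - a k))"
    unfolding r using insert.hyps by (simp add: algebra_simps)
  finally show ?case .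
qed (simp add: root_prod_def)

text \<open>Write R = (z - a_j) G; at a_j one has R' = G and R'' = 2 G'. The ratio R'' / R' is the
  sum in the two systems.\<close>

lemma root_prod_derivs:
  assumes "finite I" "inj_on a I" "j \<in> I"
  shows "poly (pderiv (root_prod I a)) (a j) = poly (root_prod (I - {j}) a) (a j)"
    "poly (pderiv (pderiv (root_prod I a))) (a j)
      = poly (root_prod (I - {j}) a) (a j) * (\<Sum>k\<in>I - {j}. 2 / (a j - a k))"
    "poly (root_prod (I - {j}) a) (a j) \<noteq> 0"
proof -
  let ?G = "root_prod (I - {j}) a"
  have ne: "a j \<noteq> a k" if "k \<in> I - {j}" for k
    using assms that by (auto dest: inj_onD)
  show "poly ?G (a j) \<noteq> 0" using assms(1) ne by (simp add: poly_root_prod)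
  have G: "poly (pderiv ?G) (a j) = poly ?G (a j) * (\<Sum>k\<in>I - {j}. 1 / (a j - a k))"
    by (rule poly_pderiv_root_prod) (use assms(1) ne in auto)
  show "poly (pderiv (root_prod I a)) (a j) = poly ?G (a j)"
    unfolding root_prod_remove[OF assms(1,3)] pderiv_linear_mult by simp
  have "poly (pderiv (pderiv (root_prod I a))) (a j) = 2 * poly (pderiv ?G) (a j)"
    unfolding root_prod_remove[OF assms(1,3)] pderiv_linear_mult pderiv_add by simp
  also have "\<dots> = poly ?G (a j) * (\<Sum>k\<in>I - {j}. 2 / (a j - a k))"
    unfolding G by (simp add: sum_distrib_left mult_ac)
  finally show "poly (pderiv (pderiv (root_prod I a))) (a j) = poly ?G (a j) * (\<Sum>k\<in>I - {j}. 2 / (a j - a k))" .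
qed

text \<open>System (A) is the case \<open>\<nu> = \<beta>\<^sub>1 + 1\<close>, system (B) the case \<open>\<nu> = - \<beta>\<^sub>1 - 1\<close>.\<close>

definition root_system :: "real \<Rightarrow> nat \<Rightarrow> nat \<Rightarrow> (nat \<Rightarrow> complex) \<Rightarrow> bool" where
  "root_system \<nu> m N a \<longleftrightarrow> (\<forall>j\<in>{1..N}.
     of_real (\<nu> - 1) / a j + of_nat m / (a j - 1) - (\<Sum>k\<in>{1..N} - {j}. 2 / (a j - a k)) = 0)"

text \<open>At a root the right side of the hypergeometric equation vanishes; dividing by a (a - 1)
  R'(a) leaves the system.\<close>

lemma root_system_of_normal_pair:
  assumes "normal_pair \<nu> m P R"
  shows "\<exists>a. admissible (degree R) a \<and> root_system \<nu> m (degree R) a"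
proof -
  obtain c where c: "coprime P R" "c \<noteq> 0" "wr \<nu> P R = smult c ([:-1, 1:] ^ m)"
    using assms by (auto simp: normal_pair_def)
  note nz = normal_pairD[OF assms] and R1 = normal_pair_root_1[OF assms]
  \<comment> \<open>A double root would be a root of the Wronskian, hence equal to 1, where
    \<open>R\<close> does not vanish.\<close>
  have "rsquarefree R"
    unfolding rsquarefree_roots
  proof (intro allI notI)
    fix x assume x: "poly R x = 0 \<and> poly (pderiv R) x = 0"
    then have "poly (wr \<nu> P R) x = 0" by (simp add: poly_wr)
    then have "x = 1" using c by simp
    then show False using x R1 by simp
  qed
  then have dec: "smult (lead_coeff R) (\<Prod>z|poly R z = 0. [:-z, 1:]) = R"
    by (rule complex_poly_decompose_rsquarefree)
  define M where "M = {z. poly R z = 0}"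
  have fin: "finite M" unfolding M_def using nz(2) by (rule poly_roots_finite)
  obtain a where a: "bij_betw a {1..card M} M" using ex_bij_betw_nat_finite_1[OF fin] by blast
  have prod: "(\<Prod>z\<in>M. [:-z, 1:]) = root_prod {1..card M} a"
    unfolding root_prod_def using prod.reindex_bij_betw[OF a, of "\<lambda>z. [:-z, 1:]"] by simp
  have R: "R = smult (lead_coeff R) (root_prod {1..card M} a)" using dec prod by (simp add: M_def)
  have "degree (root_prod {1..card M} a) = card M"
    unfolding root_prod_def by (subst degree_prod_sum_eq) auto
  then have deg: "degree R = card M" using R nz(2) by (metis degree_smult_eq leading_coeff_0_iff)
  have inj: "inj_on a {1..card M}" and img: "\<And>j. j \<in> {1..card M} \<Longrightarrow> poly R (a j) = 0"
    using a by (auto simp: bij_betw_def M_def)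
  have adm: "admissible (card M) a"
    unfolding admissible_def using inj img nz(5) R1 by metis
  have "root_system \<nu> m (card M) a"
    unfolding root_system_def
  proof
    fix j assume j: "j \<in> {1..card M}"
    note d = root_prod_derivs[OF finite_atLeastAtMost inj j]
    let ?g = "poly (root_prod ({1..card M} - {j}) a) (a j)" and ?s = "\<Sum>k\<in>{1..card M} - {j}. 2 / (a j - a k)"
    have aj: "a j \<noteq> 0" "a j - 1 \<noteq> 0" using adm j by (auto simp: admissible_def)
    define lc where "lc = lead_coeff R"
    have R': "R = smult lc (root_prod {1..card M} a)" and "lc \<noteq> 0" using R nz(2) by (simp_all add: lc_def)
    have "poly (pderiv R) (a j) = lc * ?g" "poly (pderiv (pderiv R)) (a j) = lc * (?g * ?s)"
      unfolding R' pderiv_smult poly_smult d by (rule refl)+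
    moreover have "poly (root_op \<nu> m R) (a j) = 0"
      unfolding normal_pair_ode[OF assms] using img[OF j] by simp
    then have "a j * (a j - 1) * poly (pderiv (pderiv R)) (a j)
       - (of_real (\<nu> - 1) * (a j - 1) + of_nat m * a j) * poly (pderiv R) (a j) = 0"
      by (simp add: root_op_def algebra_simps)
    ultimately have "lc * ?g * (a j * (a j - 1) * ?s - (of_real (\<nu> - 1) * (a j - 1) + of_nat m * a j)) = 0"
      by (simp add: algebra_simps)
    then have "a j * (a j - 1) * ?s = of_real (\<nu> - 1) * (a j - 1) + of_nat m * a j"
      using \<open>lc \<noteq> 0\<close> d(3) by simp
    then have "?s = (of_real (\<nu> - 1) * (a j - 1) + of_nat m * a j) / (a j * (a j - 1))"
      using aj by (simp add: field_simps)
    also have "\<dots> = of_real (\<nu> - 1) / a j + of_nat m / (a j - 1)"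
      using aj by (simp add: add_divide_distrib)
    finally show "of_real (\<nu> - 1) / a j + of_nat m / (a j - 1) - ?s = 0" by simp
  qed
  then show ?thesis using adm deg by auto
qed

section \<open>From solutions of the system back to a pair\<close>

lemma pderiv_sum: "pderiv (\<Sum>i\<in>I. f i) = (\<Sum>i\<in>I. pderiv (f i))"
  by (induction I rule: infinite_finite_induct) (simp_all add: pderiv_add)

lemma double_root_dvd:
  fixes F :: "complex poly"
  assumes "poly F x = 0" "poly (pderiv F) x = 0"
  shows "[:- x, 1:]\<^sup>2 dvd F"
proof -
  obtain G where G: "F = [:- x, 1:] * G" using assms(1) by (auto simp: poly_eq_0_iff_dvd dvd_def)
  have "poly G x = 0" using assms(2) unfolding G pderiv_linear_mult by simp
  then show ?thesis unfolding G power2_eq_square by (intro mult_dvd_mono) (auto simp: poly_eq_0_iff_dvd)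
qed

lemma root_prod_squared_dvd:
  assumes "finite I" "inj_on a I" "\<And>i. i \<in> I \<Longrightarrow> [:- a i, 1:]\<^sup>2 dvd F"
  shows "(root_prod I a)\<^sup>2 dvd F"
  using assms
proof (induction I rule: finite_induct)
  case (insert i I)
  have "poly (root_prod I a) (a i) \<noteq> 0"
    using insert.hyps insert.prems(1) by (auto simp: poly_root_prod inj_on_def)
  then have "coprime ([:- a i, 1:]\<^sup>2) ((root_prod I a)\<^sup>2)" by (auto simp: coprime_complex_poly_iff)
  then have "[:- a i, 1:]\<^sup>2 * (root_prod I a)\<^sup>2 dvd F"
    using insert by (intro divides_mult) auto
  moreover have "root_prod (insert i I) a = [:- a i, 1:] * root_prod I a"
    using insert.hyps by (simp add: root_prod_def)
  ultimately show ?case by (simp only: power_mult_distrib)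
qed (simp add: root_prod_def)

text \<open>The operator sending T to \<nu> T + z T' multiplies z^k by \<nu> + k, which is never
  0.\<close>

lemma euler_operator_surj:
  assumes "\<nu> \<notin> \<int>"
  shows "\<exists>T. wr \<nu> T 1 = F"
proof -
  define T where "T = (\<Sum>k\<le>degree F. monom (coeff F k / of_real (\<nu> + real k)) k)"
  have cT: "coeff T k = coeff F k / of_real (\<nu> + real k)" for k
    by (cases "k \<le> degree F") (auto simp: T_def coeff_sum coeff_eq_0)
  have "wr \<nu> T 1 = F"
  proof (rule poly_eqI)
    fix k
    have "coeff (wr \<nu> T 1) k = of_real (\<nu> + real k) * coeff T k"
      by (cases k) (simp_all add: wr_def coeff_pCons coeff_pderiv algebra_simps)
    moreover have "\<nu> + real k \<noteq> 0" using Ints_combine[OF assms, of k 0] by simp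
    then have "complex_of_real (\<nu> + real k) \<noteq> 0" unfolding of_real_eq_0_iff .
    ultimately show "coeff (wr \<nu> T 1) k = coeff F k" unfolding cT by (simp del: of_real_add)
  qed
  then show ?thesis ..
qed

text \<open>The system says that \<open>z\<^bsup>\<nu> - 1\<^esup> (z - 1)\<^sup>m / R\<^sup>2\<close> has no residues, so that it has a primitive \<open>z\<^sup>\<nu> P / R\<close>.\<close>

lemma normal_pair_of_root_system:
  assumes nu: "\<nu> \<notin> \<int>" and adm: "admissible N a" and sys: "root_system \<nu> m N a"
  shows "\<exists>P. normal_pair \<nu> m P (root_prod {1..N} a)"
proof -
  let ?I = "{1..N}"
  let ?R = "root_prod ?I a"
  define G where "G j = root_prod (?I - {j}) a" for j
  have inj: "inj_on a ?I" and a01: "\<And>j. j \<in> ?I \<Longrightarrow> a j \<noteq> 0 \<and> a j \<noteq> 1"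
    using adm by (auto simp: admissible_def)
  have G0: "poly (G j) (a j) \<noteq> 0" if "j \<in> ?I" for j
    unfolding G_def by (rule root_prod_derivs(3)[OF _ inj that]) simp
  have Gi: "poly (G j) (a i) = 0" if "i \<in> ?I" "j \<in> ?I" "i \<noteq> j" for i j
    unfolding G_def using that by (auto simp: poly_root_prod)
  have dG: "poly (pderiv (G j)) (a j) = poly (G j) (a j) * (\<Sum>k\<in>?I - {j}. 1 / (a j - a k))" if "j \<in> ?I" for j
    unfolding G_def using inj that by (intro poly_pderiv_root_prod) (auto dest: inj_onD)
  \<comment> \<open>Ansatz P / R = T + sum of c_j / (z - a_j), with G_j = R / (z - a_j). Matching
    the coefficient of (z - a_j)^(-2) in the derivative fixes \<open>c j\<close>.\<close>
  define c where "c j = - ((a j - 1) ^ m / (a j * (poly (G j) (a j))\<^sup>2))" for j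
  have cG: "c j * (poly (G j) (a j))\<^sup>2 * a j = - ((a j - 1) ^ m)" if "j \<in> ?I" for j
    using a01[OF that] G0[OF that] by (simp add: c_def)
  \<comment> \<open>The contribution of the j-th fraction to the Wronskian; the linear factor is
    \<nu> (z - a_j) - z.\<close>
  define E where "E j = smult (c j) ((G j)\<^sup>2 * [:- of_real \<nu> * a j, of_real \<nu> - 1:])" for j
  have pE: "poly (E j) z = c j * (poly (G j) z)\<^sup>2 * ((of_real \<nu> - 1) * z - of_real \<nu> * a j)" for j z
    by (simp add: E_def algebra_simps)
  have pE': "poly (pderiv (E j)) z = c j * (2 * poly (G j) z * poly (pderiv (G j)) z * ((of_real \<nu> - 1) * z - of_real \<nu> * a j)
      + (poly (G j) z)\<^sup>2 * (of_real \<nu> - 1))" for j z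
    unfolding E_def power2_eq_square pderiv_smult pderiv_mult by (simp add: pderiv_pCons algebra_simps)
  \<comment> \<open>What is left after the double poles have been matched. At each root
    \<open>F\<close> vanishes by the choice of \<open>c\<close>, and its derivative vanishes by the
    system.\<close>
  define F where "F = [:-1, 1:] ^ m - (\<Sum>j\<in>?I. E j)"
  have "?R\<^sup>2 dvd F"
  proof (rule root_prod_squared_dvd[OF _ inj])
    fix i assume i: "i \<in> ?I"
    have sum: "poly (\<Sum>j\<in>?I. E j) (a i) = poly (E i) (a i)"
      "poly (pderiv (\<Sum>j\<in>?I. E j)) (a i) = poly (pderiv (E i)) (a i)"
    proof -
      have one: "(\<Sum>j\<in>?I. f j) = f i" if "\<And>j. j \<in> ?I - {i} \<Longrightarrow> f j = 0" for f :: "nat \<Rightarrow> complex"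
        unfolding sum.remove[OF finite_atLeastAtMost i] using that by (simp add: sum.neutral)
      have "poly (G j) (a i) = 0" if "j \<in> ?I - {i}" for j using Gi[OF i, of j] that by auto
      then have "(\<Sum>j\<in>?I. poly (E j) (a i)) = poly (E i) (a i)" "(\<Sum>j\<in>?I. poly (pderiv (E j)) (a i)) = poly (pderiv (E i)) (a i)"
        by (intro one; simp add: pE pE')+
      then show "poly (\<Sum>j\<in>?I. E j) (a i) = poly (E i) (a i)"
        "poly (pderiv (\<Sum>j\<in>?I. E j)) (a i) = poly (pderiv (E i)) (a i)"
        by (simp_all add: poly_sum pderiv_sum)
    qed
    let ?g = "poly (G i) (a i)" and ?s = "\<Sum>k\<in>?I - {i}. 2 / (a i - a k)" and ?x = "a i"
    have s2: "2 * poly (pderiv (G i)) ?x = ?g * ?s"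
      unfolding dG[OF i] by (simp add: sum_distrib_left mult_ac)
    have x: "?x \<noteq> 0" "?x - 1 \<noteq> 0" using a01[OF i] by auto
    have "(?x - 1) * (?x * ?s - (of_real \<nu> - 1)) = of_nat m * ?x"
    proof -
      have "of_real (\<nu> - 1) / ?x + of_nat m / (?x - 1) - ?s = 0"
        using sys i unfolding root_system_def by blast
      then have e: "?s = (of_real \<nu> - 1) / ?x + of_nat m / (?x - 1)" by simp
      have "(x - 1) * (x * (n / x + p / (x - 1)) - n) = p * x" if "x \<noteq> 0" "x - 1 \<noteq> 0" for x n p :: complex
        using that by (simp add: field_simps)
      from this[OF x] show ?thesis unfolding e .
    qed
    note sysx = this
    show "[:- a i, 1:]\<^sup>2 dvd F"
    proof (rule double_root_dvd)
      have "poly F ?x = (?x - 1) ^ m + c i * ?g\<^sup>2 * ?x"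
        unfolding F_def poly_diff sum(1) pE by (simp add: algebra_simps)
      then show "poly F ?x = 0" unfolding cG[OF i] by simp
      have "poly (pderiv F) ?x = of_nat m * (?x - 1) ^ (m - 1)
         - c i * (?g * (2 * poly (pderiv (G i)) ?x) * (- ?x) + ?g\<^sup>2 * (of_real \<nu> - 1))"
        unfolding F_def pderiv_diff poly_diff sum(2) pE' by (simp add: pderiv_power pderiv_pCons algebra_simps)
      then have dF: "poly (pderiv F) ?x = of_nat m * (?x - 1) ^ (m - 1) + c i * ?g\<^sup>2 * (?x * ?s - (of_real \<nu> - 1))"
        unfolding s2 by (simp add: power2_eq_square algebra_simps)
      have "?x * (?x - 1) * poly (pderiv F) ?x =
         ?x * (of_nat m * ((?x - 1) * (?x - 1) ^ (m - 1))) + (c i * ?g\<^sup>2 * ?x) * ((?x - 1) * (?x * ?s - (of_real \<nu> - 1)))"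
        unfolding dF by (simp only: distrib_left mult_ac)
      also have "\<dots> = ?x * (of_nat m * (?x - 1) ^ m) + (- ((?x - 1) ^ m)) * (of_nat m * ?x)"
        unfolding cG[OF i] sysx by (cases m) auto
      also have "\<dots> = 0" by simp
      finally show "poly (pderiv F) ?x = 0" using x by simp
    qed
  qed simp
  then obtain T0 where T0: "F = ?R\<^sup>2 * T0" by (auto simp: dvd_def)
  obtain T where T: "wr \<nu> T 1 = T0" using euler_operator_surj[OF nu] by blast
  define P where "P = ?R * T + (\<Sum>j\<in>?I. smult (c j) (G j))"
  have "wr \<nu> (?R * T) ?R = ?R\<^sup>2 * T0"
    using wr_mult_common[of \<nu> ?R T 1] by (simp add: T)
  moreover have "wr \<nu> (smult (c j) (G j)) ?R = E j" if "j \<in> ?I" for j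
  proof -
    have "?R = G j * [:- a j, 1:]" using root_prod_remove[of ?I j a] that by (simp add: G_def mult.commute)
    moreover have "wr \<nu> (G j * 1) (G j * [:- a j, 1:]) = (G j)\<^sup>2 * [:- of_real \<nu> * a j, of_real \<nu> - 1:]"
      unfolding wr_mult_common
      by (rule arg_cong[where f="\<lambda>x. (G j)\<^sup>2 * x"], rule complex_poly_eqI) (simp add: poly_wr pderiv_pCons algebra_simps)
    ultimately show ?thesis unfolding E_def wr_smult by simp
  qed
  ultimately have "wr \<nu> P ?R = F + (\<Sum>j\<in>?I. E j)"
    unfolding P_def wr_add_left wr_sum_left T0 by simp
  then have wrP: "wr \<nu> P ?R = smult 1 ([:-1, 1:] ^ m)" by (simp add: F_def)
  have "coprime P ?R"
    unfolding coprime_complex_poly_iff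
  proof
    assume "\<exists>z. poly P z = 0 \<and> poly ?R z = 0"
    then obtain z where z: "poly P z = 0" "poly ?R z = 0" by blast
    then have "poly (wr \<nu> P ?R) z = 0" by (simp add: poly_wr)
    then have "z = 1" unfolding wrP by simp
    then show False using z(2) a01 by (auto simp: poly_root_prod)
  qed
  then show ?thesis using nu wrP unfolding normal_pair_def by (intro exI[of _ P] conjI exI[of _ 1]) auto
qed

section \<open>The metrics given by polynomial pairs\<close>

text \<open>The pullback of the round metric under \<open>z\<^sup>\<nu> p / q\<close>.\<close>

definition met :: "real \<Rightarrow> complex poly \<Rightarrow> complex poly \<Rightarrow> complex \<Rightarrow> real" where
  "met \<nu> p q z = 4 * cmod z powr (2 * \<nu> - 2) * (cmod (poly (wr \<nu> p q) z))\<^sup>2 /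
     ((cmod (poly q z))\<^sup>2 + cmod z powr (2 * \<nu>) * (cmod (poly p z))\<^sup>2)\<^sup>2"

text \<open>The two sides belong to g and 1/g, and inversion is an isometry of the round
  metric.\<close>

lemma met_swap:
  assumes "z \<noteq> 0"
  shows "met (- \<nu>) q p z = met \<nu> p q z"
proof -
  define X where "X = cmod z powr (2 * \<nu>)"
  define w where "w = cmod z powr (- 2)"
  have X: "X > 0" using assms by (simp add: X_def)
  have 1: "cmod z powr (2 * \<nu> - 2) = X * w" "cmod z powr (2 * (- \<nu>) - 2) = w / X" "cmod z powr (2 * (- \<nu>)) = 1 / X"
    by (simp_all add: X_def w_def powr_diff powr_minus divide_inverse)
  have "4 * (w / X) * W / (p' + 1 / X * q')\<^sup>2 = 4 * (X * w) * W / (q' + X * p')\<^sup>2" for W p' q' :: real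
  proof -
    have "p' + 1 / X * q' = (q' + X * p') / X" using X by (simp add: add_divide_distrib)
    moreover have "4 * (w / X) * W / (S / X)\<^sup>2 = 4 * (X * w) * W / S\<^sup>2" for S
      using X by (simp add: power_divide power2_eq_square)
    ultimately show ?thesis by (simp only:)
  qed
  then show ?thesis unfolding met_def wr_swap poly_minus norm_minus_cancel 1 X_def[symmetric] .
qed

lemma met_smult_common:
  assumes "c \<noteq> 0"
  shows "met \<nu> (smult c p) (smult c q) z = met \<nu> p q z"
proof -
  have "k * (C * (C * W))\<^sup>2 / ((C * Q)\<^sup>2 + X * (C * P)\<^sup>2)\<^sup>2 = k * W\<^sup>2 / (Q\<^sup>2 + X * P\<^sup>2)\<^sup>2" if "C \<noteq> 0" for C W k Q X P :: real
  proof -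
    have "(C * Q)\<^sup>2 + X * (C * P)\<^sup>2 = C\<^sup>2 * (Q\<^sup>2 + X * P\<^sup>2)" by (simp add: power_mult_distrib algebra_simps)
    then have "((C * Q)\<^sup>2 + X * (C * P)\<^sup>2)\<^sup>2 = (C * C)\<^sup>2 * (Q\<^sup>2 + X * P\<^sup>2)\<^sup>2" by (simp add: power_mult_distrib power2_eq_square)
    then show ?thesis using that by (simp add: power_mult_distrib)
  qed
  then show ?thesis
    unfolding met_def wr_smult poly_smult norm_mult using assms by simp
qed

text \<open>Multiplying g by a number of modulus 1 rotates the sphere. This is why the family of
  metrics has a positive real parameter.\<close>

lemma met_smult_cmod: "met \<nu> (smult c p) q z = met \<nu> (smult (of_real (cmod c)) p) q z"
  by (simp add: met_def wr_smult norm_mult)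

lemma met_shift_left:
  assumes "z \<noteq> 0"
  shows "met \<nu> ([:0, 1:] ^ n * p) q z = met (\<nu> + real n) p q z"
proof (induction n arbitrary: \<nu>)
  case (Suc n)
  have "met \<nu> ([:0, 1:] * r) q z = met (\<nu> + 1) r q z" for r
  proof -
    have e: "cmod z powr (2 * (\<nu> + 1) - 2) = cmod z powr (2 * \<nu> - 2) * (cmod z)\<^sup>2"
      "cmod z powr (2 * (\<nu> + 1)) = cmod z powr (2 * \<nu>) * (cmod z)\<^sup>2"
    proof -
      have "2 * (\<nu> + 1) - 2 = (2 * \<nu> - 2) + 2" "2 * (\<nu> + 1) = 2 * \<nu> + 2" by simp_all
      then show "cmod z powr (2 * (\<nu> + 1) - 2) = cmod z powr (2 * \<nu> - 2) * (cmod z)\<^sup>2"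
        "cmod z powr (2 * (\<nu> + 1)) = cmod z powr (2 * \<nu>) * (cmod z)\<^sup>2"
        using assms by (simp_all only: powr_add) simp_all
    qed
    have "poly [:0, 1:] z = z" by simp
    then show ?thesis unfolding met_def wr_shift poly_mult norm_mult power_mult_distrib e by (simp only: mult_ac)
  qed
  from this[of "[:0, 1:] ^ n * p"] show ?case
    using Suc.IH[of "\<nu> + 1"] by (simp add: mult.assoc add_ac)
qed simp

lemma met_shift_right:
  assumes "z \<noteq> 0"
  shows "met \<nu> p ([:0, 1:] ^ n * q) z = met (\<nu> - real n) p q z"
proof -
  have "met \<nu> p ([:0, 1:] ^ n * q) z = met (- \<nu>) ([:0, 1:] ^ n * q) p z" by (rule met_swap[OF assms, symmetric])
  also have "\<dots> = met (- (\<nu> - real n)) q p z" by (simp add: met_shift_left[OF assms])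
  also have "\<dots> = met (\<nu> - real n) p q z" by (rule met_swap[OF assms])
  finally show ?thesis .
qed

text \<open>On the covering, differentiation becomes z d/dz, which accounts for the factor |exp
  \<zeta>|^2, and the power of z is single-valued there.\<close>

lemma pullback_derivative:
  fixes p q :: "complex poly" and \<mu> :: real and \<zeta> :: complex
  assumes "poly q (exp \<zeta>) \<noteq> 0"
  defines "g \<equiv> \<lambda>\<xi>. exp (of_real \<mu> * \<xi>) * (poly p (exp \<xi>) / poly q (exp \<xi>))"
  shows "(g has_field_derivative exp (of_real \<mu> * \<zeta>) * poly (wr \<mu> p q) (exp \<zeta>) / (poly q (exp \<zeta>))\<^sup>2) (at \<zeta>)"
    "4 * (cmod (deriv g \<zeta>))\<^sup>2 / (1 + (cmod (g \<zeta>))\<^sup>2)\<^sup>2 = met \<mu> p q (exp \<zeta>) * (cmod (exp \<zeta>))\<^sup>2"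
proof -
  define z where "z = exp \<zeta>"
  have pd: "((\<lambda>\<xi>. poly r (exp \<xi>)) has_field_derivative poly (pderiv r) z * z) (at \<zeta>)" for r
    unfolding z_def by (rule DERIV_chain2[OF poly_DERIV DERIV_exp])
  have ed: "((\<lambda>\<xi>. exp (of_real \<mu> * \<xi>)) has_field_derivative exp (of_real \<mu> * \<zeta>) * of_real \<mu>) (at \<zeta>)"
    by (auto intro!: derivative_eq_intros)
  have q: "poly q z \<noteq> 0" using assms by (simp add: z_def)
  have "(g has_field_derivative (exp (of_real \<mu> * \<zeta>) * of_real \<mu>) * (poly p (exp \<zeta>) / poly q (exp \<zeta>)) +
    (poly (pderiv p) z * z * poly q (exp \<zeta>) - poly p (exp \<zeta>) * (poly (pderiv q) z * z)) / (poly q (exp \<zeta>) * poly q (exp \<zeta>)) * exp (of_real \<mu> * \<zeta>)) (at \<zeta>)"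
    unfolding g_def by (intro DERIV_mult DERIV_divide pd ed assms(1))
  moreover have "(exp (of_real \<mu> * \<zeta>) * of_real \<mu>) * (poly p (exp \<zeta>) / poly q (exp \<zeta>)) +
    (poly (pderiv p) z * z * poly q (exp \<zeta>) - poly p (exp \<zeta>) * (poly (pderiv q) z * z)) / (poly q (exp \<zeta>) * poly q (exp \<zeta>)) * exp (of_real \<mu> * \<zeta>)
    = exp (of_real \<mu> * \<zeta>) * poly (wr \<mu> p q) (exp \<zeta>) / (poly q (exp \<zeta>))\<^sup>2"
    unfolding z_def[symmetric] poly_wr using q by (simp add: power2_eq_square field_simps)
  ultimately show d: "(g has_field_derivative exp (of_real \<mu> * \<zeta>) * poly (wr \<mu> p q) (exp \<zeta>) / (poly q (exp \<zeta>))\<^sup>2) (at \<zeta>)"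
    by simp
  have n: "cmod (exp (of_real \<mu> * \<zeta>)) = cmod z powr \<mu>"
    by (simp add: z_def powr_def)
  have Z: "cmod z > 0" by (simp add: z_def)
  have "4 * (X * W / Q\<^sup>2)\<^sup>2 / (1 + (X * (P / Q))\<^sup>2)\<^sup>2 = 4 * X\<^sup>2 * W\<^sup>2 / (Q\<^sup>2 + X\<^sup>2 * P\<^sup>2)\<^sup>2" if "Q > 0" for X W Q P :: real
  proof -
    have "1 + (X * (P / Q))\<^sup>2 = (Q\<^sup>2 + X\<^sup>2 * P\<^sup>2) / Q\<^sup>2" using that by (simp add: field_simps)
    then show ?thesis using that by (simp add: power_divide power_mult_distrib)
  qed
  note alg = this
  have "4 * (cmod (deriv g \<zeta>))\<^sup>2 / (1 + (cmod (g \<zeta>))\<^sup>2)\<^sup>2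
    = 4 * (cmod z powr \<mu>)\<^sup>2 * (cmod (poly (wr \<mu> p q) z))\<^sup>2 / ((cmod (poly q z))\<^sup>2 + (cmod z powr \<mu>)\<^sup>2 * (cmod (poly p z))\<^sup>2)\<^sup>2"
    unfolding DERIV_imp_deriv[OF d] unfolding g_def z_def[symmetric] norm_mult norm_divide norm_power n
    by (rule alg) (use q in simp)
  moreover have "(cmod z powr \<mu>)\<^sup>2 = cmod z powr (2 * \<mu>)" by (simp add: power2_eq_square powr_add[symmetric])
  moreover have "cmod z powr (2 * \<mu>) = cmod z powr (2 * \<mu> - 2) * (cmod z)\<^sup>2"
    using Z powr_add[of "cmod z" "2 * \<mu> - 2" 2] by simp
  ultimately show "4 * (cmod (deriv g \<zeta>))\<^sup>2 / (1 + (cmod (g \<zeta>))\<^sup>2)\<^sup>2 = met \<mu> p q (exp \<zeta>) * (cmod (exp \<zeta>))\<^sup>2"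
    unfolding met_def z_def[symmetric] by (simp add: mult_ac)
qed

text \<open>At a pole the definition passes to 1/g, which belongs to the exchanged pair with
  exponent - \<mu>; \<open>met_swap\<close> reconciles the two cases.\<close>

lemma round_pullback_eq_met:
  assumes "coprime p q" "q \<noteq> 0"
  shows "round_pullback (\<lambda>\<xi>. exp (of_real \<mu> * \<xi>) * (poly p (exp \<xi>) / poly q (exp \<xi>))) \<zeta>
    = met \<mu> p q (exp \<zeta>) * (cmod (exp \<zeta>))\<^sup>2"
proof -
  define g where "g = (\<lambda>\<xi>. exp (of_real \<mu> * \<xi>) * (poly p (exp \<xi>) / poly q (exp \<xi>)))"
  show ?thesis
  proof (cases "poly q (exp \<zeta>) = 0")
    case False
    have "isCont g \<zeta>" using pullback_derivative(1)[OF False, of \<mu> p] DERIV_isCont unfolding g_def by blast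
    then have "(g \<longlongrightarrow> g \<zeta>) (at \<zeta>)" by (simp add: isCont_def)
    then have "\<not> is_pole g \<zeta>"
      unfolding is_pole_def using not_tendsto_and_filterlim_at_infinity[of "at \<zeta>" g "g \<zeta>"] by auto
    then show ?thesis using pullback_derivative(2)[OF False, of \<mu> p]
      unfolding round_pullback_def Let_def g_def by simp
  next
    case True
    then have p: "poly p (exp \<zeta>) \<noteq> 0" using assms(1) coprime_complex_poly_iff by blast
    \<comment> \<open>True at zeros of \<open>p\<close> and \<open>q\<close> as well, where both
      sides are 0 because \<open>x / 0 = 0\<close>.\<close>
    have inv: "(\<lambda>\<xi>. inverse (g \<xi>)) = (\<lambda>\<xi>. exp (of_real (- \<mu>) * \<xi>) * (poly q (exp \<xi>) / poly p (exp \<xi>)))"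
      by (rule ext) (simp add: g_def exp_minus inverse_eq_divide mult.commute)
    have "isCont (\<lambda>\<xi>. inverse (g \<xi>)) \<zeta>"
      using pullback_derivative(1)[OF p, of "- \<mu>" q] DERIV_isCont unfolding inv by blast
    then have "((\<lambda>\<xi>. inverse (g \<xi>)) \<longlongrightarrow> 0) (at \<zeta>)"
      using True by (simp add: isCont_def g_def)
    \<comment> \<open>A pole requires 1/g to tend to 0 without taking the value 0. The other roots
      of \<open>p\<close> and \<open>q\<close> stay away, and within distance 2 pi no other point
      has the same exponential.\<close>
    moreover have "\<forall>\<^sub>F \<xi> in at \<zeta>. inverse (g \<xi>) \<noteq> 0"
    proof -
      let ?Z = "{z. poly q z = 0} \<union> {z. poly p z = 0}"
      have "p \<noteq> 0" using p by auto
      then have "finite ?Z" using assms(2) poly_roots_finite by auto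
      then have "closed (?Z - {exp \<zeta>})" by (intro finite_imp_closed) auto
      then have "open (- (?Z - {exp \<zeta>}))" by (rule open_Compl)
      moreover have "isCont exp \<zeta>" by (intro continuous_intros)
      ultimately have "\<forall>\<^sub>F \<xi> in at \<zeta>. exp \<xi> \<in> - (?Z - {exp \<zeta>})"
        unfolding isCont_def by (intro topological_tendstoD) auto
      moreover have "\<forall>\<^sub>F \<xi> in at \<zeta>. \<xi> \<in> ball \<zeta> (2 * pi) - {\<zeta>}"
        by (rule eventually_at_in_open) auto
      ultimately show ?thesis
      proof eventually_elim
        case (elim \<xi>)
        have "exp \<xi> \<noteq> exp \<zeta>"
        proof
          assume "exp \<xi> = exp \<zeta>"
          then obtain n :: int where n: "\<xi> = \<zeta> + (of_int (2 * n) * pi) * \<i>" unfolding exp_eq by blast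
          then have "dist \<zeta> \<xi> = \<bar>of_int (2 * n) * pi\<bar>" by (simp add: dist_norm norm_mult abs_mult)
          then have "\<bar>real_of_int n\<bar> < 1" using elim by (simp add: abs_mult)
          then have "n = 0" by linarith
          then show False using n elim by simp
        qed
        then show ?case using elim by (auto simp: g_def)
      qed
    qed
    ultimately have "filterlim (\<lambda>\<xi>. inverse (g \<xi>)) (at 0) (at \<zeta>)" by (rule filterlim_atI)
    then have "filterlim (\<lambda>\<xi>. inverse (inverse (g \<xi>))) at_infinity (at \<zeta>)"
      by (rule filterlim_compose[OF filterlim_inverse_at_infinity])
    then have "is_pole g \<zeta>" by (simp add: is_pole_def)
    then have "round_pullback g \<zeta> = met (- \<mu>) q p (exp \<zeta>) * (cmod (exp \<zeta>))\<^sup>2"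
      using pullback_derivative(2)[OF p, of "- \<mu>" q] unfolding round_pullback_def Let_def inv by simp
    then show ?thesis unfolding g_def using met_swap by simp
  qed
qed

section \<open>Metrics represented on the punctured plane\<close>

definition given_by :: "conformal_metric \<Rightarrow> real \<Rightarrow> complex poly \<Rightarrow> complex poly \<Rightarrow> bool" where
  "given_by \<sigma> \<nu> p q \<longleftrightarrow> (\<forall>z. z \<noteq> 0 \<longrightarrow> z \<noteq> 1 \<longrightarrow> \<sigma> (Some z) = met \<nu> p q z)"

lemma given_by_cong:
  "given_by \<sigma> \<nu> p q \<Longrightarrow> (\<And>z. z \<noteq> 0 \<Longrightarrow> met \<nu> p q z = met \<nu>' p' q' z) \<Longrightarrow> given_by \<sigma> \<nu>' p' q'"
  by (simp add: given_by_def)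

text \<open>Since exp maps onto the nonzero numbers, the condition descends from the covering to the
  plane.\<close>

lemma developed_by_iff:
  assumes "coprime p q" "q \<noteq> 0"
  shows "developed_by \<sigma> \<mu> (\<lambda>z. poly p z / poly q z) \<longleftrightarrow> given_by \<sigma> \<mu> p q"
proof -
  have "developed_by \<sigma> \<mu> (\<lambda>z. poly p z / poly q z) \<longleftrightarrow>
    (\<forall>\<zeta>. exp \<zeta> \<noteq> 1 \<longrightarrow> \<sigma> (Some (exp \<zeta>)) = met \<mu> p q (exp \<zeta>))"
    unfolding developed_by_def round_pullback_eq_met[OF assms] by simp
  also have "\<dots> \<longleftrightarrow> given_by \<sigma> \<mu> p q"
    unfolding given_by_def by (metis exp_not_eq_zero exp_Ln)
  finally show ?thesis .
qed

lemma developed_by_scaled_iff: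
  assumes "coprime p q" "q \<noteq> 0" "t > 0"
  shows "developed_by \<sigma> \<mu> (\<lambda>z. of_real t * (poly p z / poly q z)) \<longleftrightarrow> given_by \<sigma> \<mu> (smult (of_real t) p) q"
proof -
  have "coprime (smult (of_real t) p) q" using assms by (auto simp: coprime_complex_poly_iff)
  from developed_by_iff[OF this assms(2), of \<sigma> \<mu>] show ?thesis by simp
qed

lemma gauss_curvature_cong:
  assumes "open U" "z \<in> U" "\<And>w. w \<in> U \<Longrightarrow> f w = g w"
  shows "gauss_curvature f z = gauss_curvature g z"
proof -
  have fd: "frechet_derivative f (at w) = frechet_derivative g (at w)"
    if w: "w \<in> U" and fg: "\<And>w. w \<in> U \<Longrightarrow> f w = g w" for f g :: "complex \<Rightarrow> real" and w
  proof -
    have "(f has_derivative D) (at w) \<longleftrightarrow> (g has_derivative D) (at w)" for D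
    proof
      show "(g has_derivative D) (at w)" if "(f has_derivative D) (at w)"
        by (rule has_derivative_transform_within_open[OF that assms(1) w]) (rule fg)
      show "(f has_derivative D) (at w)" if "(g has_derivative D) (at w)"
        by (rule has_derivative_transform_within_open[OF that assms(1) w]) (rule fg[symmetric])
    qed
    then show ?thesis unfolding frechet_derivative_def by simp
  qed
  have "laplacian (\<lambda>w. ln (f w)) z = laplacian (\<lambda>w. ln (g w)) z"
    unfolding laplacian_def using assms by (simp add: fd[of z "\<lambda>w. frechet_derivative (\<lambda>w. ln (f w)) (at w) _"
      "\<lambda>w. frechet_derivative (\<lambda>w. ln (g w)) (at w) _"] fd[of _ "\<lambda>w. ln (f w)" "\<lambda>w. ln (g w)"])
  then show ?thesis using assms by (simp add: gauss_curvature_def)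
qed

lemma smooth_on_cong: "open U \<Longrightarrow> (\<And>z. z \<in> U \<Longrightarrow> f z = g z) \<Longrightarrow> smooth_on f U \<Longrightarrow> smooth_on g U"
  unfolding smooth_on_def using C_k_on_cong by blast

text \<open>Near \<open>z0\<close> the density \<open>dens\<close> applies with f1 = z^\<nu> P and
  f2 = R, on a slit plane that carries a logarithm. The branch drops out of the moduli, and the
  Wronskian vanishes only at 1.\<close>

lemma met_regular:
  assumes np: "normal_pair \<nu> m P R" and z0: "z0 \<noteq> 0" "z0 \<noteq> 1"
  obtains U where "open U" "z0 \<in> U" "U \<subseteq> - {0, 1}" "smooth_on (met \<nu> P R) U"
    "\<And>z. z \<in> U \<Longrightarrow> met \<nu> P R z > 0" "\<And>z. z \<in> U \<Longrightarrow> gauss_curvature (met \<nu> P R) z = 1"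
proof -
  obtain c where c: "c \<noteq> 0" "wr \<nu> P R = smult c ([:-1, 1:] ^ m)" using np by (auto simp: normal_pair_def)
  obtain U L where U: "open U" "z0 \<in> U" "U \<subseteq> - {0, 1}"
    and L: "\<And>z. z \<in> U \<Longrightarrow> (L has_field_derivative 1 / z) (at z)"
    and nL: "\<And>z. z \<in> U \<Longrightarrow> cmod (exp (of_real \<nu> * L z)) = cmod z powr \<nu>"
  proof (cases "z0 \<in> slit {0<..}")
    case True
    show ?thesis
    proof (rule that[of "slit {0<..} - {1}" "log_right 0"])
      show "slit {0<..} - {1} \<subseteq> - {0, 1}" by (auto simp: slit_def)
      show "(log_right 0 has_field_derivative 1 / z) (at z)" if "z \<in> slit {0<..} - {1}" for z
        using log_right_deriv[of z 0] that by simp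
      show "cmod (exp (of_real \<nu> * log_right 0 z)) = cmod z powr \<nu>" if "z \<in> slit {0<..} - {1}" for z
        using cmod_exp_log(1)[of z 0 \<nu>] that by (cases "z = 0") (auto simp: slit_def)
    qed (use True z0 open_slit in auto)
  next
    case False
    show ?thesis
    proof (rule that[of "slit {..<0}" "log_left 0"])
      show "slit {..<0} \<subseteq> - {0, 1}" by (auto simp: slit_def)
      show "(log_left 0 has_field_derivative 1 / z) (at z)" if "z \<in> slit {..<0}" for z
        using log_left_deriv[of z 0] that by simp
      show "cmod (exp (of_real \<nu> * log_left 0 z)) = cmod z powr \<nu>" if "z \<in> slit {..<0}" for z
        using cmod_exp_log(2)[of z 0 \<nu>] that by (cases "z = 0") (auto simp: slit_def)
      show "z0 \<in> slit {..<0}" using False z0(1) by (auto simp: slit_def complex_eq_iff)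
    qed (use open_slit in auto)
  qed
  define f1 where "f1 z = exp (of_real \<nu> * L z) * poly P z" for z
  define G where "G z = exp (of_real \<nu> * L z) / z * poly (wr \<nu> P R) z" for z
  have Lh: "L holomorphic_on U" using L U(1) by (auto simp: holomorphic_on_open)
  have ne: "z \<noteq> 0" "z \<noteq> 1" if "z \<in> U" for z using U(3) that by auto
  have f1h: "f1 holomorphic_on U" unfolding f1_def by (intro holomorphic_intros Lh)
  have Gh: "G holomorphic_on U" unfolding G_def by (intro holomorphic_intros Lh) (use ne in auto)
  have Rh: "poly R holomorphic_on U" by (intro holomorphic_intros)
  have df1: "deriv f1 z = exp (of_real \<nu> * L z) * (of_real \<nu> * (1 / z)) * poly P z + poly (pderiv P) z * exp (of_real \<nu> * L z)" if "z \<in> U" for z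
    unfolding f1_def by (rule DERIV_imp_deriv) (intro DERIV_mult DERIV_fun_exp DERIV_cmult L that poly_DERIV)
  have dR: "deriv (poly R) z = poly (pderiv R) z" for z by (rule DERIV_imp_deriv[OF poly_DERIV])
  have W: "deriv f1 z * poly R z - f1 z * deriv (poly R) z = G z" if "z \<in> U" for z
  proof -
    have "(E * (n * (1 / x)) * p + p' * E) * r - E * p * r' = E / x * (n * p * r + x * (p' * r - p * r'))"
      if "x \<noteq> 0" for E n x p p' r r' :: complex
      using that by (simp add: field_simps)
    from this[OF ne(1)[OF that]] show ?thesis
      unfolding df1[OF that] dR G_def f1_def poly_wr .
  qed
  have G0: "G z \<noteq> 0" if "z \<in> U" for z using ne[OF that] c by (simp add: G_def)
  have eq: "4 * (cmod (G z))\<^sup>2 / ((cmod (f1 z))\<^sup>2 + (cmod (poly R z))\<^sup>2)\<^sup>2 = met \<nu> P R z" if "z \<in> U" for z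
  proof -
    have "(cmod z powr \<nu>)\<^sup>2 = cmod z powr (2 * \<nu>)" by (simp add: power2_eq_square powr_add[symmetric])
    moreover have "cmod z powr (2 * \<nu>) / (cmod z)\<^sup>2 = cmod z powr (2 * \<nu> - 2)"
      using ne[OF that] by (simp add: powr_diff powr_realpow)
    ultimately show ?thesis
      unfolding met_def G_def f1_def norm_mult norm_divide power_mult_distrib power_divide nL[OF that]
      by (simp add: add.commute)
  qed
  show ?thesis
  proof (rule that[OF U])
    show "smooth_on (met \<nu> P R) U"
      by (rule smooth_on_cong[OF U(1) eq dens_smooth[OF U(1) f1h Rh Gh W G0]])
    show "met \<nu> P R z > 0" if "z \<in> U" for z
      using dens_pos[OF U(1) f1h Rh Gh W G0 that] eq[OF that] by simp
    show "gauss_curvature (met \<nu> P R) z = 1" if "z \<in> U" for z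
      using dens_curvature[OF U(1) f1h Rh Gh W G0 that] gauss_curvature_cong[OF U(1) that eq] by simp
  qed
qed

section \<open>Behaviour at the three points\<close>

lemma conical_at_iff:
  "conical_at \<sigma> p \<beta> \<longleftrightarrow> \<beta> > -1 \<and>
    (\<exists>C>0. ((\<lambda>z. coeff_near \<sigma> p z / cmod (z - coord p) powr (2 * \<beta>)) \<longlongrightarrow> C) (at (coord p)))"
proof -
  let ?f = "coeff_near \<sigma> p" and ?r = "\<lambda>z. cmod (z - coord p) powr (2 * \<beta>)"
  have "?f \<sim>[at (coord p)] (\<lambda>z. C * ?r z) \<longleftrightarrow> ((\<lambda>z. ?f z / ?r z) \<longlongrightarrow> C) (at (coord p))"
    if C: "C > 0" for C
  proof -
    have ev: "\<forall>\<^sub>F z in at (coord p). C * ?r z \<noteq> 0" using C by (auto simp: eventually_at_filter)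
    have "?f \<sim>[at (coord p)] (\<lambda>z. C * ?r z) \<longleftrightarrow> ((\<lambda>z. ?f z / (C * ?r z)) \<longlongrightarrow> 1) (at (coord p))"
      unfolding asymp_equiv_def
      by (rule tendsto_cong, rule eventually_mono[OF ev]) auto
    also have "\<dots> \<longleftrightarrow> ((\<lambda>z. ?f z / ?r z) \<longlongrightarrow> C) (at (coord p))"
    proof
      assume "((\<lambda>z. ?f z / (C * ?r z)) \<longlongrightarrow> 1) (at (coord p))"
      then have "((\<lambda>z. C * (?f z / (C * ?r z))) \<longlongrightarrow> C * 1) (at (coord p))" by (intro tendsto_intros)
      then show "((\<lambda>z. ?f z / ?r z) \<longlongrightarrow> C) (at (coord p))" using C by simp
    next
      assume "((\<lambda>z. ?f z / ?r z) \<longlongrightarrow> C) (at (coord p))"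
      then have "((\<lambda>z. ?f z / ?r z / C) \<longlongrightarrow> C / C) (at (coord p))" using C by (intro tendsto_intros) auto
      then show "((\<lambda>z. ?f z / (C * ?r z)) \<longlongrightarrow> 1) (at (coord p))" using C by (simp add: mult.commute)
    qed
    finally show ?thesis .
  qed
  then show ?thesis unfolding conical_at_def by blast
qed

lemma cmod_powr_limit:
  fixes a :: complex
  assumes "((\<lambda>z. cmod (z - a) powr e) \<longlongrightarrow> c) (at a)" "c \<noteq> 0"
  shows "e = 0"
proof -
  have pos: "\<not> x > 0" if "((\<lambda>z. cmod (z - a) powr x) \<longlongrightarrow> d) (at a)" "d \<noteq> 0" for x d
  proof
    assume "x > 0"
    have "((\<lambda>z. cmod (z - a)) \<longlongrightarrow> 0) (at a)" by (intro tendsto_eq_intros) auto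
    then have "((\<lambda>z. cmod (z - a) powr x) \<longlongrightarrow> 0 powr x) (at a)"
      using \<open>x > 0\<close> by (intro tendsto_powr') auto
    then have "((\<lambda>z. cmod (z - a) powr x) \<longlongrightarrow> 0) (at a)" by simp
    from tendsto_unique[OF _ this that(1)] that(2) show False by simp
  qed
  have "((\<lambda>z. inverse (cmod (z - a) powr e)) \<longlongrightarrow> inverse c) (at a)" using assms by (intro tendsto_intros)
  then have "((\<lambda>z. cmod (z - a) powr (- e)) \<longlongrightarrow> inverse c) (at a)" by (simp add: powr_minus)
  from pos[OF this] pos[OF assms] assms(2) show ?thesis by auto
qed

text \<open>Dividing the two normalised functions leaves a power of |z - a| with a positive limit,
  so its exponent is 0.\<close>

lemma order_unique:
  fixes a :: complex and f :: "complex \<Rightarrow> real"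
  assumes "((\<lambda>z. f z / cmod (z - a) powr x) \<longlongrightarrow> C) (at a)" "C > 0"
    "((\<lambda>z. f z / cmod (z - a) powr y) \<longlongrightarrow> D) (at a)" "D > 0"
  shows "x = y"
proof -
  have lim: "((\<lambda>z. (f z / cmod (z - a) powr y) / (f z / cmod (z - a) powr x)) \<longlongrightarrow> D / C) (at a)"
    using assms by (intro tendsto_intros) auto
  have "\<forall>\<^sub>F z in at a. f z / cmod (z - a) powr x > 0" using assms(1,2) by (rule order_tendstoD)
  then have "\<forall>\<^sub>F z in at a. (f z / cmod (z - a) powr y) / (f z / cmod (z - a) powr x) = cmod (z - a) powr (x - y)"
  proof eventually_elim
    case (elim z)
    then have "f z \<noteq> 0" by auto
    then show ?case by (simp add: powr_diff)
  qed
  from Lim_transform_eventually[OF lim this] have "x - y = 0"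
    using assms(2,4) by (intro cmod_powr_limit[of a "x - y" "D / C"]) auto
  then show ?thesis by simp
qed

text \<open>A regular metric has order 0 in the sense of \<open>order_unique\<close>. Hence the
  curvature condition in \<open>Met_S2\<close> concerns only points other than 0, 1 and
  infinity.\<close>

lemma not_regular_if_conical:
  assumes "conical_at \<sigma> p \<beta>" "\<beta> \<noteq> 0"
  shows "\<not> regular_at \<sigma> p"
proof
  assume "regular_at \<sigma> p"
  then obtain U where U: "open U" "coord p \<in> U" "smooth_on (coeff_near \<sigma> p) U" "coeff_near \<sigma> p (coord p) > 0"
    by (auto simp: regular_at_def)
  have "C_k_on 0 (coeff_near \<sigma> p) U" using U(3) unfolding smooth_on_def by blast
  then have "isCont (coeff_near \<sigma> p) (coord p)" using U(1,2) continuous_on_eq_continuous_at by auto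
  then have "((\<lambda>z. coeff_near \<sigma> p z / cmod (z - coord p) powr 0) \<longlongrightarrow> coeff_near \<sigma> p (coord p)) (at (coord p))"
    unfolding isCont_def
    by (rule Lim_transform_eventually) (auto simp: eventually_at_filter)
  moreover obtain C where "C > 0" "((\<lambda>z. coeff_near \<sigma> p z / cmod (z - coord p) powr (2 * \<beta>)) \<longlongrightarrow> C) (at (coord p))"
    using assms(1) by (auto simp: conical_at_iff)
  ultimately have "0 = 2 * \<beta>" using U(4) by (intro order_unique)
  then show False using assms(2) by simp
qed

text \<open>For \<nu> > 0 the term with \<open>P\<close> dies out at 0, where neither
  \<open>R\<close> nor the Wronskian vanishes; \<nu> < 0 reduces to this by exchanging the
  pair.\<close>

lemma met_limit_0:
  assumes "normal_pair \<nu> m P R"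
  obtains C where "C > 0" "((\<lambda>z. met \<nu> P R z / cmod (z - 0) powr (2 * (\<bar>\<nu>\<bar> - 1))) \<longlongrightarrow> C) (at 0)"
proof -
  have pos: "\<exists>C>0. ((\<lambda>z. met \<nu> P R z / cmod z powr (2 * (\<nu> - 1))) \<longlongrightarrow> C) (at 0)"
    if np: "normal_pair \<nu> m P R" and "\<nu> > 0" for \<nu> P R
  proof (intro exI conjI)
    obtain c where c: "c \<noteq> 0" "wr \<nu> P R = smult c ([:-1, 1:] ^ m)" using np by (auto simp: normal_pair_def)
    let ?C = "4 * (cmod (poly (wr \<nu> P R) 0))\<^sup>2 / ((cmod (poly R 0))\<^sup>2 + 0 * (cmod (poly P 0))\<^sup>2)\<^sup>2"
    have R0: "poly R 0 \<noteq> 0" using normal_pairD[OF np] by simp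
    then show "?C > 0" using c by simp
    have "((\<lambda>z::complex. cmod z) \<longlongrightarrow> 0) (at 0)" by (intro tendsto_eq_intros) auto
    then have "((\<lambda>z::complex. cmod z powr (2 * \<nu>)) \<longlongrightarrow> 0 powr (2 * \<nu>)) (at 0)"
      using \<open>\<nu> > 0\<close> by (intro tendsto_powr') auto
    then have p: "((\<lambda>z::complex. cmod z powr (2 * \<nu>)) \<longlongrightarrow> 0) (at 0)" by simp
    have lim: "((\<lambda>z. 4 * (cmod (poly (wr \<nu> P R) z))\<^sup>2 / ((cmod (poly R z))\<^sup>2 + cmod z powr (2 * \<nu>) * (cmod (poly P z))\<^sup>2)\<^sup>2) \<longlongrightarrow> ?C) (at 0)"
      by (intro tendsto_intros p) (use R0 in auto)
    show "((\<lambda>z. met \<nu> P R z / cmod z powr (2 * (\<nu> - 1))) \<longlongrightarrow> ?C) (at 0)"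
    proof (rule Lim_transform_eventually[OF lim])
      have "\<forall>\<^sub>F z in at 0. z \<noteq> (0::complex)" by (simp add: eventually_at_filter)
      then show "\<forall>\<^sub>F z in at 0. 4 * (cmod (poly (wr \<nu> P R) z))\<^sup>2 / ((cmod (poly R z))\<^sup>2 + cmod z powr (2 * \<nu>) * (cmod (poly P z))\<^sup>2)\<^sup>2
         = met \<nu> P R z / cmod z powr (2 * (\<nu> - 1))"
        by eventually_elim (simp add: met_def)
    qed
  qed
  show ?thesis
  proof (cases "\<nu> > 0")
    case True
    then show ?thesis using pos[OF assms] that by auto
  next
    case False
    moreover have "\<nu> \<noteq> 0" using assms by (auto simp: normal_pair_def)
    ultimately have neg: "- \<nu> > 0" "\<bar>\<nu>\<bar> = - \<nu>" by auto
    obtain C where C: "C > 0" "((\<lambda>z. met (- \<nu>) R P z / cmod z powr (2 * (- \<nu> - 1))) \<longlongrightarrow> C) (at 0)"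
      using pos[OF normal_pair_swap[OF assms] neg(1)] by blast
    have "((\<lambda>z. met \<nu> P R z / cmod z powr (2 * (- \<nu> - 1))) \<longlongrightarrow> C) (at 0)"
      by (rule Lim_transform_eventually[OF C(2)]) (simp add: eventually_at_filter met_swap)
    then show ?thesis using that[of C] C(1) unfolding neg(2) by simp
  qed
qed

text \<open>The Wronskian supplies the zero of order m, and R(1) \<noteq> 0 keeps the denominator
  positive.\<close>

lemma met_limit_1:
  assumes "normal_pair \<nu> m P R"
  obtains C where "C > 0" "((\<lambda>z. met \<nu> P R z / cmod (z - 1) powr (2 * real m)) \<longlongrightarrow> C) (at 1)"
proof -
  obtain c where c: "c \<noteq> 0" "wr \<nu> P R = smult c ([:-1, 1:] ^ m)" using assms by (auto simp: normal_pair_def)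
  let ?C = "4 * cmod 1 powr (2 * \<nu> - 2) * (cmod c)\<^sup>2 / ((cmod (poly R 1))\<^sup>2 + cmod 1 powr (2 * \<nu>) * (cmod (poly P 1))\<^sup>2)\<^sup>2"
  have pos: "(cmod (poly R 1))\<^sup>2 + cmod 1 powr (2 * \<nu>) * (cmod (poly P 1))\<^sup>2 > 0"
    using normal_pair_root_1[OF assms] by (simp add: add_pos_nonneg)
  have lim: "((\<lambda>z. 4 * cmod z powr (2 * \<nu> - 2) * (cmod c)\<^sup>2 / ((cmod (poly R z))\<^sup>2 + cmod z powr (2 * \<nu>) * (cmod (poly P z))\<^sup>2)\<^sup>2) \<longlongrightarrow> ?C) (at 1)"
    by (intro tendsto_intros) (use pos in auto)
  show ?thesis
  proof (rule that)
    show "?C > 0" using c(1) pos by (intro divide_pos_pos mult_pos_pos zero_less_power) auto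
    show "((\<lambda>z. met \<nu> P R z / cmod (z - 1) powr (2 * real m)) \<longlongrightarrow> ?C) (at 1)"
    proof (rule Lim_transform_eventually[OF lim])
      have "\<forall>\<^sub>F z in at 1. z \<noteq> (1::complex)" by (simp add: eventually_at_filter)
      then show "\<forall>\<^sub>F z in at 1. 4 * cmod z powr (2 * \<nu> - 2) * (cmod c)\<^sup>2 / ((cmod (poly R z))\<^sup>2 + cmod z powr (2 * \<nu>) * (cmod (poly P z))\<^sup>2)\<^sup>2
        = met \<nu> P R z / cmod (z - 1) powr (2 * real m)"
      proof eventually_elim
        case (elim z)
        have "cmod (z - 1) powr (2 * real m) = (cmod (z - 1) ^ m)\<^sup>2"
        proof -
          have "cmod (z - 1) powr (2 * real m) = cmod (z - 1) powr real (m * 2)" by (simp add: mult.commute)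
          also have "\<dots> = cmod (z - 1) ^ (m * 2)" using elim by (intro powr_realpow) simp
          finally show ?thesis by (simp add: power_mult)
        qed
        then show ?case using elim
          unfolding met_def c(2) by (simp add: norm_mult norm_power power_mult_distrib)
      qed
    qed
  qed
qed

text \<open>In the coordinate w = 1/z polynomials become powers of w times their reflections, which
  do not vanish at 0. If the exponent at infinity is positive, the term with \<open>P\<close>
  dominates the denominator; otherwise the pair is exchanged.\<close>

lemma met_limit_infinity:
  assumes "normal_pair \<nu> m P R"
  obtains C where "C > 0" "((\<lambda>w. met \<nu> P R (1 / w) / cmod w ^ 4 /
    cmod (w - 0) powr (2 * (\<bar>\<nu> + real (degree P) - real (degree R)\<bar> - 1))) \<longlongrightarrow> C) (at 0)"
proof -
  have pos: "\<exists>C>0. ((\<lambda>w. met \<nu> P R (1 / w) / cmod w ^ 4 / cmod w powr (2 * (\<kappa> - 1))) \<longlongrightarrow> C) (at 0)"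
    if np: "normal_pair \<nu> m P R" and \<kappa>: "\<kappa> = \<nu> + real (degree P) - real (degree R)" "\<kappa> > 0" for \<nu> P R \<kappa>
  proof -
    obtain c where c: "\<nu> \<notin> \<int>" "c \<noteq> 0" "wr \<nu> P R = smult c ([:-1, 1:] ^ m)" using np by (auto simp: normal_pair_def)
    note nz = normal_pairD[OF np]
    have dW: "degree (wr \<nu> P R) = degree P + degree R" "wr \<nu> P R \<noteq> 0" using degree_wr[OF c(1) nz(1,2)] by auto
    define A where "A w = cmod (poly (reflect_poly P) w)" for w
    define B where "B w = cmod (poly (reflect_poly R) w)" for w
    define W where "W w = cmod (poly (reflect_poly (wr \<nu> P R)) w)" for w
    let ?C = "4 * (W 0)\<^sup>2 / ((A 0)\<^sup>2 + 0 * (B 0)\<^sup>2)\<^sup>2"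
    have A0: "A 0 \<noteq> 0" "W 0 \<noteq> 0"
      unfolding A_def W_def using nz(1) dW(2) by (simp_all only: norm_eq_zero reflect_poly_at_0_eq_0_iff not_False_eq_True)
    have "((\<lambda>z::complex. cmod z) \<longlongrightarrow> 0) (at 0)" by (intro tendsto_eq_intros) auto
    then have "((\<lambda>z::complex. cmod z powr (2 * \<kappa>)) \<longlongrightarrow> 0 powr (2 * \<kappa>)) (at 0)"
      using \<kappa>(2) by (intro tendsto_powr') auto
    then have p: "((\<lambda>z::complex. cmod z powr (2 * \<kappa>)) \<longlongrightarrow> 0) (at 0)" by simp
    have lim: "((\<lambda>w. 4 * (W w)\<^sup>2 / ((A w)\<^sup>2 + cmod w powr (2 * \<kappa>) * (B w)\<^sup>2)\<^sup>2) \<longlongrightarrow> ?C) (at 0)"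
      unfolding A_def B_def W_def by (intro tendsto_intros p) (use A0 in \<open>auto simp: A_def\<close>)
    have "((\<lambda>w. met \<nu> P R (1 / w) / cmod w ^ 4 / cmod w powr (2 * (\<kappa> - 1))) \<longlongrightarrow> ?C) (at 0)"
    proof (rule Lim_transform_eventually[OF lim])
      have "\<forall>\<^sub>F w in at 0. w \<noteq> (0::complex)" by (simp add: eventually_at_filter)
      then show "\<forall>\<^sub>F w in at 0. 4 * (W w)\<^sup>2 / ((A w)\<^sup>2 + cmod w powr (2 * \<kappa>) * (B w)\<^sup>2)\<^sup>2
         = met \<nu> P R (1 / w) / cmod w ^ 4 / cmod w powr (2 * (\<kappa> - 1))"
      proof eventually_elim
        case (elim w)
        define r where "r = cmod w"
        have r: "r > 0" using elim by (simp add: r_def)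
        have pol: "(cmod (poly p (1 / w)))\<^sup>2 = (cmod (poly (reflect_poly p) w))\<^sup>2 * r powr (- 2 * real (degree p))" for p
        proof -
          have "poly (reflect_poly p) w = w ^ degree p * poly p (1 / w)"
            using poly_reflect_poly_nz[OF elim, of p] by (simp add: inverse_eq_divide)
          then have "(cmod (poly (reflect_poly p) w))\<^sup>2 = (r ^ degree p)\<^sup>2 * (cmod (poly p (1 / w)))\<^sup>2"
            by (simp add: norm_mult norm_power power_mult_distrib r_def)
          moreover have "(r ^ degree p)\<^sup>2 * r powr (- 2 * real (degree p)) = 1"
          proof -
            have "r powr real (degree p * 2) = r ^ (degree p * 2)" using r by (intro powr_realpow)
            then have "(r ^ degree p)\<^sup>2 = r powr (2 * real (degree p))" by (simp add: power_mult mult.commute)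
            then show ?thesis using r by (simp add: powr_add[symmetric])
          qed
          ultimately show ?thesis by (simp add: mult_ac)
        qed
        have inv: "cmod (1 / w) powr x = r powr (- x)" for x
          using r by (simp add: norm_divide r_def powr_divide powr_minus_divide)
        have den: "(B w)\<^sup>2 * r powr (- 2 * real (degree R)) + r powr (- (2 * \<nu>)) * ((A w)\<^sup>2 * r powr (- 2 * real (degree P)))
          = r powr (- (2 * \<nu>) - 2 * real (degree P)) * ((A w)\<^sup>2 + r powr (2 * \<kappa>) * (B w)\<^sup>2)"
        proof -
          have "r powr (- 2 * real (degree R)) = r powr (- (2 * \<nu>) - 2 * real (degree P)) * r powr (2 * \<kappa>)"
            unfolding powr_add[symmetric] \<kappa>(1) by (simp add: algebra_simps)
          moreover have "r powr (- (2 * \<nu>)) * r powr (- 2 * real (degree P)) = r powr (- (2 * \<nu>) - 2 * real (degree P))"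
            unfolding powr_add[symmetric] by simp
          ultimately show ?thesis by (simp add: algebra_simps)
        qed
        have "met \<nu> P R (1 / w) = 4 * r powr (- (2 * \<nu> - 2)) * ((W w)\<^sup>2 * r powr (- 2 * real (degree P + degree R)))
           / (r powr (- (2 * \<nu>) - 2 * real (degree P)) * ((A w)\<^sup>2 + r powr (2 * \<kappa>) * (B w)\<^sup>2))\<^sup>2"
          unfolding met_def inv pol dW(1) A_def[symmetric] B_def[symmetric] W_def[symmetric] den ..
        also have "\<dots> = (r powr (- (2 * \<nu> - 2)) * r powr (- 2 * real (degree P + degree R)) / (r powr (- (2 * \<nu>) - 2 * real (degree P)))\<^sup>2)
           * (4 * (W w)\<^sup>2 / ((A w)\<^sup>2 + r powr (2 * \<kappa>) * (B w)\<^sup>2)\<^sup>2)"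
          by (simp add: power_mult_distrib)
        also have "r powr (- (2 * \<nu> - 2)) * r powr (- 2 * real (degree P + degree R)) / (r powr (- (2 * \<nu>) - 2 * real (degree P)))\<^sup>2
           = r powr 4 * r powr (2 * (\<kappa> - 1))"
          unfolding power2_eq_square powr_add[symmetric] powr_diff[symmetric] \<kappa>(1) by (simp add: algebra_simps)
        also have "r powr 4 = r ^ 4" using r by simp
        finally show ?case using r by (simp add: r_def[symmetric])
      qed
    qed
    moreover have "?C > 0" using A0 by simp
    ultimately show ?thesis by blast
  qed
  define \<kappa> where "\<kappa> = \<nu> + real (degree P) - real (degree R)"
  have nu: "\<nu> \<notin> \<int>" using assms by (simp add: normal_pair_def)
  show ?thesis
  proof (cases "\<kappa> > 0")
    case True
    then show ?thesis using pos[OF assms \<kappa>_def True] that unfolding \<kappa>_def[symmetric] by auto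
  next
    case False
    moreover have "\<kappa> \<noteq> 0" using Ints_combine[OF nu] by (simp add: \<kappa>_def)
    ultimately have neg: "- \<kappa> > 0" "\<bar>\<kappa>\<bar> = - \<kappa>" by auto
    have "- \<kappa> = - \<nu> + real (degree R) - real (degree P)" by (simp add: \<kappa>_def)
    then obtain C where C: "C > 0" "((\<lambda>w. met (- \<nu>) R P (1 / w) / cmod w ^ 4 / cmod w powr (2 * (- \<kappa> - 1))) \<longlongrightarrow> C) (at 0)"
      using pos[OF normal_pair_swap[OF assms] _ neg(1)] by blast
    have "((\<lambda>w. met \<nu> P R (1 / w) / cmod w ^ 4 / cmod w powr (2 * (- \<kappa> - 1))) \<longlongrightarrow> C) (at 0)"
      by (rule Lim_transform_eventually[OF C(2)]) (simp add: eventually_at_filter met_swap)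
    then show ?thesis using that[of C] C(1) unfolding \<kappa>_def[symmetric] neg(2) by simp
  qed
qed

section \<open>Metrics with three conical points\<close>

text \<open>Collects the pointwise condition \<open>regular_at\<close> into smoothness on the whole
  doubly punctured plane.\<close>

lemma C_k_on_local:
  assumes "\<And>z. z \<in> U \<Longrightarrow> \<exists>V. open V \<and> z \<in> V \<and> C_k_on k f V"
  shows "C_k_on k f U"
  using assms
proof (induction k arbitrary: f)
  case 0
  have "isCont f z" if z: "z \<in> U" for z
  proof -
    obtain V where "open V" "z \<in> V" "C_k_on 0 f V" using 0[OF z] by blast
    then show ?thesis using continuous_on_eq_continuous_at by auto
  qed
  then show ?case by (auto intro: continuous_at_imp_continuous_on)
next
  case (Suc k)
  have "f differentiable (at z)" if z: "z \<in> U" for z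
  proof -
    obtain V where "z \<in> V" "C_k_on (Suc k) f V" using Suc.prems[OF z] by blast
    then show ?thesis by simp
  qed
  moreover have "C_k_on k (\<lambda>z. frechet_derivative f (at z) v) U" for v
  proof (rule Suc.IH)
    fix z assume z: "z \<in> U"
    obtain V where "open V" "z \<in> V" "C_k_on (Suc k) f V" using Suc.prems[OF z] by blast
    then show "\<exists>V. open V \<and> z \<in> V \<and> C_k_on k (\<lambda>z. frechet_derivative f (at z) v) V"
      using C_k_on_SucE(2) by blast
  qed
  ultimately show ?case by simp
qed

lemma eventually_avoids_0_1: "\<forall>\<^sub>F z in at a. z \<noteq> 0 \<and> z \<noteq> (1::complex)"
proof -
  have "finite ({0, 1} - {a})" by simp
  then have "open (- ({0, 1} - {a}))" by (intro open_Compl finite_imp_closed)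
  then have "\<forall>\<^sub>F z in at a. z \<in> - ({0, 1} - {a}) - {a}" by (rule eventually_at_in_open) simp
  then show ?thesis by (rule eventually_mono) auto
qed

lemma coeff_near_simps: "coeff_near \<sigma> (Some a) = (\<lambda>z. \<sigma> (Some z))" "coord (Some a) = a" "coord None = 0"
  by (simp_all add: coeff_near_def coord_def)

lemma divisor_01inf_simps:
  "divisor_01inf x y w (Some 0) = x" "divisor_01inf x y w (Some 1) = y" "divisor_01inf x y w None = w"
  "z \<noteq> 0 \<Longrightarrow> z \<noteq> 1 \<Longrightarrow> divisor_01inf x y w (Some z) = 0"
  by (simp_all add: divisor_01inf_def)

lemma has_divisor_01inf_iff:
  assumes "x \<noteq> 0" "y \<noteq> 0" "w \<noteq> 0"
  shows "has_divisor \<sigma> (divisor_01inf x y w) \<longleftrightarrow>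
    conical_at \<sigma> (Some 0) x \<and> conical_at \<sigma> (Some 1) y \<and> conical_at \<sigma> None w \<and>
    (\<forall>z. z \<noteq> 0 \<longrightarrow> z \<noteq> 1 \<longrightarrow> regular_at \<sigma> (Some z))"
proof -
  have "{p. divisor_01inf x y w p \<noteq> 0} \<subseteq> {Some 0, Some 1, None}" by (auto simp: divisor_01inf_def split: if_splits)
  then have fin: "finite {p. divisor_01inf x y w p \<noteq> 0}" by (rule finite_subset) simp
  have all: "(\<forall>p::sphere. Q p) \<longleftrightarrow> Q (Some 0) \<and> Q (Some 1) \<and> Q None \<and> (\<forall>z. z \<noteq> 0 \<longrightarrow> z \<noteq> 1 \<longrightarrow> Q (Some z))" for Q
    by (metis option.exhaust)
  show ?thesis
    unfolding has_divisor_def all using fin assms by (simp add: divisor_01inf_simps)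
qed

context
  fixes \<beta>1 \<beta>3 :: real and \<beta>2 :: nat
  assumes \<beta>: "\<beta>1 > -1" "\<beta>1 \<notin> \<int>" "\<beta>3 > -1" "\<beta>3 \<notin> \<int>" "\<beta>2 > 0"
begin

abbreviation (input) div3 :: "sphere \<Rightarrow> real" where "div3 \<equiv> divisor_01inf \<beta>1 (real \<beta>2) \<beta>3"

text \<open>By the three limits above, these conditions say that the orders are \<beta>1, \<beta>2
  and \<beta>3. Absolute values occur because g and 1/g give the same metric.\<close>

definition adapted :: "real \<Rightarrow> complex poly \<Rightarrow> complex poly \<Rightarrow> bool" where
  "adapted \<nu> P R \<longleftrightarrow> normal_pair \<nu> \<beta>2 P R \<and> \<bar>\<nu>\<bar> = \<beta>1 + 1 \<and>
     \<bar>\<nu> + real (degree P) - real (degree R)\<bar> = \<beta>3 + 1"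

lemma orders_nonzero: "\<beta>1 \<noteq> 0" "real \<beta>2 \<noteq> 0" "\<beta>3 \<noteq> 0"
  using \<beta> by auto

lemma adapted_swap: "adapted \<nu> P R \<Longrightarrow> adapted (- \<nu>) R P"
  unfolding adapted_def using normal_pair_swap by auto

lemma adapted_smult: "adapted \<nu> P R \<Longrightarrow> c \<noteq> 0 \<Longrightarrow> adapted \<nu> (smult c P) R"
  unfolding adapted_def using normal_pair_smult by auto

lemma adapted_metric:
  assumes ad: "adapted \<nu> P R" and rep: "given_by \<sigma> \<nu> P R"
  shows "\<sigma> \<in> Met_S2" "has_divisor \<sigma> div3"
proof -
  have np: "normal_pair \<nu> \<beta>2 P R" and nu: "\<bar>\<nu>\<bar> - 1 = \<beta>1"
    and kap: "\<bar>\<nu> + real (degree P) - real (degree R)\<bar> - 1 = \<beta>3"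
    using ad by (auto simp: adapted_def)
  have reg: "regular_at \<sigma> (Some z0) \<and> curvature_at \<sigma> (Some z0) = 1" if z0: "z0 \<noteq> 0" "z0 \<noteq> 1" for z0
  proof -
    obtain U where U: "open U" "z0 \<in> U" "U \<subseteq> - {0, 1}" "smooth_on (met \<nu> P R) U"
      "\<And>z. z \<in> U \<Longrightarrow> met \<nu> P R z > 0" "\<And>z. z \<in> U \<Longrightarrow> gauss_curvature (met \<nu> P R) z = 1"
      using met_regular[OF np z0] by blast
    have eq: "met \<nu> P R z = \<sigma> (Some z)" if "z \<in> U" for z
      using rep U(3) that by (auto simp: given_by_def)
    have "smooth_on (\<lambda>z. \<sigma> (Some z)) U" by (rule smooth_on_cong[OF U(1) eq U(4)])
    then have "regular_at \<sigma> (Some z0)"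
      unfolding regular_at_def coeff_near_simps using U(1,2,5) eq by (intro exI[of _ U]) auto
    moreover have "gauss_curvature (\<lambda>z. \<sigma> (Some z)) z0 = 1"
      using gauss_curvature_cong[OF U(1,2) eq] U(6)[OF U(2)] by simp
    ultimately show ?thesis by (simp add: curvature_at_def coeff_near_simps)
  qed
  have c0: "conical_at \<sigma> (Some 0) \<beta>1"
  proof -
    obtain C where C: "C > 0" "((\<lambda>z. met \<nu> P R z / cmod (z - 0) powr (2 * \<beta>1)) \<longlongrightarrow> C) (at 0)"
      using met_limit_0[OF np] unfolding nu by blast
    have "((\<lambda>z. \<sigma> (Some z) / cmod (z - 0) powr (2 * \<beta>1)) \<longlongrightarrow> C) (at 0)"
      by (rule Lim_transform_eventually[OF C(2)], rule eventually_mono[OF eventually_avoids_0_1]) (use rep in \<open>simp add: given_by_def\<close>)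
    then show ?thesis unfolding conical_at_iff coeff_near_simps using C(1) \<beta> by blast
  qed
  have c1: "conical_at \<sigma> (Some 1) (real \<beta>2)"
  proof -
    obtain C where C: "C > 0" "((\<lambda>z. met \<nu> P R z / cmod (z - 1) powr (2 * real \<beta>2)) \<longlongrightarrow> C) (at 1)"
      using met_limit_1[OF np] by blast
    have "((\<lambda>z. \<sigma> (Some z) / cmod (z - 1) powr (2 * real \<beta>2)) \<longlongrightarrow> C) (at 1)"
      by (rule Lim_transform_eventually[OF C(2)], rule eventually_mono[OF eventually_avoids_0_1]) (use rep in \<open>simp add: given_by_def\<close>)
    moreover have "real \<beta>2 > -1" by simp
    ultimately show ?thesis unfolding conical_at_iff coeff_near_simps using C(1) by blast
  qed
  have c3: "conical_at \<sigma> None \<beta>3"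
  proof -
    obtain C where C: "C > 0" "((\<lambda>w. met \<nu> P R (1 / w) / cmod w ^ 4 / cmod (w - 0) powr (2 * \<beta>3)) \<longlongrightarrow> C) (at 0)"
      using met_limit_infinity[OF np] unfolding kap by blast
    have "((\<lambda>w. coeff_near \<sigma> None w / cmod (w - 0) powr (2 * \<beta>3)) \<longlongrightarrow> C) (at 0)"
      by (rule Lim_transform_eventually[OF C(2)], rule eventually_mono[OF eventually_avoids_0_1])
        (use rep in \<open>auto simp: given_by_def coeff_near_def\<close>)
    then show ?thesis unfolding conical_at_iff coeff_near_simps using C(1) \<beta> by blast
  qed
  show div: "has_divisor \<sigma> div3"
    unfolding has_divisor_01inf_iff[OF orders_nonzero] using c0 c1 c3 reg by blast
  have "curvature_at \<sigma> p = 1" if p: "regular_at \<sigma> p" for p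
  proof -
    have "p \<noteq> Some 0" "p \<noteq> Some 1" "p \<noteq> None"
      using p not_regular_if_conical[OF c0 orders_nonzero(1)] not_regular_if_conical[OF c1 orders_nonzero(2)]
        not_regular_if_conical[OF c3 orders_nonzero(3)] by metis+
    then obtain z where "p = Some z" "z \<noteq> 0" "z \<noteq> 1" by (metis option.exhaust)
    then show ?thesis using reg by blast
  qed
  then show "\<sigma> \<in> Met_S2" using div by (auto simp: Met_S2_def)
qed

lemma divisor_limits:
  assumes "has_divisor \<sigma> div3"
  obtains C0 C1 C3 where "C0 > 0" "((\<lambda>z. \<sigma> (Some z) / cmod (z - 0) powr (2 * \<beta>1)) \<longlongrightarrow> C0) (at 0)"
    "C1 > 0" "((\<lambda>z. \<sigma> (Some z) / cmod (z - 1) powr (2 * real \<beta>2)) \<longlongrightarrow> C1) (at 1)"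
    "C3 > 0" "((\<lambda>w. \<sigma> (Some (1 / w)) / cmod w ^ 4 / cmod (w - 0) powr (2 * \<beta>3)) \<longlongrightarrow> C3) (at 0)"
proof -
  have "conical_at \<sigma> (Some 0) \<beta>1" "conical_at \<sigma> (Some 1) (real \<beta>2)" "conical_at \<sigma> None \<beta>3"
    using assms unfolding has_divisor_01inf_iff[OF orders_nonzero] by blast+
  then obtain C0 C1 C3 where C: "C0 > 0" "((\<lambda>z. \<sigma> (Some z) / cmod (z - 0) powr (2 * \<beta>1)) \<longlongrightarrow> C0) (at 0)"
    "C1 > 0" "((\<lambda>z. \<sigma> (Some z) / cmod (z - 1) powr (2 * real \<beta>2)) \<longlongrightarrow> C1) (at 1)"
    "C3 > 0" "((\<lambda>w. coeff_near \<sigma> None w / cmod (w - 0) powr (2 * \<beta>3)) \<longlongrightarrow> C3) (at 0)"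
    unfolding conical_at_iff coeff_near_simps by blast
  have "((\<lambda>w. \<sigma> (Some (1 / w)) / cmod w ^ 4 / cmod (w - 0) powr (2 * \<beta>3)) \<longlongrightarrow> C3) (at 0)"
    by (rule Lim_transform_eventually[OF C(6)]) (auto simp: eventually_at_filter coeff_near_def)
  then show ?thesis using that C by blast
qed

lemma divisor_positive:
  assumes "has_divisor \<sigma> div3" "z \<noteq> 0" "z \<noteq> 1"
  shows "\<sigma> (Some z) > 0"
proof -
  have "regular_at \<sigma> (Some z)" using assms unfolding has_divisor_01inf_iff[OF orders_nonzero] by blast
  then show ?thesis by (auto simp: regular_at_def coeff_near_simps)
qed

text \<open>In the density of the developing pair the modulus of the prefactor cancels between the
  Wronskian and the norm, which leaves \<open>\<rho>\<close>. Positivity of the norm excludes common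
  zeros.\<close>

lemma metric_given_by:
  assumes met: "\<sigma> \<in> Met_S2" and div: "has_divisor \<sigma> div3"
  obtains \<alpha> p q where "\<alpha> \<notin> \<int>" "coprime p q" "given_by \<sigma> \<alpha> p q"
proof -
  define \<rho> where "\<rho> z = \<sigma> (Some z)" for z
  have pos: "\<rho> z > 0" if "z \<in> - {0, 1}" for z using divisor_positive[OF div] that by (simp add: \<rho>_def)
  have reg: "regular_at \<sigma> (Some z)" if "z \<in> - {0, 1}" for z
    using div that unfolding has_divisor_01inf_iff[OF orders_nonzero] by auto
  have "smooth_on \<rho> (- {0, 1})"
    unfolding smooth_on_def
  proof (intro allI C_k_on_local)
    fix k and z :: complex assume "z \<in> - {0, 1}"
    from reg[OF this] show "\<exists>V. open V \<and> z \<in> V \<and> C_k_on k \<rho> V"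
      unfolding regular_at_def coeff_near_simps smooth_on_def \<rho>_def[abs_def] by blast
  qed
  moreover have "gauss_curvature \<rho> z = 1" if "z \<in> - {0, 1}" for z
    using met reg[OF that] unfolding Met_S2_def curvature_at_def \<rho>_def[abs_def]
    by (auto simp: coeff_near_simps dest!: spec[of _ "Some z"])
  moreover have "open (- {0, 1 :: complex})" by (intro open_Compl finite_imp_closed) auto
  ultimately obtain a b q where data: "liouville_data \<rho> (- {0, 1}) a b q"
    using liouville_data_exists[of "- {0, 1}" \<rho>] pos by blast
  obtain C0 C1 C3 where C: "C0 > 0" "((\<lambda>z. \<sigma> (Some z) / cmod (z - 0) powr (2 * \<beta>1)) \<longlongrightarrow> C0) (at 0)"
    "C1 > 0" "((\<lambda>z. \<sigma> (Some z) / cmod (z - 1) powr (2 * real \<beta>2)) \<longlongrightarrow> C1) (at 1)"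
    "C3 > 0" "((\<lambda>w. \<sigma> (Some (1 / w)) / cmod w ^ 4 / cmod (w - 0) powr (2 * \<beta>3)) \<longlongrightarrow> C3) (at 0)"
    by (rule divisor_limits[OF div])
  obtain \<alpha> P R where \<alpha>: "\<alpha> \<notin> \<int>" "poly R 0 \<noteq> 0" "poly P 1 \<noteq> 0 \<or> poly R 1 \<noteq> 0"
    and norm: "\<And>z. z \<noteq> 0 \<Longrightarrow> z \<noteq> 1 \<Longrightarrow> cmod z powr (2 * \<alpha>) * (cmod (poly P z))\<^sup>2 + (cmod (poly R z))\<^sup>2
       = cmod z powr \<beta>1 * cmod (z - 1) powr real \<beta>2 * (2 / sqrt (\<rho> z))"
    and wron: "\<And>z. z \<noteq> 0 \<Longrightarrow> z \<noteq> 1 \<Longrightarrow> cmod z powr (\<alpha> - 1) * cmod (poly (wr \<alpha> P R) z)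
      = cmod z powr \<beta>1 * cmod (z - 1) powr real \<beta>2"
  proof (rule developing_pair_exists[OF data, of \<beta>1 C0 \<beta>2 C1 \<beta>3 C3])
    show "((\<lambda>z. \<rho> z / cmod z powr (2 * \<beta>1)) \<longlongrightarrow> C0) (at 0)" using C(2) by (simp add: \<rho>_def)
    show "((\<lambda>z. \<rho> z / cmod (z - 1) powr (2 * real \<beta>2)) \<longlongrightarrow> C1) (at 1)" using C(4) by (simp add: \<rho>_def)
    show "((\<lambda>w. \<rho> (1 / w) / cmod w ^ 4 / cmod w powr (2 * \<beta>3)) \<longlongrightarrow> C3) (at 0)" using C(6) by (simp add: \<rho>_def)
  qed (use C(1,3,5) \<beta>(2) in auto)
  have "coprime P R"
    unfolding coprime_complex_poly_iff
  proof
    assume "\<exists>z. poly P z = 0 \<and> poly R z = 0"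
    then obtain z where z: "poly P z = 0" "poly R z = 0" by blast
    then have z01: "z \<noteq> 0" "z \<noteq> 1" using \<alpha>(2,3) by auto
    have "cmod z powr \<beta>1 * cmod (z - 1) powr real \<beta>2 * (2 / sqrt (\<rho> z)) > 0"
      using z01 pos[of z] by (intro mult_pos_pos divide_pos_pos) auto
    then show False unfolding norm[OF z01, symmetric] using z by simp
  qed
  moreover have "given_by \<sigma> \<alpha> P R"
    unfolding given_by_def
  proof (intro allI impI)
    fix z :: complex assume z: "z \<noteq> 0" "z \<noteq> 1"
    define w where "w = cmod z powr \<beta>1 * cmod (z - 1) powr real \<beta>2"
    have w: "w > 0" using z by (simp add: w_def)
    have \<rho>: "\<rho> z > 0" using pos z by simp
    have "cmod z powr (2 * \<alpha> - 2) = (cmod z powr (\<alpha> - 1))\<^sup>2"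
      by (simp add: power2_eq_square powr_add[symmetric])
    then have "met \<alpha> P R z = 4 * (cmod z powr (\<alpha> - 1) * cmod (poly (wr \<alpha> P R) z))\<^sup>2 /
       (cmod z powr (2 * \<alpha>) * (cmod (poly P z))\<^sup>2 + (cmod (poly R z))\<^sup>2)\<^sup>2"
      unfolding met_def by (simp add: power_mult_distrib add.commute)
    also have "\<dots> = 4 * w\<^sup>2 / (w * (2 / sqrt (\<rho> z)))\<^sup>2"
      unfolding norm[OF z] wron[OF z] w_def ..
    also have "\<dots> = \<rho> z" using w \<rho> by (simp add: power_mult_distrib power_divide)
    finally show "\<sigma> (Some z) = met \<alpha> P R z" by (simp add: \<rho>_def)
  qed
  ultimately show ?thesis using that \<alpha>(1) by blast
qed

text \<open>Powers of z dividing \<open>p\<close> or \<open>q\<close> are moved into the exponent.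
  The identity is kept for every factor \<open>t\<close>, so that the scaling of g survives the
  reduction.\<close>

lemma adapt:
  assumes div: "has_divisor \<sigma> div3" and rep: "given_by \<sigma> \<mu> p q" and \<mu>: "\<mu> \<notin> \<int>" and cop: "coprime p q"
  shows "\<exists>\<nu> P R. adapted \<nu> P R \<and>
    (\<forall>t z. z \<noteq> 0 \<longrightarrow> met \<mu> (smult t p) q z = met \<nu> (smult t P) R z)"
proof -
  have pos: "met \<mu> p q z > 0" if "z \<noteq> 0" "z \<noteq> 1" for z
    using divisor_positive[OF div that] rep that by (simp add: given_by_def)
  have wr_nz: "poly (wr \<mu> p q) z \<noteq> 0" if "z \<noteq> 0" "z \<noteq> 1" for z
    using pos[OF that] by (auto simp: met_def)
  have pq: "p \<noteq> 0" "q \<noteq> 0" using wr_nz[of 2] by (auto simp: wr_def)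
  obtain P where P: "p = [:0, 1:] ^ order 0 p * P" "\<not> [:0, 1:] dvd P" using order_decomp[OF pq(1), of 0] by auto
  obtain R where R: "q = [:0, 1:] ^ order 0 q * R" "\<not> [:0, 1:] dvd R" using order_decomp[OF pq(2), of 0] by auto
  define \<nu> where "\<nu> = \<mu> + real (order 0 p) - real (order 0 q)"
  have "\<nu> \<notin> \<int>"
  proof
    assume "\<nu> \<in> \<int>"
    then have "\<nu> - real (order 0 p) + real (order 0 q) \<in> \<int>" by (intro Ints_add Ints_diff) auto
    then show False using \<mu> by (simp add: \<nu>_def)
  qed
  have eq: "met \<mu> (smult t p) q z = met \<nu> (smult t P) R z" if "z \<noteq> 0" for t z
  proof -
    have "smult t p = [:0, 1:] ^ order 0 p * smult t P" by (subst P(1)) simp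
    then have "met \<mu> (smult t p) q z = met \<mu> ([:0, 1:] ^ order 0 p * smult t P) ([:0, 1:] ^ order 0 q * R) z"
      using R(1) by simp
    moreover have "\<mu> - real (order 0 q) + real (order 0 p) = \<nu>" by (simp add: \<nu>_def)
    ultimately show ?thesis by (simp only: met_shift_left[OF that] met_shift_right[OF that])
  qed
  have eq1: "met \<mu> p q z = met \<nu> P R z" if "z \<noteq> 0" for z using eq[OF that, of 1] by simp
  have PR0: "poly P 0 \<noteq> 0" "poly R 0 \<noteq> 0" using P(2) R(2) by (simp_all add: dvd_iff_poly_eq_0)
  have "coprime P R"
    unfolding coprime_complex_poly_iff
  proof
    assume "\<exists>z. poly P z = 0 \<and> poly R z = 0"
    then obtain z where z: "poly P z = 0" "poly R z = 0" by blast
    have "poly p z = 0" by (subst P(1)) (simp add: z)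
    moreover have "poly q z = 0" by (subst R(1)) (simp add: z)
    ultimately show False using cop coprime_complex_poly_iff by blast
  qed
  have W0: "poly (wr \<nu> P R) 0 \<noteq> 0"
    using PR0 \<open>\<nu> \<notin> \<int>\<close> by (auto simp: poly_wr)
  have Wz: "poly (wr \<nu> P R) z \<noteq> 0" if "z \<noteq> 1" for z
  proof (cases "z = 0")
    case False
    then have "met \<nu> P R z > 0" using pos eq1 that by metis
    then show ?thesis by (auto simp: met_def)
  qed (use W0 in simp)
  \<comment> \<open>The Wronskian has no root except 1: elsewhere the metric is positive, and at 0
    the value is \<nu> P(0) R(0). By the fundamental theorem of algebra it is a constant times a
    power of z - 1.\<close>
  obtain m c where mc: "c \<noteq> 0" "wr \<nu> P R = smult c ([:-1, 1:] ^ m)"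
  proof -
    have "wr \<nu> P R \<noteq> 0" using W0 by auto
    then obtain S where S: "wr \<nu> P R = [:-1, 1:] ^ order 1 (wr \<nu> P R) * S" "\<not> [:-1, 1:] dvd S"
      using order_decomp[of "wr \<nu> P R" 1] by auto
    have "poly S z \<noteq> 0" for z
    proof (cases "z = 1")
      case True
      then show ?thesis using S(2) by (simp add: dvd_iff_poly_eq_0)
    next
      case False
      then show ?thesis using Wz[of z] by (subst (asm) S(1)) auto
    qed
    then have "degree S = 0" using alg_closed_imp_poly_has_root[of S] by auto
    then obtain c where c: "S = [:c:]" using degree_eq_zeroE by blast
    then have "c \<noteq> 0" using S(2) by auto
    moreover have "wr \<nu> P R = smult c ([:-1, 1:] ^ order 1 (wr \<nu> P R))" by (subst S(1)) (simp add: c)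
    ultimately show ?thesis using that by blast
  qed
  have np: "normal_pair \<nu> m P R" using \<open>\<nu> \<notin> \<int>\<close> \<open>coprime P R\<close> mc by (auto simp: normal_pair_def)
  obtain C0 C1 C3 where C: "C0 > 0" "((\<lambda>z. \<sigma> (Some z) / cmod (z - 0) powr (2 * \<beta>1)) \<longlongrightarrow> C0) (at 0)"
    "C1 > 0" "((\<lambda>z. \<sigma> (Some z) / cmod (z - 1) powr (2 * real \<beta>2)) \<longlongrightarrow> C1) (at 1)"
    "C3 > 0" "((\<lambda>w. \<sigma> (Some (1 / w)) / cmod w ^ 4 / cmod (w - 0) powr (2 * \<beta>3)) \<longlongrightarrow> C3) (at 0)"
    by (rule divisor_limits[OF div])
  have \<sigma>: "\<sigma> (Some z) = met \<nu> P R z" if "z \<noteq> 0" "z \<noteq> 1" for z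
    using rep eq1 that by (simp add: given_by_def)
  \<comment> \<open>Each order is computed twice, from the divisor and from \<open>met\<close>;
    uniqueness of orders identifies |\<nu>|, m and the exponent at infinity.\<close>
  obtain D0 where D0: "D0 > 0" "((\<lambda>z. met \<nu> P R z / cmod (z - 0) powr (2 * (\<bar>\<nu>\<bar> - 1))) \<longlongrightarrow> D0) (at 0)"
    by (rule met_limit_0[OF np])
  have "((\<lambda>z. \<sigma> (Some z) / cmod (z - 0) powr (2 * (\<bar>\<nu>\<bar> - 1))) \<longlongrightarrow> D0) (at 0)"
    by (rule Lim_transform_eventually[OF D0(2)], rule eventually_mono[OF eventually_avoids_0_1]) (simp add: \<sigma>)
  from order_unique[OF this D0(1) C(2,1)] have "\<bar>\<nu>\<bar> = \<beta>1 + 1" by simp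
  moreover
  obtain D1 where D1: "D1 > 0" "((\<lambda>z. met \<nu> P R z / cmod (z - 1) powr (2 * real m)) \<longlongrightarrow> D1) (at 1)"
    by (rule met_limit_1[OF np])
  have "((\<lambda>z. \<sigma> (Some z) / cmod (z - 1) powr (2 * real m)) \<longlongrightarrow> D1) (at 1)"
    by (rule Lim_transform_eventually[OF D1(2)], rule eventually_mono[OF eventually_avoids_0_1]) (simp add: \<sigma>)
  from order_unique[OF this D1(1) C(4,3)] have "m = \<beta>2" by simp
  moreover
  obtain D3 where D3: "D3 > 0" "((\<lambda>w. met \<nu> P R (1 / w) / cmod w ^ 4 /
    cmod (w - 0) powr (2 * (\<bar>\<nu> + real (degree P) - real (degree R)\<bar> - 1))) \<longlongrightarrow> D3) (at 0)"
    by (rule met_limit_infinity[OF np])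
  have "((\<lambda>w. \<sigma> (Some (1 / w)) / cmod w ^ 4 /
    cmod (w - 0) powr (2 * (\<bar>\<nu> + real (degree P) - real (degree R)\<bar> - 1))) \<longlongrightarrow> D3) (at 0)"
    by (rule Lim_transform_eventually[OF D3(2)], rule eventually_mono[OF eventually_avoids_0_1]) (simp add: \<sigma>)
  from order_unique[OF this D3(1) C(6,5)] have "\<bar>\<nu> + real (degree P) - real (degree R)\<bar> = \<beta>3 + 1" by simp
  ultimately have "adapted \<nu> P R" using np by (simp add: adapted_def)
  then show ?thesis using eq by (intro exI[of _ \<nu>] exI[of _ P] exI[of _ R]) simp
qed

lemma adapted_degree:
  assumes "adapted \<nu> P R"
  shows "\<nu> + real \<beta>2 - 2 * real (degree R) = \<beta>3 + 1 \<or> \<nu> + real \<beta>2 - 2 * real (degree R) = - (\<beta>3 + 1)"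
proof -
  have np: "normal_pair \<nu> \<beta>2 P R" and k: "\<bar>\<nu> + real (degree P) - real (degree R)\<bar> = \<beta>3 + 1"
    using assms by (auto simp: adapted_def)
  have "real \<beta>2 = real (degree P) + real (degree R)" using normal_pairD(3)[OF np] by simp
  then show ?thesis using k by (auto simp: abs_if split: if_splits)
qed

text \<open>For equal \<open>\<nu>\<close> the degrees of the denominators agree: opposite signs in
  \<open>adapted_degree\<close> would make \<beta>3 + 1 a difference of degrees, hence an integer.
  Opposite values of \<open>\<nu>\<close> are reduced to this by exchanging the pair.\<close>

lemma adapted_unique:
  assumes "adapted \<nu> P R" "adapted \<nu>' P' R'"
  shows "\<exists>t>0. \<forall>z. z \<noteq> 0 \<longrightarrow> met \<nu>' P' R' z = met \<nu> (smult (of_real t) P) R z"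
proof -
  have same: "\<exists>t>0. \<forall>z. met \<nu> P' R' z = met \<nu> (smult (of_real t) P) R z"
    if ad: "adapted \<nu> P R" "adapted \<nu> P' R'" for P' R'
  proof -
    have "degree R = degree R'"
    proof (rule ccontr)
      assume ne: "degree R \<noteq> degree R'"
      then have "\<beta>3 = real (degree R') - real (degree R) - 1 \<or> \<beta>3 = real (degree R) - real (degree R') - 1"
        using adapted_degree[OF ad(1)] adapted_degree[OF ad(2)] by auto
      moreover have "real i - real j - 1 \<in> \<int>" for i j by (intro Ints_diff) auto
      ultimately show False using \<beta>(4) by metis
    qed
    then obtain \<kappa> s where ks: "\<kappa> \<noteq> 0" "s \<noteq> 0" "R' = smult s R" "P' = smult (s * \<kappa>) P"
      using normal_pair_unique ad unfolding adapted_def by metis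
    have "met \<nu> P' R' z = met \<nu> (smult (of_real (cmod \<kappa>)) P) R z" for z
    proof -
      have "met \<nu> P' R' z = met \<nu> (smult s (smult \<kappa> P)) (smult s R) z" by (simp add: ks)
      also have "\<dots> = met \<nu> (smult \<kappa> P) R z" by (rule met_smult_common[OF ks(2)])
      also have "\<dots> = met \<nu> (smult (of_real (cmod \<kappa>)) P) R z" by (rule met_smult_cmod)
      finally show ?thesis .
    qed
    then show ?thesis using ks(1) by (intro exI[of _ "cmod \<kappa>"]) auto
  qed
  have "\<bar>\<nu>\<bar> = \<bar>\<nu>'\<bar>" using assms by (simp add: adapted_def)
  then consider "\<nu>' = \<nu>" | "\<nu>' = - \<nu>" by (auto simp: abs_if split: if_splits)
  then show ?thesis
  proof cases
    case 1
    then show ?thesis using same[of P' R'] assms by blast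
  next
    case 2
    then have "adapted \<nu> R' P'" using adapted_swap[OF assms(2)] by simp
    from same[OF assms(1) this] obtain t where t: "t > 0" "\<And>z. met \<nu> R' P' z = met \<nu> (smult (of_real t) P) R z" by blast
    have "met \<nu>' P' R' z = met \<nu> (smult (of_real t) P) R z" if "z \<noteq> 0" for z
      using met_swap[OF that, of \<nu> P' R'] t(2) 2 by simp
    then show ?thesis using t(1) by blast
  qed
qed

lemma root_system_iff:
  "root_system (\<beta>1 + 1) \<beta>2 N a \<longleftrightarrow> system_A \<beta>1 \<beta>2 N a"
  "root_system (- (\<beta>1 + 1)) \<beta>2 N a \<longleftrightarrow> system_B \<beta>1 \<beta>2 N a"
proof -
  have "- (\<beta>1 + 1) - 1 = - \<beta>1 - 2" by simp
  then show "root_system (- (\<beta>1 + 1)) \<beta>2 N a \<longleftrightarrow> system_B \<beta>1 \<beta>2 N a"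
    unfolding root_system_def system_B_def by (simp only:)
qed (simp add: root_system_def system_A_def)

lemma roots_of_adapted:
  assumes "adapted \<nu> P R"
  shows "\<exists>N a. admissible N a \<and> root_system \<nu> \<beta>2 N a \<and>
    (\<nu> + real \<beta>2 - 2 * real N = \<beta>3 + 1 \<or> \<nu> + real \<beta>2 - 2 * real N = - (\<beta>3 + 1))"
  using root_system_of_normal_pair adapted_degree[OF assms] assms unfolding adapted_def by blast

lemma metric_of_roots:
  assumes "admissible N a" "root_system \<nu> \<beta>2 N a" "\<bar>\<nu>\<bar> = \<beta>1 + 1"
    "\<nu> + real \<beta>2 - 2 * real N = \<beta>3 + 1 \<or> \<nu> + real \<beta>2 - 2 * real N = - (\<beta>3 + 1)"
  shows "\<exists>\<sigma>\<in>Met_S2. has_divisor \<sigma> div3"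
proof -
  have "\<nu> \<notin> \<int>"
  proof
    assume "\<nu> \<in> \<int>"
    then have "\<bar>\<nu>\<bar> - 1 \<in> \<int>" by simp
    then show False using \<beta>(2) assms(3) by simp
  qed
  then obtain P where np: "normal_pair \<nu> \<beta>2 P (root_prod {1..N} a)"
    using normal_pair_of_root_system assms(1,2) by blast
  let ?R = "root_prod {1..N} a"
  have "degree ?R = N" unfolding root_prod_def by (subst degree_prod_sum_eq) auto
  moreover have "real \<beta>2 = real (degree P) + real (degree ?R)" using normal_pairD(3)[OF np] by simp
  ultimately have "\<nu> + real (degree P) - real (degree ?R) = \<nu> + real \<beta>2 - 2 * real N" by simp
  then have "\<bar>\<nu> + real (degree P) - real (degree ?R)\<bar> = \<beta>3 + 1" using assms(4) \<beta>(3) by auto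
  then have "adapted \<nu> P ?R" using np assms(3) by (simp add: adapted_def)
  \<comment> \<open>The value at \<open>None\<close>, a singular point, is irrelevant.\<close>
  moreover have "given_by (\<lambda>p. met \<nu> P ?R (the p)) \<nu> P ?R" by (simp add: given_by_def)
  ultimately show ?thesis using adapted_metric by blast
qed

text \<open>The sign of \<open>\<nu>\<close> selects (A) or (B), and the sign of the exponent at
  infinity selects the linear relation between the orders.\<close>

lemma metric_iff_roots:
  "(\<exists>\<sigma>\<in>Met_S2. has_divisor \<sigma> div3) \<longleftrightarrow>
      (\<exists>N a. admissible N a \<and> \<beta>1 + real \<beta>2 + \<beta>3 = 2 * real N - 2 \<and> system_A \<beta>1 \<beta>2 N a) \<or>
      (\<exists>N a. admissible N a \<and> \<beta>1 - real \<beta>2 + \<beta>3 = - 2 * real N - 2 \<and> system_B \<beta>1 \<beta>2 N a) \<or>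
      (\<exists>N a. admissible N a \<and> \<beta>1 + real \<beta>2 - \<beta>3 = 2 * real N \<and> system_A \<beta>1 \<beta>2 N a) \<or>
      (\<exists>N a. admissible N a \<and> \<beta>1 - real \<beta>2 - \<beta>3 = - 2 * real N \<and> system_B \<beta>1 \<beta>2 N a)"
  (is "?L \<longleftrightarrow> ?A1 \<or> ?B1 \<or> ?A2 \<or> ?B2")
proof
  assume ?L
  then obtain \<sigma> where \<sigma>: "\<sigma> \<in> Met_S2" "has_divisor \<sigma> div3" by blast
  obtain \<alpha> p q where pq: "\<alpha> \<notin> \<int>" "coprime p q" "given_by \<sigma> \<alpha> p q" using metric_given_by[OF \<sigma>] by blast
  obtain \<nu> P R where ad: "adapted \<nu> P R" using adapt[OF \<sigma>(2) pq(3,1,2)] by blast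
  obtain N a where a: "admissible N a" "root_system \<nu> \<beta>2 N a"
    "\<nu> + real \<beta>2 - 2 * real N = \<beta>3 + 1 \<or> \<nu> + real \<beta>2 - 2 * real N = - (\<beta>3 + 1)"
    using roots_of_adapted[OF ad] by blast
  have "\<nu> = \<beta>1 + 1 \<or> \<nu> = - (\<beta>1 + 1)" using ad by (auto simp: adapted_def abs_if split: if_splits)
  then show "?A1 \<or> ?B1 \<or> ?A2 \<or> ?B2"
  proof
    assume \<nu>: "\<nu> = \<beta>1 + 1"
    have "system_A \<beta>1 \<beta>2 N a" using a(2) unfolding \<nu> root_system_iff .
    moreover have "\<beta>1 + real \<beta>2 + \<beta>3 = 2 * real N - 2 \<or> \<beta>1 + real \<beta>2 - \<beta>3 = 2 * real N" using a(3) \<nu> by linarith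
    ultimately show ?thesis using a(1) by blast
  next
    assume \<nu>: "\<nu> = - (\<beta>1 + 1)"
    have "system_B \<beta>1 \<beta>2 N a" using a(2) unfolding \<nu> root_system_iff .
    moreover have "\<beta>1 - real \<beta>2 + \<beta>3 = - 2 * real N - 2 \<or> \<beta>1 - real \<beta>2 - \<beta>3 = - 2 * real N" using a(3) \<nu> by linarith
    ultimately show ?thesis using a(1) by blast
  qed
next
  have A: ?L if "admissible N a" "system_A \<beta>1 \<beta>2 N a"
    "\<beta>1 + real \<beta>2 + \<beta>3 = 2 * real N - 2 \<or> \<beta>1 + real \<beta>2 - \<beta>3 = 2 * real N" for N a
    using that \<beta>(1) by (intro metric_of_roots[of N a "\<beta>1 + 1"]) (auto simp: root_system_iff)
  have B: ?L if "admissible N a" "system_B \<beta>1 \<beta>2 N a"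
    "\<beta>1 - real \<beta>2 + \<beta>3 = - 2 * real N - 2 \<or> \<beta>1 - real \<beta>2 - \<beta>3 = - 2 * real N" for N a
    using that(3) \<beta>(1) root_system_iff(2)[of N a] that(1,2)
    by (intro metric_of_roots[of N a "- (\<beta>1 + 1)"]) (simp, blast, simp, argo)
  assume "?A1 \<or> ?B1 \<or> ?A2 \<or> ?B2"
  then show ?L using A B by blast
qed

lemma metric_developed:
  assumes \<sigma>: "\<sigma> \<in> Met_S2" "has_divisor \<sigma> div3"
  shows "\<exists>\<mu> \<phi>. \<mu> \<notin> \<int> \<and> rational_function \<phi> \<and> developed_by \<sigma> \<mu> \<phi>"
proof -
  obtain \<alpha> p q where pq: "\<alpha> \<notin> \<int>" "coprime p q" "given_by \<sigma> \<alpha> p q" using metric_given_by[OF \<sigma>] by blast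
  have "q \<noteq> 0"
  proof
    assume "q = 0"
    then have "met \<alpha> p q 2 = 0" by (simp add: met_def wr_def)
    then show False using divisor_positive[OF \<sigma>(2), of 2] pq(3) by (simp add: given_by_def)
  qed
  then have "rational_function (\<lambda>z. poly p z / poly q z)" "developed_by \<sigma> \<alpha> (\<lambda>z. poly p z / poly q z)"
    using pq developed_by_iff by (auto simp: rational_function_def)
  then show ?thesis using pq(1) by blast
qed

text \<open>The given representation and that of the second metric are both brought to adapted form,
  where only a positive factor separates them. As \<open>adapt\<close> respects scaling, this factor
  is the one that multiplies \<open>\<phi>\<close>.\<close>

lemma metric_family:
  assumes \<sigma>: "has_divisor \<sigma> div3" and \<phi>: "\<mu> \<notin> \<int>" "rational_function \<phi>" "developed_by \<sigma> \<mu> \<phi>"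
  shows "\<sigma>' \<in> Met_S2 \<and> has_divisor \<sigma>' div3 \<longleftrightarrow> (\<exists>t>0. developed_by \<sigma>' \<mu> (\<lambda>z. of_real t * \<phi> z))"
proof -
  obtain p q where pq: "q \<noteq> 0" "coprime p q" and \<phi>_eq: "\<phi> = (\<lambda>z. poly p z / poly q z)"
    using \<phi>(2) unfolding rational_function_def by (metis ext)
  have "given_by \<sigma> \<mu> p q" using \<phi>(3) unfolding \<phi>_eq developed_by_iff[OF pq(2,1)] .
  from adapt[OF \<sigma> this \<phi>(1) pq(2)] obtain \<nu> P R where ad: "adapted \<nu> P R"
    and eq: "\<And>t z. z \<noteq> 0 \<Longrightarrow> met \<mu> (smult t p) q z = met \<nu> (smult t P) R z" by blast
  have dev: "developed_by \<sigma>' \<mu> (\<lambda>z. of_real t * \<phi> z) \<longleftrightarrow> given_by \<sigma>' \<nu> (smult (of_real t) P) R" if "t > 0" for t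
    unfolding \<phi>_eq developed_by_scaled_iff[OF pq(2,1) that] by (simp add: given_by_def eq)
  show ?thesis
  proof
    assume \<sigma>': "\<sigma>' \<in> Met_S2 \<and> has_divisor \<sigma>' div3"
    then obtain \<alpha> p' q' where pq': "\<alpha> \<notin> \<int>" "coprime p' q'" "given_by \<sigma>' \<alpha> p' q'" using metric_given_by by blast
    from adapt[OF _ pq'(3,1,2)] \<sigma>' obtain \<nu>' P' R' where ad': "adapted \<nu>' P' R'"
      and eq': "\<And>t z. z \<noteq> 0 \<Longrightarrow> met \<alpha> (smult t p') q' z = met \<nu>' (smult t P') R' z" by blast
    obtain t where t: "t > 0" "\<And>z. z \<noteq> 0 \<Longrightarrow> met \<nu>' P' R' z = met \<nu> (smult (of_real t) P) R z"
      using adapted_unique[OF ad ad'] by blast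
    have "given_by \<sigma>' \<nu> (smult (of_real t) P) R"
      using given_by_cong[OF pq'(3)] eq'[of _ 1] t(2) by simp
    then show "\<exists>t>0. developed_by \<sigma>' \<mu> (\<lambda>z. of_real t * \<phi> z)" using dev t(1) by blast
  next
    assume "\<exists>t>0. developed_by \<sigma>' \<mu> (\<lambda>z. of_real t * \<phi> z)"
    then obtain t where t: "t > 0" "given_by \<sigma>' \<nu> (smult (of_real t) P) R" using dev by blast
    then show "\<sigma>' \<in> Met_S2 \<and> has_divisor \<sigma>' div3"
      using adapted_metric[OF adapted_smult[OF ad, of "of_real t"]] by simp
  qed
qed

end

theorem proposition3p5:
  fixes \<beta>1 \<beta>3 :: real and \<beta>2 :: nat
  assumes "\<beta>1 > -1" and "\<beta>1 \<notin> \<int>"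
    and "\<beta>3 > -1" and "\<beta>3 \<notin> \<int>"
    and "\<beta>2 > 0"
  shows "((\<exists>\<sigma>\<in>Met_S2. has_divisor \<sigma> (divisor_01inf \<beta>1 (real \<beta>2) \<beta>3)) \<longleftrightarrow>
      (\<exists>N a. admissible N a \<and> \<beta>1 + real \<beta>2 + \<beta>3 = 2 * real N - 2 \<and> system_A \<beta>1 \<beta>2 N a) \<or>
      (\<exists>N a. admissible N a \<and> \<beta>1 - real \<beta>2 + \<beta>3 = - 2 * real N - 2 \<and> system_B \<beta>1 \<beta>2 N a) \<or>
      (\<exists>N a. admissible N a \<and> \<beta>1 + real \<beta>2 - \<beta>3 = 2 * real N \<and> system_A \<beta>1 \<beta>2 N a) \<or>
      (\<exists>N a. admissible N a \<and> \<beta>1 - real \<beta>2 - \<beta>3 = - 2 * real N \<and> system_B \<beta>1 \<beta>2 N a)) \<and>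
    (\<forall>\<sigma>\<in>Met_S2. has_divisor \<sigma> (divisor_01inf \<beta>1 (real \<beta>2) \<beta>3) \<longrightarrow>
      (\<exists>\<mu> \<phi>. \<mu> \<notin> \<int> \<and> rational_function \<phi> \<and> developed_by \<sigma> \<mu> \<phi>) \<and>
      (\<forall>\<mu> \<phi>. \<mu> \<notin> \<int> \<and> rational_function \<phi> \<and> developed_by \<sigma> \<mu> \<phi> \<longrightarrow>
        (\<forall>\<sigma>'. \<sigma>' \<in> Met_S2 \<and> has_divisor \<sigma>' (divisor_01inf \<beta>1 (real \<beta>2) \<beta>3) \<longleftrightarrow>
          (\<exists>t>0. developed_by \<sigma>' \<mu> (\<lambda>z. of_real t * \<phi> z)))))"
  using metric_iff_roots[OF assms] metric_developed[OF assms] metric_family[OF assms]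
  by (intro conjI ballI impI allI; blast)

end
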